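(* Let $(\mathfrak{M}, \tau)$ be a tracial von Neumann algebra and let $T, C \in \mathfrak{M}$ be positive. Then \[ V_C(T) = \left[ \int^1_0 \lambda_T(s) \lambda_C(1-s) \, ds,\ \int^1_{0} \lambda_T(s) \lambda_C(s)\, ds \right]. \]
   Context: A tracial von Neumann algebra is a pair $(\mathfrak{M},\tau)$ with $\mathfrak{M}$ a von Neumann algebra and $\tau$ a normal, faithful, tracial state on $\mathfrak{M}$. $\mathfrak{M}_{\mathrm{sa}}$ is the set of self-adjoint elements of $\mathfrak{M}$. For a normal operator $N$ and a Borel set $B\subseteq\mathbb{C}$, $1_B(N)$ is the spectral projection of $N$ for $B$. For $T\in\mathfrak{M}_{\mathrm{sa}}$ the eigenvalue function of $T$ is $\lambda_T(s) = \inf\{t\in\mathbb{R} \mid \tau(1_{(t,\infty)}(T))\le s\}$ for $s\in[0,1)$. For real-valued $f,g\in L^\infty[0,1]$, write $g\prec f$ ($f$ majorizes $g$) if $\int_0^t g(x)\,dx\le\int_0^t f(x)\,dx$ for all $t\in[0,1]$ and $\int_0^1 g(x)\,dx=\int_0^1 f(x)\,dx$. For $C\in\mathfrak{M}_{\mathrm{sa}}$ and $T\in\mathfrak{M}$, the $C$-numerical range of $T$ is $V_C(T)=\{\tau(TX)\mid X\in\mathfrak{M}_{\mathrm{sa}},\ \lambda_X\prec\lambda_C\}$. *)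

theory Defs
  imports "HOL-Analysis.Analysis"
begin

text \<open>
  Complex Hilbert spaces, as real Hilbert spaces with a compatible complex structure.
  The inner product is linear in its first argument.  The real inner product and the
  real scalar multiplication are those of the underlying real Hilbert space.
\<close>

class complex_hilbert_space = real_inner + complete_space +
  fixes scaleC :: "complex \<Rightarrow> 'a \<Rightarrow> 'a"  (infixr "*\<^sub>C" 75)
    and cinner :: "'a \<Rightarrow> 'a \<Rightarrow> complex"
  assumes scaleC_add_right: "c *\<^sub>C (x + y) = c *\<^sub>C x + c *\<^sub>C y"
    and scaleC_add_left: "(c + d) *\<^sub>C x = c *\<^sub>C x + d *\<^sub>C x"
    and scaleC_scaleC: "c *\<^sub>C d *\<^sub>C x = (c * d) *\<^sub>C x"
    and scaleC_of_real: "complex_of_real r *\<^sub>C x = r *\<^sub>R x"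
    and cinner_add_left: "cinner (x + y) z = cinner x z + cinner y z"
    and cinner_scaleC_left: "cinner (c *\<^sub>C x) y = c * cinner x y"
    and cinner_commute: "cinner y x = cnj (cinner x y)"
    and inner_eq_Re_cinner: "x \<bullet> y = Re (cinner x y)"
begin

lemma cinner_self: "cinner x x = complex_of_real ((norm x)\<^sup>2)"
proof -
  have "Im (cinner x x) = 0"
    using cinner_commute[of x x] by (metis cnj.simps(2) equal_neg_zero)
  moreover have "Re (cinner x x) = (norm x)\<^sup>2"
    by (metis inner_eq_Re_cinner power2_norm_eq_inner)
  ultimately show ?thesis by (simp add: complex_eq_iff)
qed

lemma norm_scaleC: "norm (c *\<^sub>C x) = cmod c * norm x"
proof -
  have "cinner (c *\<^sub>C x) (c *\<^sub>C x) = c * cnj (c * cinner x x)"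
    by (metis cinner_commute cinner_scaleC_left)
  also have "\<dots> = (c * cnj c) * complex_of_real ((norm x)\<^sup>2)"
    by (simp add: cinner_self)
  also have "\<dots> = complex_of_real ((cmod c * norm x)\<^sup>2)"
    by (simp add: complex_mult_cnj cmod_power2 power_mult_distrib)
  finally have "complex_of_real ((norm (c *\<^sub>C x))\<^sup>2) = complex_of_real ((cmod c * norm x)\<^sup>2)"
    by (simp only: cinner_self)
  then have "(norm (c *\<^sub>C x))\<^sup>2 = (cmod c * norm x)\<^sup>2"
    using of_real_eq_iff by blast
  then show ?thesis
    by (simp add: power2_eq_iff_nonneg)
qed

end

text \<open>
  Operators are elements of the library type of bounded real-linear maps; the bounded
  operators on the complex Hilbert space are the complex-linear ones among them.
\<close>

definition bounded_ops :: "('h::complex_hilbert_space \<Rightarrow>\<^sub>L 'h) set" where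
  "bounded_ops = {A. \<forall>c x. blinfun_apply A (c *\<^sub>C x) = c *\<^sub>C blinfun_apply A x}"

lift_definition scale_op ::
  "complex \<Rightarrow> ('h::complex_hilbert_space \<Rightarrow>\<^sub>L 'h) \<Rightarrow> ('h \<Rightarrow>\<^sub>L 'h)"
  is "\<lambda>c A x. c *\<^sub>C A x"
proof -
  fix c :: complex and A :: "'h \<Rightarrow> 'h"
  assume A: "bounded_linear A"
  have "bounded_linear (\<lambda>x::'h. c *\<^sub>C x)"
  proof (rule bounded_linear_intro[where K = "cmod c"])
    show "c *\<^sub>C (r *\<^sub>R x) = r *\<^sub>R (c *\<^sub>C x)" for r and x :: 'h
      by (simp add: scaleC_of_real[symmetric] scaleC_scaleC mult.commute)
  qed (simp_all add: scaleC_add_right norm_scaleC mult.commute)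
  from bounded_linear_compose[OF this A] show "bounded_linear (\<lambda>x. c *\<^sub>C A x)" .
qed

definition adj :: "('h::complex_hilbert_space \<Rightarrow>\<^sub>L 'h) \<Rightarrow> ('h \<Rightarrow>\<^sub>L 'h)" where
  "adj A = (THE B. \<forall>x y. cinner (blinfun_apply A x) y = cinner x (blinfun_apply B y))"

definition positive_op :: "('h::complex_hilbert_space \<Rightarrow>\<^sub>L 'h) \<Rightarrow> bool" where
  "positive_op A \<longleftrightarrow> A \<in> bounded_ops \<and> (\<forall>x. cinner (blinfun_apply A x) x \<in> \<real>\<^sub>\<ge>\<^sub>0)"

definition op_le :: "('h::complex_hilbert_space \<Rightarrow>\<^sub>L 'h) \<Rightarrow> ('h \<Rightarrow>\<^sub>L 'h) \<Rightarrow> bool" where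
  "op_le A B \<longleftrightarrow> positive_op (B - A)"

definition is_projection :: "('h::complex_hilbert_space \<Rightarrow>\<^sub>L 'h) \<Rightarrow> bool" where
  "is_projection P \<longleftrightarrow> P \<in> bounded_ops \<and> adj P = P \<and> P o\<^sub>L P = P"

definition commutant ::
  "('h::complex_hilbert_space \<Rightarrow>\<^sub>L 'h) set \<Rightarrow> ('h \<Rightarrow>\<^sub>L 'h) set" where
  "commutant S = {A \<in> bounded_ops. \<forall>B\<in>S. A o\<^sub>L B = B o\<^sub>L A}"

locale von_neumann_algebra =
  fixes M :: "('h::complex_hilbert_space \<Rightarrow>\<^sub>L 'h) set"
  assumes adj_closed: "A \<in> M \<Longrightarrow> adj A \<in> M"
    and double_commutant: "commutant (commutant M) = M"

definition selfadjoint_part ::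
  "('h::complex_hilbert_space \<Rightarrow>\<^sub>L 'h) set \<Rightarrow> ('h \<Rightarrow>\<^sub>L 'h) set" where
  "selfadjoint_part M = {A \<in> M. adj A = A}"

definition is_lub_sa ::
  "('h::complex_hilbert_space \<Rightarrow>\<^sub>L 'h) set \<Rightarrow> ('h \<Rightarrow>\<^sub>L 'h) set \<Rightarrow> ('h \<Rightarrow>\<^sub>L 'h) \<Rightarrow> bool" where
  "is_lub_sa M D S \<longleftrightarrow> S \<in> selfadjoint_part M \<and> (\<forall>A\<in>D. op_le A S) \<and>
     (\<forall>S'\<in>selfadjoint_part M. (\<forall>A\<in>D. op_le A S') \<longrightarrow> op_le S S')"

text \<open>
  Only the values of \<open>\<tau>\<close> on \<open>M\<close> matter.  Normality is preservation of suprema of upward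
  directed families of self-adjoint elements.
\<close>

locale tracial_von_neumann_algebra = von_neumann_algebra M
  for M :: "('h::complex_hilbert_space \<Rightarrow>\<^sub>L 'h) set" +
  fixes \<tau> :: "('h \<Rightarrow>\<^sub>L 'h) \<Rightarrow> complex"
  assumes tau_add: "A \<in> M \<Longrightarrow> B \<in> M \<Longrightarrow> \<tau> (A + B) = \<tau> A + \<tau> B"
    and tau_scale: "A \<in> M \<Longrightarrow> \<tau> (scale_op c A) = c * \<tau> A"
    and tau_positive: "A \<in> M \<Longrightarrow> \<tau> (adj A o\<^sub>L A) \<in> \<real>\<^sub>\<ge>\<^sub>0"
    and tau_one: "\<tau> id_blinfun = 1"
    and tau_tracial: "A \<in> M \<Longrightarrow> B \<in> M \<Longrightarrow> \<tau> (A o\<^sub>L B) = \<tau> (B o\<^sub>L A)"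
    and tau_faithful: "A \<in> M \<Longrightarrow> \<tau> (adj A o\<^sub>L A) = 0 \<Longrightarrow> A = 0"
    and tau_normal: "D \<subseteq> selfadjoint_part M \<Longrightarrow> D \<noteq> {} \<Longrightarrow>
        (\<And>A B. A \<in> D \<Longrightarrow> B \<in> D \<Longrightarrow> \<exists>R\<in>D. op_le A R \<and> op_le B R) \<Longrightarrow>
        is_lub_sa M D S \<Longrightarrow> Re (\<tau> S) = (SUP A\<in>D. Re (\<tau> A))"

definition projection_valued_measure ::
  "(complex set \<Rightarrow> ('h::complex_hilbert_space \<Rightarrow>\<^sub>L 'h)) \<Rightarrow> bool" where
  "projection_valued_measure E \<longleftrightarrow>
     (\<forall>B\<in>sets borel. is_projection (E B)) \<and>
     E UNIV = id_blinfun \<and>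
     (\<forall>A\<in>sets borel. \<forall>B\<in>sets borel. E (A \<inter> B) = E A o\<^sub>L E B) \<and>
     (\<forall>B. range B \<subseteq> sets borel \<longrightarrow> disjoint_family B \<longrightarrow>
        (\<forall>x. (\<lambda>n::nat. blinfun_apply (E (B n)) x) sums blinfun_apply (E (\<Union>n. B n)) x))"

definition scalar_measure ::
  "(complex set \<Rightarrow> ('h::complex_hilbert_space \<Rightarrow>\<^sub>L 'h)) \<Rightarrow> 'h \<Rightarrow> complex measure" where
  "scalar_measure E x =
     measure_of UNIV (sets borel) (\<lambda>B. ennreal (Re (cinner (blinfun_apply (E B) x) x)))"

text \<open>
  \<open>N = \<integral> z dE(z)\<close> in the weak sense.  By polarization it suffices to test it on the
  diagonal, where only positive measures occur.
\<close>

definition spectral_resolution ::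
  "('h::complex_hilbert_space \<Rightarrow>\<^sub>L 'h) \<Rightarrow> (complex set \<Rightarrow> ('h \<Rightarrow>\<^sub>L 'h)) \<Rightarrow> bool" where
  "spectral_resolution N E \<longleftrightarrow> projection_valued_measure E \<and>
     (\<forall>x. integrable (scalar_measure E x) (\<lambda>z. z) \<and>
          cinner (blinfun_apply N x) x = (\<integral>z. z \<partial>scalar_measure E x))"

text \<open>
  The projection \<open>1\<^sub>B(N)\<close>, for \<open>N\<close> normal and \<open>B\<close> Borel.  The description is of the value
  at \<open>B\<close> and not of \<open>E\<close> itself, as \<open>E\<close> is determined only on the Borel sets.
\<close>

definition spectral_projection ::
  "('h::complex_hilbert_space \<Rightarrow>\<^sub>L 'h) \<Rightarrow> complex set \<Rightarrow> ('h \<Rightarrow>\<^sub>L 'h)" where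
  "spectral_projection N B = (THE P. \<exists>E. spectral_resolution N E \<and> P = E B)"

text \<open>
  Meaningful for \<open>0 \<le> s < 1\<close> only (for \<open>s = 1\<close> the set is unbounded below); the functions
  below are integrated over \<open>[0,1]\<close>, so that the endpoint plays no role.  The trace of a
  projection is real, so nothing is lost by taking the real part.
\<close>

definition eigenvalue_function ::
  "(('h::complex_hilbert_space \<Rightarrow>\<^sub>L 'h) \<Rightarrow> complex) \<Rightarrow> ('h \<Rightarrow>\<^sub>L 'h) \<Rightarrow> real \<Rightarrow> real" where
  "eigenvalue_function \<tau> T s =
     Inf {t. Re (\<tau> (spectral_projection T (complex_of_real ` {t<..}))) \<le> s}"

definition majorizes :: "(real \<Rightarrow> real) \<Rightarrow> (real \<Rightarrow> real) \<Rightarrow> bool" where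
  "majorizes f g \<longleftrightarrow>
     (\<forall>t\<in>{0..1}. (LINT x:{0..t}|lborel. g x) \<le> (LINT x:{0..t}|lborel. f x)) \<and>
     (LINT x:{0..1}|lborel. g x) = (LINT x:{0..1}|lborel. f x)"

definition C_numerical_range ::
  "('h::complex_hilbert_space \<Rightarrow>\<^sub>L 'h) set \<Rightarrow> (('h \<Rightarrow>\<^sub>L 'h) \<Rightarrow> complex) \<Rightarrow>
     ('h \<Rightarrow>\<^sub>L 'h) \<Rightarrow> ('h \<Rightarrow>\<^sub>L 'h) \<Rightarrow> complex set" where
  "C_numerical_range M \<tau> C T =
     {\<tau> (T o\<^sub>L X) | X. X \<in> selfadjoint_part M \<and>
        majorizes (eigenvalue_function \<tau> C) (eigenvalue_function \<tau> X)}"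

end

theory Submission
  imports Defs
begin

text \<open>
  Write \<open>P\<^sub>t\<close> for the spectral projection of \<open>T\<close> for \<open>(t,\<infinity>)\<close>, so that \<open>s < \<tau>(P\<^sub>t)\<close> if and only
  if \<open>t < \<lambda>\<^sub>T(s)\<close>.  As \<open>T \<ge> 0\<close>, the operator \<open>T\<close> is the integral of \<open>P\<^sub>t\<close> over \<open>t \<ge> 0\<close>, and
  \<open>\<tau>(TX)\<close> is controlled by the numbers \<open>\<tau>(P\<^sub>tX)\<close>.

  For a projection \<open>P\<close>, a self-adjoint \<open>X\<close> and any real \<open>r\<close>, the inequality
  \<open>X - r \<le> (X - r)\<^sub>+\<close> and the trace property give \<open>\<tau>(PX) \<le> r \<tau>(P) + \<tau>((X - r)\<^sub>+)\<close>.  The best \<open>r\<close> turns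
  the right-hand side into the integral of \<open>\<lambda>\<^sub>X\<close> over \<open>[0, \<tau>(P)]\<close>, which for \<open>\<lambda>\<^sub>X \<prec> \<lambda>\<^sub>C\<close> is at most that
  of \<open>\<lambda>\<^sub>C\<close>.  Taking \<open>P = P\<^sub>t\<close> and integrating over \<open>t\<close> yields the upper bound; \<open>P = 1 - P\<^sub>t\<close>,
  together with \<open>\<tau>(X) = \<tau>(C)\<close>, yields the lower one (\<open>tr_compose_bounds\<close>, from
  \<open>tr_compose_le_integral\<close>).

  Every value in between is attained by a function of \<open>T\<close>.  For \<open>u \<in> [0,1]\<close> put
  \<open>h(s) = (1 - u) \<lambda>\<^sub>C(1 - s) + u \<lambda>\<^sub>C(s)\<close>, and let \<open>g\<close> be a Borel function for which \<open>g \<circ> \<lambda>\<^sub>T\<close> is the conditional expectation of \<open>h\<close> given \<open>\<lambda>\<^sub>T\<close>.  Conditioning is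
  what copes with atoms: where \<open>\<lambda>\<^sub>T\<close> is constant, \<open>M\<close> need not contain projections of intermediate
  trace, and \<open>h\<close> has to be averaged.  The operator \<open>X = g(T)\<close> satisfies \<open>\<tau>(P\<^sub>tX) = \<integral> h\<close> over
  \<open>[0, \<tau>(P\<^sub>t)]\<close>, hence \<open>\<tau>(TX) = \<integral> \<lambda>\<^sub>T h\<close>, and this runs through the whole interval with \<open>u\<close>.
  The majorization \<open>\<lambda>\<^sub>X \<prec> \<lambda>\<^sub>C\<close> amounts to \<open>\<integral> (\<lambda>\<^sub>X - r)\<^sub>+ \<le> \<integral> (\<lambda>\<^sub>C - r)\<^sub>+\<close> for all \<open>r\<close> and equal
  integrals: convexity and the symmetry \<open>s \<mapsto> 1 - s\<close> give it for \<open>h\<close>, and Jensen's inequality passes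
  it on to \<open>g \<circ> \<lambda>\<^sub>T\<close> (\<open>majorized_operator_exists\<close>).

  The spectral theorem is proved for symmetric operators on a \<^emph>\<open>real\<close> Hilbert
  space, with the property that all operators constructed from \<open>X\<close> commute with everything that
  commutes with \<open>X\<close>.  Applied to multiplication by \<open>\<i>\<close> this gives complex linearity, and applied to
  the commutant of \<open>M\<close> it gives membership in \<open>M\<close>.  Spectral projections of half-lines are
  characterised by an order condition (\<open>cuts\<close>), which determines them among all projections
  commuting with \<open>X\<close>; this identifies them with the values of any spectral resolution.  The Borel
  functional calculus is built so that the quadratic forms and the trace of \<open>g(X)\<close> are computed by
  one and the same induction (\<open>represents\<close>).
\<close>

section \<open>Symmetric operators on a real Hilbert space\<close>

definition sym_op :: "('a::real_inner \<Rightarrow>\<^sub>L 'a) \<Rightarrow> bool" where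
  "sym_op A \<longleftrightarrow> (\<forall>x y. A x \<bullet> y = x \<bullet> A y)"

definition pos_op :: "('a::real_inner \<Rightarrow>\<^sub>L 'a) \<Rightarrow> bool" where
  "pos_op A \<longleftrightarrow> sym_op A \<and> (\<forall>x. 0 \<le> A x \<bullet> x)"

definition commutes :: "('a::real_normed_vector \<Rightarrow>\<^sub>L 'a) \<Rightarrow> ('a \<Rightarrow>\<^sub>L 'a) \<Rightarrow> bool" where
  "commutes A B \<longleftrightarrow> (\<forall>x. A (B x) = B (A x))"

text \<open>
  Membership of \<open>A\<close> in the double commutant of \<open>X\<close>, taken among all bounded real-linear operators.
\<close>

definition bicommutes :: "('a::real_normed_vector \<Rightarrow>\<^sub>L 'a) \<Rightarrow> ('a \<Rightarrow>\<^sub>L 'a) \<Rightarrow> bool" where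
  "bicommutes X A \<longleftrightarrow> (\<forall>B. commutes B X \<longrightarrow> commutes B A)"

lemmas blin_simps = blinfun.add_left blinfun.add_right blinfun.diff_left blinfun.diff_right
  blinfun.scaleR_left blinfun.scaleR_right blinfun.minus_left blinfun.minus_right
  blinfun.zero_left blinfun.zero_right

lemma sym_opD: "sym_op A \<Longrightarrow> A x \<bullet> y = x \<bullet> A y"
  unfolding sym_op_def by blast

lemma pos_opD: "pos_op A \<Longrightarrow> 0 \<le> A x \<bullet> x" and pos_op_sym: "pos_op A \<Longrightarrow> sym_op A"
  unfolding pos_op_def by blast+

lemma sym_op_intros:
  "sym_op A \<Longrightarrow> sym_op B \<Longrightarrow> sym_op (A + B)"
  "sym_op A \<Longrightarrow> sym_op B \<Longrightarrow> sym_op (A - B)"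
  "sym_op A \<Longrightarrow> sym_op (c *\<^sub>R A)"
  "sym_op A \<Longrightarrow> sym_op (- A)"
  "sym_op id_blinfun"
  "sym_op 0"
  "sym_op A \<Longrightarrow> sym_op (A o\<^sub>L A)"
  unfolding sym_op_def by (simp_all add: blin_simps inner_simps)

lemma commutesD: "commutes A B \<Longrightarrow> A (B x) = B (A x)"
  unfolding commutes_def by blast

lemma commutes_sym: "commutes A B \<Longrightarrow> commutes B A"
  unfolding commutes_def by simp

lemma commutes_intros:
  "commutes X A \<Longrightarrow> commutes X B \<Longrightarrow> commutes X (A + B)"
  "commutes X A \<Longrightarrow> commutes X B \<Longrightarrow> commutes X (A - B)"
  "commutes X A \<Longrightarrow> commutes X (c *\<^sub>R A)"
  "commutes X A \<Longrightarrow> commutes X (- A)"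
  "commutes X A \<Longrightarrow> commutes X B \<Longrightarrow> commutes X (A o\<^sub>L B)"
  "commutes X id_blinfun"
  "commutes X 0"
  "commutes X X"
  unfolding commutes_def by (simp_all add: blin_simps)

lemma bicommutes_intros:
  "bicommutes X A \<Longrightarrow> bicommutes X B \<Longrightarrow> bicommutes X (A + B)"
  "bicommutes X A \<Longrightarrow> bicommutes X B \<Longrightarrow> bicommutes X (A - B)"
  "bicommutes X A \<Longrightarrow> bicommutes X (c *\<^sub>R A)"
  "bicommutes X A \<Longrightarrow> bicommutes X (- A)"
  "bicommutes X A \<Longrightarrow> bicommutes X B \<Longrightarrow> bicommutes X (A o\<^sub>L B)"
  "bicommutes X id_blinfun"
  "bicommutes X 0"
  "bicommutes X X"
  unfolding bicommutes_def by (blast intro: commutes_intros)+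

lemma bicommutes_trans: "bicommutes X Y \<Longrightarrow> bicommutes Y Z \<Longrightarrow> bicommutes X Z"
  unfolding bicommutes_def by blast

lemma bicommutesD: "bicommutes X A \<Longrightarrow> commutes B X \<Longrightarrow> commutes B A"
  unfolding bicommutes_def by blast

lemma bicommutes_commute:
  "bicommutes X A \<Longrightarrow> bicommutes X B \<Longrightarrow> commutes A B"
  using bicommutesD commutes_sym commutes_intros(8) by blast

lemma sym_op_compose:
  assumes "sym_op A" "sym_op B" "commutes A B"
  shows "sym_op (A o\<^sub>L B)"
  unfolding sym_op_def
proof (intro allI)
  fix x y
  show "(A o\<^sub>L B) x \<bullet> y = x \<bullet> (A o\<^sub>L B) y"
    using sym_opD[OF assms(1), of "B x" y] sym_opD[OF assms(2), of x "A y"] commutesD[OF assms(3), of y] by simp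
qed

lemma sym_op_bicommutes_compose:
  assumes "sym_op A" "sym_op B" "bicommutes X A" "bicommutes X B"
  shows "sym_op (A o\<^sub>L B)"
  using assms bicommutes_commute sym_op_compose by blast

text \<open>
  Polarization: evaluating the form of the difference \<open>D\<close> at \<open>x + D x\<close> leaves \<open>2 \<parallel>D x\<parallel>\<^sup>2\<close>.
\<close>

lemma sym_op_eqI:
  assumes A: "sym_op A" and B: "sym_op B" and q: "\<And>x. A x \<bullet> x = B x \<bullet> x"
  shows "A = B"
proof (rule blinfun_eqI)
  fix x
  define D where "D = A - B"
  have D: "sym_op D" unfolding D_def by (intro sym_op_intros A B)
  have q0: "D x \<bullet> x = 0" for x
    using q[of x] by (simp add: D_def blin_simps inner_simps)
  have "D (x + D x) \<bullet> (x + D x) = D x \<bullet> x + D (D x) \<bullet> D x + 2 * (D x \<bullet> D x)"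
    using sym_opD[OF D, of "D x" x] by (simp add: blin_simps inner_simps inner_commute)
  then have "D x \<bullet> D x = 0" by (simp add: q0)
  then show "A x = B x" by (simp add: D_def blin_simps)
qed

lemma pos_op_cauchy_schwarz:
  assumes A: "pos_op A"
  shows "(A x \<bullet> y)\<^sup>2 \<le> (A x \<bullet> x) * (A y \<bullet> y)"
proof -
  define a b c where "a = A x \<bullet> x" and "b = A x \<bullet> y" and "c = A y \<bullet> y"
  have q: "0 \<le> a + 2 * t * b + t\<^sup>2 * c" for t
  proof -
    have "0 \<le> A (x + t *\<^sub>R y) \<bullet> (x + t *\<^sub>R y)" by (rule pos_opD[OF A])
    also have "\<dots> = a + 2 * t * b + t\<^sup>2 * c"
      using sym_opD[OF pos_op_sym[OF A], of y x]
      by (simp add: blin_simps inner_simps a_def b_def c_def power2_eq_square algebra_simps inner_commute)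
    finally show ?thesis .
  qed
  have c: "0 \<le> c" unfolding c_def by (rule pos_opD[OF A])
  show ?thesis
  proof (cases "c = 0")
    case True
    have "b = 0"
    proof (rule ccontr)
      assume b: "b \<noteq> 0"
      have "0 \<le> a + 2 * (- (a + 1) / (2 * b)) * b" using q[of "- (a + 1) / (2 * b)"] True by simp
      also have "\<dots> = -1" using b by (simp add: field_simps)
      finally show False by simp
    qed
    then show ?thesis using True by (simp flip: a_def b_def c_def)
  next
    case False
    have "0 \<le> a + 2 * (- b / c) * b + (- b / c)\<^sup>2 * c" by (rule q)
    also have "\<dots> = a - b\<^sup>2 / c" using False by (simp add: field_simps power2_eq_square)
    finally have "b\<^sup>2 \<le> a * c" using c False by (simp add: field_simps)
    then show ?thesis by (simp flip: a_def b_def c_def)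
  qed
qed

text \<open>
  For positive operators, bounds on the quadratic form control the operator itself; this is the
  Cauchy-Schwarz inequality of the form, applied to \<open>x\<close> and \<open>A x\<close>.
\<close>

lemma pos_op_norm_sq_le:
  assumes A: "pos_op A" and c: "\<And>x. A x \<bullet> x \<le> c * (x \<bullet> x)"
  shows "A x \<bullet> A x \<le> c * (A x \<bullet> x)"
proof (cases "A x = 0")
  case False
  have "(A x \<bullet> A x)\<^sup>2 \<le> (A x \<bullet> x) * (A (A x) \<bullet> A x)"
    by (rule pos_op_cauchy_schwarz[OF A])
  also have "\<dots> \<le> (A x \<bullet> x) * (c * (A x \<bullet> A x))"
    by (intro mult_left_mono c pos_opD A)
  finally have "(A x \<bullet> A x) * (A x \<bullet> A x) \<le> (c * (A x \<bullet> x)) * (A x \<bullet> A x)"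
    by (simp add: power2_eq_square mult_ac)
  then show ?thesis by (rule mult_right_le_imp_le) (simp add: False)
qed simp

lemma pos_op_norm_le:
  assumes A: "pos_op A" and c: "\<And>x. A x \<bullet> x \<le> c * (x \<bullet> x)" and "0 \<le> c"
  shows "norm (A x) \<le> c * norm x"
proof -
  have "A x \<bullet> A x \<le> c * (A x \<bullet> x)" by (rule pos_op_norm_sq_le[OF A c])
  also have "\<dots> \<le> c * (c * (x \<bullet> x))" by (intro mult_left_mono c assms)
  finally have "(norm (A x))\<^sup>2 \<le> (c * norm x)\<^sup>2"
    by (simp add: power2_norm_eq_inner power_mult_distrib power2_eq_square[of c] mult.assoc)
  then show ?thesis using \<open>0 \<le> c\<close> by (auto intro: power2_le_imp_le)
qed

lemma quad_le_norm: "\<bar>(A::'a::real_inner \<Rightarrow>\<^sub>L 'a) x \<bullet> x\<bar> \<le> norm A * (x \<bullet> x)"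
proof -
  have "\<bar>A x \<bullet> x\<bar> \<le> norm (A x) * norm x" by (rule Cauchy_Schwarz_ineq2)
  also have "\<dots> \<le> (norm A * norm x) * norm x" by (intro mult_right_mono norm_blinfun) simp
  also have "\<dots> = norm A * (x \<bullet> x)" by (simp add: dot_square_norm power2_eq_square)
  finally show ?thesis .
qed

lemma pos_op_kernel:
  assumes A: "pos_op A" and "A x \<bullet> x = 0"
  shows "A x = 0"
  using pos_op_norm_sq_le[OF A, of "norm A" x] quad_le_norm[of A] assms(2)
  by (metis abs_ge_self inner_eq_zero_iff inner_ge_zero mult_zero_right order_antisym order_trans)

lemma pos_op_sandwich:
  assumes S: "sym_op S" and A: "pos_op A" shows "pos_op (S o\<^sub>L A o\<^sub>L S)"
proof -
  have "S (A (S x)) \<bullet> y = x \<bullet> S (A (S y))" for x y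
    using sym_opD[OF S] sym_opD[OF pos_op_sym[OF A]] by simp
  moreover have "0 \<le> S (A (S x)) \<bullet> x" for x
    using pos_opD[OF A, of "S x"] sym_opD[OF S, of "A (S x)" x] by simp
  ultimately show ?thesis by (simp add: pos_op_def sym_op_def)
qed

lemma pos_op_square: assumes S: "sym_op S" shows "pos_op (S o\<^sub>L S)"
  using sym_opD[OF S, of "S x" x for x] sym_op_intros(7)[OF S]
  by (simp add: pos_op_def)

lemma pos_op_intros:
  "pos_op A \<Longrightarrow> pos_op B \<Longrightarrow> pos_op (A + B)"
  "pos_op A \<Longrightarrow> 0 \<le> c \<Longrightarrow> pos_op (c *\<^sub>R A)"
  "pos_op id_blinfun"
  "pos_op 0"
  unfolding pos_op_def by (simp_all add: sym_op_intros blin_simps inner_simps)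

lemma pos_op_normalize:
  assumes A: "pos_op A"
  obtains k where "0 < k" "pos_op ((1 / k) *\<^sub>R A)" "\<And>x. ((1 / k) *\<^sub>R A) x \<bullet> x \<le> x \<bullet> x"
proof
  show k: "0 < norm A + 1" by (simp add: add_nonneg_pos)
  then show "pos_op ((1 / (norm A + 1)) *\<^sub>R A)" using A by (simp add: pos_op_intros)
  show "((1 / (norm A + 1)) *\<^sub>R A) x \<bullet> x \<le> x \<bullet> x" for x
  proof -
    have "A x \<bullet> x \<le> norm A * (x \<bullet> x)" using quad_le_norm[of A x] by linarith
    also have "\<dots> \<le> (norm A + 1) * (x \<bullet> x)" by (intro mult_right_mono) auto
    finally show ?thesis using k by (simp add: blin_simps field_simps)
  qed
qed

section \<open>Bounded monotone sequences converge strongly\<close>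

text \<open>
  Vigier's theorem.  By \<open>pos_op_norm_sq_le\<close>, the distance \<open>\<parallel>A\<^sub>n x - A\<^sub>m x\<parallel>\<^sup>2\<close> is at most a constant times
  the increment of the bounded monotone sequence \<open>\<langle>A\<^sub>n x, x\<rangle>\<close>.
\<close>

lemma monotone_operator_limit:
  fixes A :: "nat \<Rightarrow> ('a::{real_inner,complete_space} \<Rightarrow>\<^sub>L 'a)"
  assumes sym: "\<And>n. sym_op (A n)"
    and inc: "\<And>n x. A n x \<bullet> x \<le> A (Suc n) x \<bullet> x"
    and bdd: "\<And>n x. A n x \<bullet> x \<le> c * (x \<bullet> x)"
  obtains L where "sym_op L" "\<forall>x. (\<lambda>n. A n x) \<longlonglongrightarrow> L x"
    "\<forall>X. (\<forall>n. bicommutes X (A n)) \<longrightarrow> bicommutes X L"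
proof -
  have mono: "A m x \<bullet> x \<le> A n x \<bullet> x" if "m \<le> n" for m n x
    using lift_Suc_mono_le[of "\<lambda>n. A n x \<bullet> x", OF inc that] .
  define K where "K = \<bar>c\<bar> + norm (A 0)"
  have K0: "0 \<le> K" unfolding K_def by simp
  have pos: "pos_op (A n - A m)" if "m \<le> n" for m n
    using mono[OF that] unfolding pos_op_def
    by (simp add: sym_op_intros sym blin_simps inner_simps)
  have K: "(A n - A m) x \<bullet> x \<le> K * (x \<bullet> x)" if "m \<le> n" for m n x
  proof -
    have "A n x \<bullet> x \<le> \<bar>c\<bar> * (x \<bullet> x)"
      using bdd[of n x] by (meson abs_ge_self inner_ge_zero mult_right_mono order_trans)
    moreover have "- (norm (A 0) * (x \<bullet> x)) \<le> A 0 x \<bullet> x"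
      using quad_le_norm[of "A 0" x] by linarith
    moreover have "A 0 x \<bullet> x \<le> A m x \<bullet> x" by (rule mono) simp
    ultimately show ?thesis unfolding K_def
      by (simp add: blin_simps inner_simps algebra_simps)
  qed
  have sq: "(norm (A n x - A m x))\<^sup>2 \<le> K * (A n x \<bullet> x - A m x \<bullet> x)" if "m \<le> n" for m n x
    using pos_op_norm_sq_le[OF pos[OF that] K[OF that], of x]
    by (simp add: power2_norm_eq_inner blin_simps inner_simps)
  have conv: "convergent (\<lambda>n. A n x)" for x
  proof -
    have "incseq (\<lambda>n. A n x \<bullet> x)" by (rule incseq_SucI) (rule inc)
    then obtain a where "(\<lambda>n. A n x \<bullet> x) \<longlonglongrightarrow> a"
      by (rule incseq_convergent[of _ "c * (x \<bullet> x)"]) (use bdd in blast)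
    then have cau: "Cauchy (\<lambda>n. A n x \<bullet> x)" by (rule LIMSEQ_imp_Cauchy)
    have "Cauchy (\<lambda>n. A n x)"
    proof (rule CauchyI')
      fix e :: real assume e: "0 < e"
      have "0 < e\<^sup>2 / (K + 1)" using e K0 by simp
      then obtain N where N: "\<And>m n. m \<ge> N \<Longrightarrow> n > m \<Longrightarrow> dist (A m x \<bullet> x) (A n x \<bullet> x) < e\<^sup>2 / (K + 1)"
        using cau unfolding Cauchy_altdef by blast
      have "norm (A m x - A n x) < e" if "m \<ge> N" "n > m" for m n
      proof -
        have d: "\<bar>A n x \<bullet> x - A m x \<bullet> x\<bar> < e\<^sup>2 / (K + 1)"
          using N[OF that] by (simp add: dist_real_def abs_minus_commute)
        have "(norm (A m x - A n x))\<^sup>2 \<le> K * (A n x \<bullet> x - A m x \<bullet> x)"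
          using sq[of m n x] that by (simp add: norm_minus_commute)
        also have "\<dots> \<le> K * (e\<^sup>2 / (K + 1))" using d K0 by (intro mult_left_mono) auto
        also have "\<dots> < e\<^sup>2" using e K0 by (simp add: field_simps)
        finally show ?thesis using e by (auto intro: power2_less_imp_less)
      qed
      then show "\<exists>M. \<forall>m\<ge>M. \<forall>n>m. dist (A m x) (A n x) < e" unfolding dist_norm by blast
    qed
    then show ?thesis by (rule Cauchy_convergent)
  qed
  define l where "l x = lim (\<lambda>n. A n x)" for x
  have l: "(\<lambda>n. A n x) \<longlonglongrightarrow> l x" for x
    using conv[of x] unfolding l_def by (simp add: convergent_LIMSEQ_iff)
  have "bounded_linear l"
  proof (rule bounded_linear_intro)
    show "l (x + y) = l x + l y" for x y
      using LIMSEQ_unique[OF l[of "x + y"]] tendsto_add[OF l[of x] l[of y]]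
      by (simp add: blin_simps)
    show "l (r *\<^sub>R x) = r *\<^sub>R l x" for r x
      using LIMSEQ_unique[OF l[of "r *\<^sub>R x"]] tendsto_scaleR[OF tendsto_const l[of x]]
      by (simp add: blin_simps)
    show "norm (l x) \<le> norm x * (K + norm (A 0))" for x
    proof (rule tendsto_upperbound[OF tendsto_norm[OF l]])
      have "norm (A n x) \<le> norm x * (K + norm (A 0))" for n
      proof -
        have "norm (A n x) \<le> norm ((A n - A 0) x) + norm (A 0 x)"
          using norm_triangle_ineq[of "(A n - A 0) x" "A 0 x"] by (simp add: blin_simps)
        also have "\<dots> \<le> K * norm x + norm (A 0) * norm x"
          by (intro add_mono norm_blinfun pos_op_norm_le[OF pos K K0]) simp_all
        finally show ?thesis by (simp add: algebra_simps)
      qed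
      then show "\<forall>\<^sub>F n in sequentially. norm (A n x) \<le> norm x * (K + norm (A 0))" by simp
    qed simp
  qed
  then have ap: "blinfun_apply (Blinfun l) = l" by (rule bounded_linear_Blinfun_apply)
  show thesis
  proof (rule that[of "Blinfun l"])
    show "sym_op (Blinfun l)" unfolding sym_op_def ap
    proof (intro allI)
      fix x y
      have "(\<lambda>n. A n x \<bullet> y) \<longlonglongrightarrow> l x \<bullet> y" by (intro tendsto_intros l)
      moreover have "(\<lambda>n. A n x \<bullet> y) \<longlonglongrightarrow> x \<bullet> l y"
        unfolding sym_opD[OF sym] by (intro tendsto_intros l)
      ultimately show "l x \<bullet> y = x \<bullet> l y" by (rule LIMSEQ_unique)
    qed
    show "\<forall>x. (\<lambda>n. A n x) \<longlonglongrightarrow> Blinfun l x" unfolding ap using l by blast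
    show "\<forall>X. (\<forall>n. bicommutes X (A n)) \<longrightarrow> bicommutes X (Blinfun l)"
      unfolding bicommutes_def[of _ "Blinfun l"] commutes_def[of _ "Blinfun l"] ap
    proof (intro allI impI)
      fix X B :: "'a \<Rightarrow>\<^sub>L 'a" and x assume X: "\<forall>n. bicommutes X (A n)" and B: "commutes B X"
      have "(\<lambda>n. B (A n x)) \<longlonglongrightarrow> B (l x)" by (intro tendsto_intros l)
      then have "(\<lambda>n. A n (B x)) \<longlonglongrightarrow> B (l x)"
        unfolding commutesD[OF bicommutesD[OF X[rule_format] B]] .
      then show "B (l x) = l (B x)" using l LIMSEQ_unique by blast
    qed
  qed
qed

section \<open>Square roots of positive operators\<close>

text \<open>
  The cone generated by the powers of \<open>B\<close>.  It is closed under products, and for \<open>B \<ge> 0\<close> it consists of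
  positive operators; this keeps the iteration for the square root ordered.
\<close>

inductive nonneg_poly :: "('a::real_normed_vector \<Rightarrow>\<^sub>L 'a) \<Rightarrow> ('a \<Rightarrow>\<^sub>L 'a) \<Rightarrow> bool" for B where
  zero: "nonneg_poly B 0"
| one: "nonneg_poly B id_blinfun"
| add: "nonneg_poly B A \<Longrightarrow> nonneg_poly B C \<Longrightarrow> nonneg_poly B (A + C)"
| scale: "nonneg_poly B A \<Longrightarrow> 0 \<le> c \<Longrightarrow> nonneg_poly B (c *\<^sub>R A)"
| shift: "nonneg_poly B A \<Longrightarrow> nonneg_poly B (B o\<^sub>L A)"

lemma nonneg_poly_mult:
  assumes "nonneg_poly B A" "nonneg_poly B C"
  shows "nonneg_poly B (A o\<^sub>L C)"
  using assms
proof (induction rule: nonneg_poly.induct)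
  case zero
  have "0 o\<^sub>L C = 0" by (rule blinfun_eqI) (simp add: blin_simps)
  then show ?case by (simp add: nonneg_poly.zero)
next
  case one
  have "id_blinfun o\<^sub>L C = C" by (rule blinfun_eqI) simp
  then show ?case using one by simp
next
  case (add A A')
  have "(A + A') o\<^sub>L C = (A o\<^sub>L C) + (A' o\<^sub>L C)" by (rule blinfun_eqI) (simp add: blin_simps)
  then show ?case using add by (simp add: nonneg_poly.add)
next
  case (scale A c)
  have "(c *\<^sub>R A) o\<^sub>L C = c *\<^sub>R (A o\<^sub>L C)" by (rule blinfun_eqI) (simp add: blin_simps)
  then show ?case using scale by (simp add: nonneg_poly.scale)
next
  case (shift A)
  have "(B o\<^sub>L A) o\<^sub>L C = B o\<^sub>L (A o\<^sub>L C)" by (rule blinfun_eqI) simp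
  then show ?case using shift by (simp add: nonneg_poly.shift)
qed

lemma nonneg_poly_bicommutes: "nonneg_poly B A \<Longrightarrow> bicommutes B A"
  by (induction rule: nonneg_poly.induct) (auto intro: bicommutes_intros)

text \<open>
  The induction carries along positivity of \<open>B A\<close>, since \<open>B (B A) = B A B\<close> is positive with \<open>A\<close>.
\<close>

lemma nonneg_poly_pos:
  assumes B: "pos_op B" and A: "nonneg_poly B A"
  shows "pos_op A"
proof -
  have "pos_op A \<and> pos_op (B o\<^sub>L A)"
    using A
  proof (induction rule: nonneg_poly.induct)
    case zero
    have "B o\<^sub>L 0 = 0" by (rule blinfun_eqI) (simp add: blin_simps)
    then show ?case by (simp add: pos_op_intros)
  next
    case one
    have "B o\<^sub>L id_blinfun = B" by (rule blinfun_eqI) simp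
    then show ?case using B by (simp add: pos_op_intros)
  next
    case (add A C)
    have "B o\<^sub>L (A + C) = (B o\<^sub>L A) + (B o\<^sub>L C)" by (rule blinfun_eqI) (simp add: blin_simps)
    then show ?case using add by (simp add: pos_op_intros)
  next
    case (scale A c)
    have "B o\<^sub>L (c *\<^sub>R A) = c *\<^sub>R (B o\<^sub>L A)" by (rule blinfun_eqI) (simp add: blin_simps)
    then show ?case using scale by (simp add: pos_op_intros)
  next
    case (shift A)
    have "commutes B A"
      using nonneg_poly_bicommutes[OF shift.hyps] bicommutesD commutes_intros(8) by blast
    then have "B o\<^sub>L (B o\<^sub>L A) = B o\<^sub>L A o\<^sub>L B"
      by (intro blinfun_eqI) (simp add: commutesD)
    then show ?case using shift pos_op_sandwich[OF pos_op_sym[OF B]] by simp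
  qed
  then show ?thesis ..
qed

lemma strong_limit_compose:
  fixes A B :: "nat \<Rightarrow> ('a::real_normed_vector \<Rightarrow>\<^sub>L 'a)"
  assumes A: "\<And>x. (\<lambda>n. A n x) \<longlonglongrightarrow> L x" and B: "(\<lambda>n. B n x) \<longlonglongrightarrow> y"
    and K: "\<And>n y. norm (A n y) \<le> K * norm y"
  shows "(\<lambda>n. A n (B n x)) \<longlonglongrightarrow> L y"
proof -
  have "(\<lambda>n. A n (B n x - y)) \<longlonglongrightarrow> 0"
  proof (rule Lim_null_comparison)
    show "\<forall>\<^sub>F n in sequentially. norm (A n (B n x - y)) \<le> K * norm (B n x - y)"
      using K by simp
    have "(\<lambda>n. K * norm (B n x - y)) \<longlonglongrightarrow> K * norm (y - y)"
      by (intro tendsto_intros B)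
    then show "(\<lambda>n. K * norm (B n x - y)) \<longlonglongrightarrow> 0" by simp
  qed
  from tendsto_add[OF this A[of y]] show ?thesis by (simp add: blin_simps)
qed

text \<open>
  The iteration of Riesz and Nagy.  A fixed point \<open>Z\<close> satisfies \<open>(1 - Z)\<^sup>2 = 1 - B\<close>.
\<close>

fun sqrt_iter :: "('a::real_normed_vector \<Rightarrow>\<^sub>L 'a) \<Rightarrow> nat \<Rightarrow> ('a \<Rightarrow>\<^sub>L 'a)" where
  "sqrt_iter B 0 = 0"
| "sqrt_iter B (Suc n) = (1/2) *\<^sub>R (B + (sqrt_iter B n o\<^sub>L sqrt_iter B n))"

text \<open>
  The iterates and their increments are polynomials in \<open>B = 1 - A\<close> with nonnegative coefficients, so
  they increase; by induction they are contractions, and their limit is a fixed point of the iteration.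
\<close>

lemma contraction_sqrt_exists:
  fixes A :: "'a::{real_inner,complete_space} \<Rightarrow>\<^sub>L 'a"
  assumes A: "pos_op A" and A1: "\<And>x. A x \<bullet> x \<le> x \<bullet> x"
  obtains S where "pos_op S" "S o\<^sub>L S = A" "bicommutes A S"
proof -
  define B where "B = id_blinfun - A"
  have B: "pos_op B" using A A1 unfolding B_def pos_op_def
    by (simp add: sym_op_intros blin_simps inner_simps)
  have B1: "B x \<bullet> x \<le> x \<bullet> x" for x
    using pos_opD[OF A, of x] by (simp add: B_def blin_simps inner_simps)
  define Z where "Z = sqrt_iter B"
  have Z0: "Z 0 = 0" and ZS: "Z (Suc n) = (1/2) *\<^sub>R (B + (Z n o\<^sub>L Z n))" for n
    by (simp_all add: Z_def)
  have Bp: "nonneg_poly B B"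
  proof -
    have "B o\<^sub>L id_blinfun = B" by (rule blinfun_eqI) simp
    then show ?thesis using nonneg_poly.shift[OF nonneg_poly.one, of B] by simp
  qed
  have Zp: "nonneg_poly B (Z n)" for n
    by (induction n) (auto simp: Z0 ZS intro!: nonneg_poly.intros nonneg_poly_mult Bp)
  have Dp: "nonneg_poly B (Z (Suc n) - Z n)" for n
  proof (induction n)
    case 0
    have "Z (Suc 0) - Z 0 = (1/2) *\<^sub>R B" by (rule blinfun_eqI) (simp add: Z0 ZS blin_simps)
    then show ?case by (simp add: nonneg_poly.scale Bp)
  next
    case (Suc n)
    \<comment> \<open>\<open>Y\<^sup>2 - Z\<^sup>2 = (Y - Z) Y + Z (Y - Z)\<close>\<close>
    have "Z (Suc (Suc n)) - Z (Suc n) =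
      (1/2) *\<^sub>R (((Z (Suc n) - Z n) o\<^sub>L Z (Suc n)) + (Z n o\<^sub>L (Z (Suc n) - Z n)))"
    proof (rule blinfun_eqI)
      fix x
      define W where "W = Z (Suc n) (Z (Suc n) x)"
      define V where "V = Z n (Z n x)"
      have e: "Z (Suc (Suc n)) x = (1/2) *\<^sub>R (B x + W)" "Z (Suc n) x = (1/2) *\<^sub>R (B x + V)"
        unfolding W_def V_def by (subst ZS, simp add: blin_simps)+
      have "(Z (Suc (Suc n)) - Z (Suc n)) x = (1/2) *\<^sub>R (B x + W) - (1/2) *\<^sub>R (B x + V)"
        by (simp only: blin_simps e)
      also have "\<dots> = (1/2) *\<^sub>R (W - V)" by (simp add: algebra_simps)
      also have "\<dots> = ((1/2) *\<^sub>R (((Z (Suc n) - Z n) o\<^sub>L Z (Suc n)) + (Z n o\<^sub>L (Z (Suc n) - Z n)))) x"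
        unfolding W_def V_def by (simp add: blin_simps)
      finally show "(Z (Suc (Suc n)) - Z (Suc n)) x =
        ((1/2) *\<^sub>R (((Z (Suc n) - Z n) o\<^sub>L Z (Suc n)) + (Z n o\<^sub>L (Z (Suc n) - Z n)))) x" .
    qed
    then show ?case by (auto intro!: nonneg_poly.intros nonneg_poly_mult Suc Zp)
  qed
  have Zpos: "pos_op (Z n)" for n by (rule nonneg_poly_pos[OF B Zp])
  have Z1: "Z n x \<bullet> x \<le> 1 * (x \<bullet> x)" for n x
  proof (induction n arbitrary: x)
    case 0 then show ?case by (simp add: Z0 blin_simps)
  next
    case (Suc n)
    have "norm (Z n x) \<le> 1 * norm x" by (rule pos_op_norm_le[OF Zpos Suc.IH]) simp
    then have "Z n x \<bullet> Z n x \<le> x \<bullet> x"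
      by (simp add: dot_square_norm power_mono)
    moreover have "Z (Suc n) x \<bullet> x = (B x \<bullet> x + Z n x \<bullet> Z n x) / 2"
      using sym_opD[OF pos_op_sym[OF Zpos], of n "Z n x" x]
      by (simp add: ZS blin_simps inner_simps)
    ultimately show ?case using B1[of x] by simp
  qed
  have Zc: "norm (Z n x) \<le> 1 * norm x" for n x
    by (rule pos_op_norm_le[OF Zpos Z1]) simp
  have Zinc: "Z n x \<bullet> x \<le> Z (Suc n) x \<bullet> x" for n x
    using pos_opD[OF nonneg_poly_pos[OF B Dp], of n x] by (simp add: blin_simps inner_simps)
  obtain L where Lsym: "sym_op L" and Llim: "\<forall>x. (\<lambda>n. Z n x) \<longlonglongrightarrow> L x"
    and Lc: "\<forall>X. (\<forall>n. bicommutes X (Z n)) \<longrightarrow> bicommutes X L"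
    using monotone_operator_limit[of Z 1, OF pos_op_sym[OF Zpos] Zinc Z1] by blast
  note L = Lsym Llim[rule_format]
  have LL: "2 *\<^sub>R L x = B x + L (L x)" for x
  proof -
    have "(\<lambda>n. 2 *\<^sub>R Z (Suc n) x) \<longlonglongrightarrow> 2 *\<^sub>R L x"
      by (intro tendsto_intros LIMSEQ_Suc[OF L(2)])
    moreover have "2 *\<^sub>R Z (Suc n) x = B x + Z n (Z n x)" for n
      by (simp add: ZS blin_simps)
    moreover have "(\<lambda>n. B x + Z n (Z n x)) \<longlonglongrightarrow> B x + L (L x)"
      by (intro tendsto_intros strong_limit_compose[where K = 1] L Zc)
    ultimately show ?thesis using LIMSEQ_unique by auto
  qed
  show thesis
  proof (rule that[of "id_blinfun - L"])
    have "L x \<bullet> x \<le> x \<bullet> x" for x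
      by (rule LIMSEQ_le_const2[of "\<lambda>n. Z n x \<bullet> x"]) (use Z1 in \<open>auto intro!: tendsto_intros L\<close>)
    then show "pos_op (id_blinfun - L)" unfolding pos_op_def
      by (simp add: sym_op_intros L blin_simps inner_simps)
    show "(id_blinfun - L) o\<^sub>L (id_blinfun - L) = A"
    proof (rule blinfun_eqI)
      fix x
      have "(id_blinfun - L) ((id_blinfun - L) x) = x - 2 *\<^sub>R L x + L (L x)"
        by (simp add: blin_simps scaleR_2)
      also have "\<dots> = A x" by (simp add: LL B_def blin_simps)
      finally show "((id_blinfun - L) o\<^sub>L (id_blinfun - L)) x = A x" by simp
    qed
    have "bicommutes B L" using Lc nonneg_poly_bicommutes[OF Zp] by blast
    moreover have "bicommutes A B" unfolding B_def by (intro bicommutes_intros)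
    ultimately show "bicommutes A (id_blinfun - L)"
      by (intro bicommutes_intros) (rule bicommutes_trans)
  qed
qed

lemma pos_op_sqrt_exists:
  fixes A :: "'a::{real_inner,complete_space} \<Rightarrow>\<^sub>L 'a"
  assumes A: "pos_op A"
  obtains S where "pos_op S" "S o\<^sub>L S = A" "bicommutes A S"
proof -
  obtain k where k: "0 < k" and kA: "pos_op ((1/k) *\<^sub>R A)" "\<And>x. ((1/k) *\<^sub>R A) x \<bullet> x \<le> x \<bullet> x"
    using pos_op_normalize[OF A] by blast
  obtain S where S: "pos_op S" "S o\<^sub>L S = (1/k) *\<^sub>R A" "bicommutes ((1/k) *\<^sub>R A) S"
    using contraction_sqrt_exists[OF kA] by blast
  show thesis
  proof (rule that[of "sqrt k *\<^sub>R S"])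
    show "pos_op (sqrt k *\<^sub>R S)" using S k by (simp add: pos_op_intros)
    show "(sqrt k *\<^sub>R S) o\<^sub>L (sqrt k *\<^sub>R S) = A"
    proof (rule blinfun_eqI)
      fix x
      have "S (S x) = (1/k) *\<^sub>R A x" using arg_cong[OF S(2), of "\<lambda>F. F x"] by (simp add: blin_simps)
      then show "((sqrt k *\<^sub>R S) o\<^sub>L (sqrt k *\<^sub>R S)) x = A x" using k by (simp add: blin_simps)
    qed
    have "bicommutes A ((1/k) *\<^sub>R A)" by (intro bicommutes_intros)
    then show "bicommutes A (sqrt k *\<^sub>R S)" using S(3) by (intro bicommutes_intros) (rule bicommutes_trans)
  qed
qed

section \<open>Spectral projections of half-lines\<close>

definition proj_op :: "('a::real_inner \<Rightarrow>\<^sub>L 'a) \<Rightarrow> bool" where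
  "proj_op P \<longleftrightarrow> sym_op P \<and> (\<forall>x. P (P x) = P x)"

text \<open>
  The projection onto the kernel of \<open>A\<close> is the limit of the decreasing sequence \<open>(1 - A)\<^sup>2\<^sup>n\<close>.
\<close>

lemma kernel_projection_exists:
  fixes A :: "'a::{real_inner,complete_space} \<Rightarrow>\<^sub>L 'a"
  assumes A: "pos_op A" and A1: "\<And>x. A x \<bullet> x \<le> x \<bullet> x"
  obtains Q where "proj_op Q" "bicommutes A Q" "\<And>x. A (Q x) = 0" "\<And>x. A x = 0 \<Longrightarrow> Q x = x"
proof -
  define U where "U = id_blinfun - A"
  have U: "pos_op U" using A A1 unfolding U_def pos_op_def
    by (simp add: sym_op_intros blin_simps inner_simps)
  have U1: "U x \<bullet> x \<le> 1 * (x \<bullet> x)" for x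
    using pos_opD[OF A, of x] by (simp add: U_def blin_simps inner_simps)
  have Uc: "norm (U x) \<le> norm x" for x
    using pos_op_norm_le[OF U U1] by simp
  define V where "V n = ((\<lambda>W. U o\<^sub>L W) ^^ n) id_blinfun" for n
  have V0: "V 0 = id_blinfun" and VS: "V (Suc n) = U o\<^sub>L V n" for n
    by (simp_all add: V_def)
  have AU: "bicommutes A U" unfolding U_def by (intro bicommutes_intros)
  have AV: "bicommutes A (V n)" for n
    by (induction n) (auto simp: V0 VS intro: bicommutes_intros AU)
  have Vsym: "sym_op (V n)" for n
  proof (induction n)
    case (Suc n)
    show ?case unfolding VS
      by (rule sym_op_bicommutes_compose[OF pos_op_sym[OF U] Suc AU AV])
  qed (simp add: V0 sym_op_intros)
  have q: "(- (V n o\<^sub>L V n)) x \<bullet> x = - (norm (V n x))\<^sup>2" for n x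
    using sym_opD[OF Vsym, of n "V n x" x] by (simp add: blin_simps inner_simps power2_norm_eq_inner)
  have Vinc: "(- (V n o\<^sub>L V n)) x \<bullet> x \<le> (- (V (Suc n) o\<^sub>L V (Suc n))) x \<bullet> x" for n x
    unfolding q using Uc[of "V n x"] by (simp add: VS power_mono)
  have V0': "(- (V n o\<^sub>L V n)) x \<bullet> x \<le> 0 * (x \<bullet> x)" for n x
    unfolding q by simp
  have Vsym': "sym_op (- (V n o\<^sub>L V n))" for n by (intro sym_op_intros Vsym)
  obtain L where Lsym: "sym_op L" and Llim: "\<forall>x. (\<lambda>n. (- (V n o\<^sub>L V n)) x) \<longlonglongrightarrow> L x"
    and Lc: "\<forall>X. (\<forall>n. bicommutes X (- (V n o\<^sub>L V n))) \<longrightarrow> bicommutes X L"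
    using monotone_operator_limit[of "\<lambda>n. - (V n o\<^sub>L V n)", OF Vsym' Vinc V0'] by blast
  note L = Lsym Llim[rule_format]
  define Q where "Q = - L"
  have Qlim: "(\<lambda>n. V n (V n x)) \<longlonglongrightarrow> Q x" for x
    using tendsto_minus[OF L(2)[of x]] by (simp add: Q_def blin_simps)
  have AQ: "bicommutes A Q" unfolding Q_def by (intro bicommutes_intros Lc[rule_format] AV)
  have UUQ: "U (U (Q x)) = Q x" for x
  proof -
    have UV: "commutes U (V n)" for n using bicommutes_commute[OF AU AV] .
    have "V (Suc n) (V (Suc n) x) = U (U (V n (V n x)))" for n
      using commutesD[OF UV, of n] by (simp add: VS)
    then have "(\<lambda>n. U (U (V n (V n x)))) \<longlonglongrightarrow> Q x"
      using LIMSEQ_Suc[OF Qlim[of x]] by simp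
    moreover have "(\<lambda>n. U (U (V n (V n x)))) \<longlonglongrightarrow> U (U (Q x))"
      by (intro tendsto_intros Qlim)
    ultimately show ?thesis using LIMSEQ_unique by blast
  qed
  have AQ0: "A (Q x) = 0" for x
  proof -
    define y where "y = A (Q x)"
    have UQ: "U (Q x) = Q x - y" by (simp add: U_def y_def blin_simps)
    have "Q x - (y + U y) = U (U (Q x))" by (simp add: UQ blin_simps)
    then have "y + U y = 0" by (simp only: UUQ diff_eq_eq[of "Q x"]) simp
    then have "y \<bullet> y + U y \<bullet> y = 0" by (metis inner_add_left inner_zero_left)
    then have "y \<bullet> y = 0" using pos_opD[OF U, of y] inner_ge_zero[of y] by linarith
    then show ?thesis by (simp add: y_def)
  qed
  have Qfix: "Q x = x" if "A x = 0" for x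
  proof -
    have "U x = x" using that by (simp add: U_def blin_simps)
    then have "V n x = x" for n by (induction n) (simp_all add: V0 VS)
    then show ?thesis using LIMSEQ_unique[OF Qlim[of x], of x] by simp
  qed
  have "sym_op Q" unfolding Q_def by (intro sym_op_intros L)
  then have "proj_op Q" unfolding proj_op_def using Qfix[OF AQ0] by simp
  then show thesis using that AQ AQ0 Qfix by blast
qed

lemma proj_opD: "proj_op P \<Longrightarrow> sym_op P" "proj_op P \<Longrightarrow> P (P x) = P x"
  unfolding proj_op_def by blast+

lemma proj_op_complement: "proj_op P \<Longrightarrow> proj_op (id_blinfun - P)"
  unfolding proj_op_def by (simp add: sym_op_intros blin_simps)

lemma proj_op_quad: "proj_op P \<Longrightarrow> P x \<bullet> x = P x \<bullet> P x"
  using sym_opD[of P "P x" x] by (simp add: proj_opD)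

lemma proj_op_pos: "proj_op P \<Longrightarrow> pos_op P"
  by (simp add: pos_op_def proj_opD proj_op_quad)

lemma proj_op_le_one: assumes "proj_op P" shows "P x \<bullet> x \<le> x \<bullet> x"
  using pos_opD[OF proj_op_pos[OF proj_op_complement[OF assms]], of x]
  by (simp add: blin_simps inner_simps)

text \<open>
  This order condition replaces the equation \<open>P = 1_(t,\<infinity>)(X)\<close>: strict on the range of \<open>P\<close>, weak on its
  complement, so that the eigenspace for \<open>t\<close> lies in the complement.
\<close>

definition cuts :: "('a::real_inner \<Rightarrow>\<^sub>L 'a) \<Rightarrow> real \<Rightarrow> ('a \<Rightarrow>\<^sub>L 'a) \<Rightarrow> bool" where
  "cuts X t P \<longleftrightarrow> proj_op P \<and> (\<forall>x. P x = x \<longrightarrow> x \<noteq> 0 \<longrightarrow> t * (x \<bullet> x) < X x \<bullet> x) \<and>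
     (\<forall>x. P x = 0 \<longrightarrow> X x \<bullet> x \<le> t * (x \<bullet> x))"

text \<open>
  With \<open>S = \<bar>Y\<bar>\<close>, take for \<open>P\<close> the projection onto the orthogonal complement of the kernel of
  \<open>V = S + Y\<close>.  On the kernel \<open>Y = -S \<le> 0\<close>; since \<open>V (S - Y) = 0\<close>, on the complement \<open>Y = S \<ge> 0\<close>, and
  there \<open>Y x = 0\<close> would put \<open>x\<close> into the kernel.
\<close>

lemma zero_cut_exists:
  fixes Y :: "'a::{real_inner,complete_space} \<Rightarrow>\<^sub>L 'a"
  assumes Y: "sym_op Y"
  obtains P where "cuts Y 0 P" "bicommutes Y P"
proof -
  obtain S where S: "pos_op S" "S o\<^sub>L S = Y o\<^sub>L Y" "bicommutes (Y o\<^sub>L Y) S"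
    using pos_op_sqrt_exists[OF pos_op_square[OF Y]] .
  have SS: "S (S x) = Y (Y x)" for x
    using arg_cong[OF S(2), of "\<lambda>F. F x"] by simp
  have "bicommutes Y (Y o\<^sub>L Y)" by (intro bicommutes_intros)
  then have YS: "bicommutes Y S" using S(3) by (rule bicommutes_trans)
  then have SY: "S (Y x) = Y (S x)" for x
    using bicommutesD[OF YS commutes_intros(8)] commutesD by metis
  define V where "V = S + Y"
  have Vsym: "sym_op V" unfolding V_def by (intro sym_op_intros Y pos_op_sym S)
  have YV: "bicommutes Y V" unfolding V_def by (intro bicommutes_intros YS)
  obtain k where k: "0 < k" and kA: "pos_op ((1 / k) *\<^sub>R (V o\<^sub>L V))"
    "\<And>x. ((1 / k) *\<^sub>R (V o\<^sub>L V)) x \<bullet> x \<le> x \<bullet> x"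
    using pos_op_normalize[OF pos_op_square[OF Vsym]] by blast
  define A where "A = (1 / k) *\<^sub>R (V o\<^sub>L V)"
  note A = kA(1)[folded A_def] and A1 = kA(2)[folded A_def]
  have A0: "A x = 0 \<longleftrightarrow> V x = 0" for x
  proof
    assume "A x = 0"
    then have "V (V x) = 0" using k by (simp add: A_def blin_simps)
    then have "V x \<bullet> V x = 0" using sym_opD[OF Vsym, of x "V x"] by simp
    then show "V x = 0" by simp
  qed (simp add: A_def blin_simps)
  obtain Q where Q: "proj_op Q" "bicommutes A Q" "\<And>x. A (Q x) = 0" "\<And>x. A x = 0 \<Longrightarrow> Q x = x"
    using kernel_projection_exists[OF A A1] by blast
  have VQ: "V (Q x) = 0" for x using Q(3) A0 by simp
  have Qfix: "Q x = x" if "V x = 0" for x using Q(4) A0 that by simp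
  have "bicommutes Y A" unfolding A_def by (intro bicommutes_intros YV)
  then have YQ: "bicommutes Y Q" using Q(2) by (rule bicommutes_trans)
  define P where "P = id_blinfun - Q"
  have P: "proj_op P" unfolding P_def by (rule proj_op_complement[OF Q(1)])
  have YP: "bicommutes Y P" unfolding P_def by (intro bicommutes_intros YQ)
  have onP: "Y x = S x" if "P x = x" for x
  proof -
    have "V (S x - Y x) = 0" by (simp add: V_def blin_simps SS SY)
    then have "Q (S x - Y x) = S x - Y x" by (rule Qfix)
    moreover have "commutes Q (S - Y)"
      by (rule bicommutes_commute[OF YQ]) (intro bicommutes_intros YS)
    ultimately have "S x - Y x = S (Q x) - Y (Q x)"
      using commutesD[of Q "S - Y" x] by (simp add: blin_simps)
    moreover have "Q x = 0" using that by (simp add: P_def blin_simps)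
    ultimately show ?thesis by (simp add: blin_simps)
  qed
  have "0 < Y x \<bullet> x" if "P x = x" "x \<noteq> 0" for x
  proof (rule ccontr)
    assume "\<not> 0 < Y x \<bullet> x"
    then have "S x \<bullet> x = 0" using onP[OF that(1)] pos_opD[OF S(1), of x] by simp
    then have "S x = 0" by (rule pos_op_kernel[OF S(1)])
    then have "V x = 0" using onP[OF that(1)] by (simp add: V_def blin_simps)
    then have "Q x = x" by (rule Qfix)
    then show False using that by (simp add: P_def blin_simps)
  qed
  moreover have "Y x \<bullet> x \<le> 0" if "P x = 0" for x
  proof -
    have "Q x = x" using that by (simp add: P_def blin_simps)
    then have "V x = 0" using VQ[of x] by simp
    then have "Y x = - S x" by (simp add: V_def blin_simps eq_neg_iff_add_eq_0 add.commute)
    then show ?thesis using pos_opD[OF S(1), of x] by simp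
  qed
  ultimately show thesis using that[of P] P YP unfolding cuts_def by simp
qed

lemma cut_exists:
  fixes X :: "'a::{real_inner,complete_space} \<Rightarrow>\<^sub>L 'a"
  assumes X: "sym_op X"
  obtains P where "cuts X t P" "bicommutes X P"
proof -
  define Y where "Y = X - t *\<^sub>R id_blinfun"
  have "sym_op Y" unfolding Y_def by (intro sym_op_intros X)
  then obtain P where P: "cuts Y 0 P" "bicommutes Y P" using zero_cut_exists by blast
  have q: "Y x \<bullet> x = X x \<bullet> x - t * (x \<bullet> x)" for x
    by (simp add: Y_def blin_simps inner_simps)
  have "bicommutes X Y" unfolding Y_def by (intro bicommutes_intros)
  then have "bicommutes X P" using P(2) by (rule bicommutes_trans)
  moreover have "cuts X t P" using P(1) unfolding cuts_def q by simp
  ultimately show thesis using that by blast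
qed

text \<open>
  A vector in the range of \<open>Q\<close> and orthogonal to that of \<open>P\<close> would satisfy contradictory inequalities.
\<close>

lemma commuting_cuts_le:
  assumes P: "cuts X s P" and Q: "cuts X t Q" and PQ: "commutes P Q" and "s \<le> t"
  shows "P (Q x) = Q x"
proof -
  define y where "y = Q x - P (Q x)"
  have p: "P (P z) = P z" "Q (Q z) = Q z" for z
    using P Q unfolding cuts_def by (simp_all add: proj_opD)
  have y: "P y = 0" "Q y = y"
    unfolding y_def by (simp_all add: blin_simps p commutesD[OF PQ, symmetric])
  have "y = 0"
  proof (rule ccontr)
    assume "y \<noteq> 0"
    then have "t * (y \<bullet> y) < X y \<bullet> y" using Q y unfolding cuts_def by simp
    also have "\<dots> \<le> s * (y \<bullet> y)" using P y unfolding cuts_def by simp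
    also have "\<dots> \<le> t * (y \<bullet> y)" using \<open>s \<le> t\<close> by (intro mult_right_mono) auto
    finally show False by simp
  qed
  then show ?thesis by (simp add: y_def)
qed

lemma commuting_cuts_unique:
  assumes P: "cuts X t P" and Q: "cuts X t Q" and PQ: "commutes P Q"
  shows "P = Q"
proof (rule blinfun_eqI)
  fix x
  show "P x = Q x"
    using commuting_cuts_le[OF P Q PQ order_refl, of x] commuting_cuts_le[OF Q P commutes_sym[OF PQ] order_refl, of x]
      commutesD[OF PQ, of x] by simp
qed

definition upper_proj :: "('a::{real_inner,complete_space} \<Rightarrow>\<^sub>L 'a) \<Rightarrow> real \<Rightarrow> ('a \<Rightarrow>\<^sub>L 'a)" where
  "upper_proj X t = (SOME P. cuts X t P \<and> bicommutes X P)"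

lemma upper_proj:
  assumes "sym_op X"
  shows upper_proj_cuts: "cuts X t (upper_proj X t)"
    and upper_proj_bicommutes: "bicommutes X (upper_proj X t)"
    and upper_proj_proj_op: "proj_op (upper_proj X t)"
proof -
  have "\<exists>P. cuts X t P \<and> bicommutes X P" using cut_exists[OF assms, of t] by blast
  then have "cuts X t (upper_proj X t) \<and> bicommutes X (upper_proj X t)"
    unfolding upper_proj_def by (rule someI_ex)
  then show "cuts X t (upper_proj X t)" "bicommutes X (upper_proj X t)" "proj_op (upper_proj X t)"
    by (auto simp: cuts_def)
qed

text \<open>
  Any such \<open>Q\<close> commutes with \<open>upper_proj X t\<close> because the latter bicommutes with \<open>X\<close>.
\<close>

lemma upper_proj_unique:
  assumes "sym_op X" "cuts X t Q" "commutes Q X"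
  shows "Q = upper_proj X t"
  using commuting_cuts_unique[OF assms(2) upper_proj_cuts[OF assms(1)]]
    bicommutesD[OF upper_proj_bicommutes[OF assms(1)] assms(3)] by blast

lemma upper_proj_le:
  assumes "sym_op X" "s \<le> t"
  shows "upper_proj X s (upper_proj X t x) = upper_proj X t x"
    "upper_proj X t (upper_proj X s x) = upper_proj X t x"
proof -
  have c: "commutes (upper_proj X s) (upper_proj X t)"
    by (rule bicommutes_commute) (rule upper_proj_bicommutes[OF assms(1)])+
  show "upper_proj X s (upper_proj X t x) = upper_proj X t x"
    by (rule commuting_cuts_le[OF upper_proj_cuts upper_proj_cuts c]) (use assms in auto)
  then show "upper_proj X t (upper_proj X s x) = upper_proj X t x"
    using commutesD[OF c] by simp
qed

section \<open>The spectral measures of a symmetric operator\<close>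

lemma upper_proj_top:
  assumes X: "sym_op X" and t: "norm X \<le> t"
  shows "upper_proj X t = 0"
proof (rule blinfun_eqI)
  fix x
  define y where "y = upper_proj X t x"
  have Py: "upper_proj X t y = y" unfolding y_def using proj_opD(2)[OF upper_proj_proj_op[OF X]] .
  have "X y \<bullet> y \<le> norm X * (y \<bullet> y)" using quad_le_norm[of X y] by linarith
  also have "\<dots> \<le> t * (y \<bullet> y)" using t by (intro mult_right_mono) auto
  finally have "y = 0" using upper_proj_cuts[OF X, of t] Py unfolding cuts_def by force
  then show "upper_proj X t x = blinfun_apply 0 x" by (simp add: y_def)
qed

lemma upper_proj_bot:
  assumes X: "sym_op X" and t: "\<And>x. x \<noteq> 0 \<Longrightarrow> t * (x \<bullet> x) < X x \<bullet> x"
  shows "upper_proj X t = id_blinfun"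
proof (rule blinfun_eqI)
  fix x
  define y where "y = x - upper_proj X t x"
  have Py: "upper_proj X t y = 0"
    unfolding y_def using proj_opD(2)[OF upper_proj_proj_op[OF X]] by (simp add: blin_simps)
  then have "X y \<bullet> y \<le> t * (y \<bullet> y)" using upper_proj_cuts[OF X, of t] unfolding cuts_def by blast
  then have "y = 0" using t[of y] by force
  then show "upper_proj X t x = id_blinfun x" by (simp add: y_def)
qed

lemma upper_proj_bot_norm:
  assumes X: "sym_op X" and t: "t < - norm X"
  shows "upper_proj X t = id_blinfun"
proof (rule upper_proj_bot[OF X])
  fix x :: 'a assume "x \<noteq> 0"
  then have "t * (x \<bullet> x) < - norm X * (x \<bullet> x)" using t by (intro mult_strict_right_mono) auto
  also have "\<dots> \<le> X x \<bullet> x" using quad_le_norm[of X x] by (simp add: abs_le_iff)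
  finally show "t * (x \<bullet> x) < X x \<bullet> x" .
qed

lemma upper_proj_diff:
  assumes X: "sym_op X" and st: "s \<le> t"
  shows "proj_op (upper_proj X s - upper_proj X t)"
  unfolding proj_op_def
  using upper_proj_le[OF X st] proj_opD(2)[OF upper_proj_proj_op[OF X]]
  by (simp add: blin_simps sym_op_intros proj_opD(1)[OF upper_proj_proj_op[OF X]])

lemma upper_proj_quad_mono:
  assumes X: "sym_op X" and st: "s \<le> t"
  shows "upper_proj X t x \<bullet> x \<le> upper_proj X s x \<bullet> x"
  using pos_opD[OF proj_op_pos[OF upper_proj_diff[OF X st]], of x]
  by (simp add: blin_simps inner_simps)

text \<open>
  If \<open>L\<close> is the limit from the right, a vector \<open>y\<close> in the range of \<open>P\<^sub>t - L\<close> is annihilated by all \<open>P\<^sub>r\<close>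
  with \<open>r > t\<close>; hence \<open>\<langle>X y, y\<rangle> \<le> t \<parallel>y\<parallel>\<^sup>2\<close>, against the strict inequality on the range of \<open>P\<^sub>t\<close>.
\<close>

lemma upper_proj_right_limit:
  assumes X: "sym_op X"
  shows "(\<lambda>n. upper_proj X (t + inverse (real (Suc n))) x) \<longlonglongrightarrow> upper_proj X t x"
proof -
  define r where "r n = t + inverse (real (Suc n))" for n
  have r: "t \<le> r n" "r n \<le> r m" if "m \<le> n" for m n
    using that by (auto simp: r_def le_imp_inverse_le)
  have rt: "t \<le> r n" for n using r(1)[of n n] by simp
  have rlim: "r \<longlonglongrightarrow> t" unfolding r_def
    using tendsto_add[OF tendsto_const LIMSEQ_inverse_real_of_nat] by simp
  note proj = upper_proj_proj_op[OF X]
  have sy: "sym_op (upper_proj X (r n))" for n by (rule proj_opD(1)[OF proj])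
  have inc: "upper_proj X (r n) x \<bullet> x \<le> upper_proj X (r (Suc n)) x \<bullet> x" for n x
    by (rule upper_proj_quad_mono[OF X]) (rule r, simp)
  have bd: "upper_proj X (r n) x \<bullet> x \<le> 1 * (x \<bullet> x)" for n x
    using proj_op_le_one[OF proj] by simp
  obtain L where Ll: "\<forall>x. (\<lambda>n. upper_proj X (r n) x) \<longlonglongrightarrow> L x"
    by (rule monotone_operator_limit[of "\<lambda>n. upper_proj X (r n)", OF sy inc bd]) (rule that)
  note L = Ll[rule_format]
  have PL: "upper_proj X t (L x) = L x" for x
  proof -
    have "(\<lambda>n. upper_proj X t (upper_proj X (r n) x)) \<longlonglongrightarrow> upper_proj X t (L x)"
      by (intro tendsto_intros L)
    then have "(\<lambda>n. upper_proj X (r n) x) \<longlonglongrightarrow> upper_proj X t (L x)"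
      by (simp add: upper_proj_le(1)[OF X rt])
    then show ?thesis using L LIMSEQ_unique by blast
  qed
  have PnL: "upper_proj X (r n) (L x) = upper_proj X (r n) x" for n x
  proof -
    have "(\<lambda>m. upper_proj X (r n) (upper_proj X (r m) x)) \<longlonglongrightarrow> upper_proj X (r n) (L x)"
      by (intro tendsto_intros L)
    moreover have "\<forall>\<^sub>F m in sequentially. upper_proj X (r n) (upper_proj X (r m) x) = upper_proj X (r n) x"
      using eventually_ge_at_top[of n] by eventually_elim (rule upper_proj_le(2)[OF X r(2)])
    ultimately have "(\<lambda>m. upper_proj X (r n) x) \<longlonglongrightarrow> upper_proj X (r n) (L x)"
      by (rule Lim_transform_eventually)
    then show ?thesis using LIMSEQ_unique tendsto_const by blast
  qed
  define y where "y = upper_proj X t x - L x"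
  have yt: "upper_proj X t y = y"
    by (simp add: y_def blin_simps PL proj_opD(2)[OF proj])
  have yr: "upper_proj X (r n) y = 0" for n
    by (simp add: y_def blin_simps PnL upper_proj_le(2)[OF X rt])
  have "X y \<bullet> y \<le> t * (y \<bullet> y)"
  proof (rule LIMSEQ_le_const)
    show "(\<lambda>n. r n * (y \<bullet> y)) \<longlonglongrightarrow> t * (y \<bullet> y)" by (intro tendsto_intros rlim)
    show "\<exists>N. \<forall>n\<ge>N. X y \<bullet> y \<le> r n * (y \<bullet> y)"
      using upper_proj_cuts[OF X] yr unfolding cuts_def by blast
  qed
  then have "y = 0" using upper_proj_cuts[OF X, of t] yt unfolding cuts_def by force
  then show ?thesis using L[of x] by (simp add: r_def y_def)
qed

text \<open>
  The measure \<open>B \<mapsto> \<langle>1\<^sub>B(X) x, x\<rangle>\<close>, given by its distribution function.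
\<close>

definition spec_measure :: "('a::{real_inner,complete_space} \<Rightarrow>\<^sub>L 'a) \<Rightarrow> 'a \<Rightarrow> real measure" where
  "spec_measure X x = interval_measure (\<lambda>t. x \<bullet> x - upper_proj X t x \<bullet> x)"

lemma sets_spec_measure [simp, measurable_cong]: "sets (spec_measure X x) = sets borel"
  and space_spec_measure [simp]: "space (spec_measure X x) = UNIV"
  by (simp_all add: spec_measure_def)

lemma emeasure_UNIV_greaterThan:
  fixes M :: "real measure"
  assumes M: "sets M = sets borel" and a: "\<And>t. t < c \<Longrightarrow> emeasure M {t<..} = a"
  shows "emeasure M UNIV = a"
proof -
  define A where "A n = {c - 1 - real n <..}" for n
  have "(\<lambda>n. emeasure M (A n)) \<longlonglongrightarrow> emeasure M (\<Union>n. A n)"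
    by (rule Lim_emeasure_incseq) (auto simp: M A_def incseq_def)
  moreover have "(\<Union>n. A n) = UNIV"
  proof -
    have "\<exists>n. z \<in> A n" for z
      using reals_Archimedean2[of "c - 1 - z"] by (auto simp: A_def algebra_simps)
    then show ?thesis by blast
  qed
  moreover have "emeasure M (A n) = a" for n unfolding A_def by (rule a) simp
  ultimately have "(\<lambda>n::nat. a) \<longlonglongrightarrow> emeasure M UNIV" by simp
  then show ?thesis using LIMSEQ_unique tendsto_const by blast
qed

context
  fixes X :: "'a::{real_inner,complete_space} \<Rightarrow>\<^sub>L 'a"
  assumes X: "sym_op X"
begin

lemma emeasure_spec_measure_greaterThan:
  "emeasure (spec_measure X x) {t<..} = ennreal (upper_proj X t x \<bullet> x)"
proof -
  define F where "F t = x \<bullet> x - upper_proj X t x \<bullet> x" for t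
  have mono: "F s \<le> F t" if "s \<le> t" for s t
    using upper_proj_quad_mono[OF X that] by (simp add: F_def)
  have rc: "continuous (at_right a) F" for a
  proof (subst continuous_at_right_real_increasing[OF mono], assumption, intro allI impI)
    fix e :: real assume "0 < e"
    have "(\<lambda>n. F (a + inverse (real (Suc n)))) \<longlonglongrightarrow> F a"
      unfolding F_def by (intro tendsto_intros upper_proj_right_limit[OF X])
    then have "\<forall>\<^sub>F n in sequentially. F (a + inverse (real (Suc n))) < F a + e"
      using \<open>0 < e\<close> by (intro order_tendstoD(2)) auto
    then obtain n where "F (a + inverse (real (Suc n))) < F a + e"
      unfolding eventually_sequentially by blast
    then show "\<exists>\<delta>>0. F (a + \<delta>) - F a < e"
      by (intro exI[of _ "inverse (real (Suc n))"]) auto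
  qed
  define A where "A n = {t <.. t + real n}" for n
  have "(\<lambda>n. emeasure (spec_measure X x) (A n)) \<longlonglongrightarrow> emeasure (spec_measure X x) (\<Union>n. A n)"
    by (rule Lim_emeasure_incseq) (auto simp: A_def incseq_def)
  moreover have "(\<Union>n. A n) = {t<..}"
  proof -
    have "\<exists>n. z \<in> A n" if "t < z" for z
      using real_arch_simple[of "z - t"] that by (auto simp: A_def algebra_simps)
    then show ?thesis by (auto simp: A_def)
  qed
  moreover have "\<forall>\<^sub>F n in sequentially. emeasure (spec_measure X x) (A n) = ennreal (upper_proj X t x \<bullet> x)"
  proof -
    obtain N where N: "norm X - t \<le> real N" using real_arch_simple by blast
    show ?thesis using eventually_ge_at_top[of N]
    proof eventually_elim
      case (elim n)
      then have "norm X \<le> t + real n" using N by (simp add: algebra_simps)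
      then have F1: "F (t + real n) = x \<bullet> x" by (simp add: F_def upper_proj_top[OF X])
      have "emeasure (spec_measure X x) (A n) = ennreal (F (t + real n) - F t)"
        unfolding A_def spec_measure_def F_def[symmetric]
        by (rule emeasure_interval_measure_Ioc) (auto intro: mono rc)
      then show ?case by (simp only: F1) (simp add: F_def)
    qed
  qed
  ultimately have "(\<lambda>n::nat. ennreal (upper_proj X t x \<bullet> x)) \<longlonglongrightarrow> emeasure (spec_measure X x) {t<..}"
    using Lim_transform_eventually by fastforce
  then show ?thesis using LIMSEQ_unique tendsto_const by blast
qed

lemma upper_proj_quad_nonneg: "0 \<le> upper_proj X t x \<bullet> x"
  by (rule pos_opD[OF proj_op_pos[OF upper_proj_proj_op[OF X]]])

lemma emeasure_spec_measure_UNIV: "emeasure (spec_measure X x) UNIV = ennreal (x \<bullet> x)"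
  by (rule emeasure_UNIV_greaterThan[of _ "- norm X"])
    (simp_all add: emeasure_spec_measure_greaterThan upper_proj_bot_norm[OF X])

lemma finite_spec_measure: "finite_measure (spec_measure X x)"
  by (rule finite_measureI) (simp add: emeasure_spec_measure_UNIV)

lemma measure_spec_measure:
  "measure (spec_measure X x) {t<..} = upper_proj X t x \<bullet> x"
  "measure (spec_measure X x) UNIV = x \<bullet> x"
  by (simp_all add: measure_def emeasure_spec_measure_greaterThan upper_proj_quad_nonneg
      emeasure_spec_measure_UNIV)

lemma AE_spec_measure_le: "AE z in spec_measure X x. z \<le> norm X"
proof -
  have "emeasure (spec_measure X x) {norm X<..} = 0"
    by (simp add: emeasure_spec_measure_greaterThan upper_proj_top[OF X])
  then show ?thesis by (intro AE_I[of _ _ "{norm X<..}"]) auto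
qed

lemma AE_spec_measure_gt:
  assumes "upper_proj X t = id_blinfun" shows "AE z in spec_measure X x. t < z"
proof -
  interpret finite_measure "spec_measure X x" by (rule finite_spec_measure)
  have "measure (spec_measure X x) (UNIV - {t<..}) = 0"
    using finite_measure_compl[of "{t<..}"] by (simp add: measure_spec_measure assms)
  then have "emeasure (spec_measure X x) (UNIV - {t<..}) = 0"
    by (simp add: emeasure_eq_measure)
  then show ?thesis by (intro AE_I[of _ _ "UNIV - {t<..}"]) auto
qed

lemma AE_spec_measure_abs_le: "AE z in spec_measure X x. \<bar>z\<bar> \<le> norm X + 1"
proof -
  have "AE z in spec_measure X x. - norm X - 1 < z"
    by (rule AE_spec_measure_gt) (rule upper_proj_bot_norm[OF X], simp)
  with AE_spec_measure_le show ?thesis by eventually_elim linarith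
qed

end

text \<open>
  Summing over \<open>n\<close> equal steps gives \<open>h a - h b \<le> (b - a) (d a - d b) / n\<close>.
\<close>

lemma partition_monotone:
  fixes h d :: "real \<Rightarrow> real"
  assumes h: "\<And>s t. s \<le> t \<Longrightarrow> h s - h t \<le> (t - s) * (d s - d t)" and ab: "a \<le> b"
  shows "h a \<le> h b"
proof -
  have bound: "real n * (h a - h b) \<le> (b - a) * (d a - d b)" if n: "0 < n" for n :: nat
  proof -
    define \<delta> where "\<delta> = (b - a) / real n"
    have d0: "0 \<le> \<delta>" unfolding \<delta>_def using ab by simp
    have "h a - h (a + real k * \<delta>) \<le> \<delta> * (d a - d (a + real k * \<delta>))" for k
    proof (induction k)
      case (Suc k)
      have "h (a + real k * \<delta>) - h (a + real (Suc k) * \<delta>)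
        \<le> \<delta> * (d (a + real k * \<delta>) - d (a + real (Suc k) * \<delta>))"
        using h[of "a + real k * \<delta>" "a + real (Suc k) * \<delta>"] d0 by (simp add: algebra_simps)
      then show ?case using Suc by (simp only: right_diff_distrib)
    qed simp
    from this[of n] have "h a - h b \<le> \<delta> * (d a - d b)" using n by (simp add: \<delta>_def)
    then have "real n * (h a - h b) \<le> real n * (\<delta> * (d a - d b))" by (intro mult_left_mono) auto
    also have "\<dots> = (b - a) * (d a - d b)" using n by (simp add: \<delta>_def)
    finally show ?thesis .
  qed
  show ?thesis
  proof (rule ccontr)
    assume "\<not> h a \<le> h b"
    then have p: "0 < h a - h b" by simp
    obtain n where "(b - a) * (d a - d b) < real n * (h a - h b)"
      using reals_Archimedean3[OF p] by blast
    also have "\<dots> \<le> real (Suc n) * (h a - h b)" using p by (intro mult_right_mono) auto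
    finally show False using bound[of "Suc n"] by simp
  qed
qed

text \<open>
  The positive part \<open>(X - t)\<^sub>+\<close>.
\<close>

definition upper_part :: "('a::{real_inner,complete_space} \<Rightarrow>\<^sub>L 'a) \<Rightarrow> real \<Rightarrow> ('a \<Rightarrow>\<^sub>L 'a)" where
  "upper_part X t = (X o\<^sub>L upper_proj X t) - t *\<^sub>R upper_proj X t"

context
  fixes X :: "'a::{real_inner,complete_space} \<Rightarrow>\<^sub>L 'a"
  assumes X: "sym_op X"
begin

lemma integrable_spec_measureI:
  assumes [measurable]: "g \<in> borel_measurable borel" and "\<And>z. \<bar>z\<bar> \<le> norm X + 1 \<Longrightarrow> \<bar>g z\<bar> \<le> c"
  shows "integrable (spec_measure X x) (g :: real \<Rightarrow> real)"
proof -
  interpret finite_measure "spec_measure X x" by (rule finite_spec_measure[OF X])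
  have "AE z in spec_measure X x. norm (g z) \<le> c"
    using AE_spec_measure_abs_le[OF X] by eventually_elim (use assms(2) in auto)
  then show ?thesis by (rule integrable_const_bound) measurable
qed

lemma upper_part_quad: "upper_part X t x \<bullet> x = X (upper_proj X t x) \<bullet> x - t * (upper_proj X t x \<bullet> x)"
  by (simp add: upper_part_def blin_simps inner_simps)

text \<open>
  On the range of \<open>P\<^sub>s - P\<^sub>t\<close> the operator \<open>X\<close> lies between \<open>s\<close> and \<open>t\<close>.  Thus \<open>(X - t)\<^sub>+\<close> decreases in \<open>t\<close>
  at a rate between \<open>P\<^sub>t\<close> and \<open>P\<^sub>s\<close>, the operator form of \<open>d/dt (z - t)\<^sub>+ = -1\<close> for \<open>z > t\<close>.
\<close>

lemma upper_part_decrease: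
  assumes st: "s \<le> t"
  shows "pos_op (upper_part X s - upper_part X t - (t - s) *\<^sub>R upper_proj X t)" (is ?lower)
    and "pos_op ((t - s) *\<^sub>R upper_proj X s - (upper_part X s - upper_part X t))" (is ?upper)
proof -
  let ?P = "upper_proj X"
  note pr = proj_opD[OF upper_proj_proj_op[OF X]]
  have sy: "sym_op (upper_part X t)" for t
    unfolding upper_part_def
    by (intro sym_op_intros pr sym_op_bicommutes_compose[OF X pr(1) bicommutes_intros(8) upper_proj_bicommutes[OF X]])
  have R: "proj_op (?P s - ?P t)" by (rule upper_proj_diff[OF X st])
  have cm: "commutes (?P s - ?P t) X"
    by (intro commutes_sym[OF bicommutesD[OF _ commutes_intros(8)]] bicommutes_intros upper_proj_bicommutes[OF X])
  have *: "(t - s) * (?P t x \<bullet> x) \<le> upper_part X s x \<bullet> x - upper_part X t x \<bullet> x \<and>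
      upper_part X s x \<bullet> x - upper_part X t x \<bullet> x \<le> (t - s) * (?P s x \<bullet> x)" for x
  proof -
    define y where "y = ?P s x - ?P t x"
    have Py: "?P s y = y" "?P t y = 0"
      unfolding y_def by (simp_all add: blin_simps pr upper_proj_le[OF X st])
    have yy: "y \<bullet> y = ?P s x \<bullet> x - ?P t x \<bullet> x"
      using proj_op_quad[OF R, of x] by (simp add: y_def blin_simps inner_simps)
    have "X y \<bullet> y = X ((?P s - ?P t) x) \<bullet> (?P s - ?P t) x" by (simp add: y_def blin_simps)
    also have "\<dots> = (?P s - ?P t) (X ((?P s - ?P t) x)) \<bullet> x"
      by (rule sym_opD[OF proj_opD(1)[OF R], symmetric])
    also have "\<dots> = X ((?P s - ?P t) x) \<bullet> x" by (simp only: commutesD[OF cm] proj_opD(2)[OF R])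
    finally have Xy: "X y \<bullet> y = X (?P s x) \<bullet> x - X (?P t x) \<bullet> x" by (simp add: blin_simps inner_simps)
    have "s * (y \<bullet> y) \<le> X y \<bullet> y"
    proof (cases "y = 0")
      case False
      then show ?thesis using upper_proj_cuts[OF X, of s] Py unfolding cuts_def by (simp add: less_imp_le)
    qed (simp add: blin_simps)
    moreover have "X y \<bullet> y \<le> t * (y \<bullet> y)"
      using upper_proj_cuts[OF X, of t] Py unfolding cuts_def by simp
    ultimately show ?thesis unfolding Xy yy upper_part_quad by (simp add: algebra_simps)
  qed
  show ?lower unfolding pos_op_def
    using * by (auto intro!: sym_op_intros sy pr simp: blin_simps inner_simps)
  show ?upper unfolding pos_op_def
    using * by (auto intro!: sym_op_intros sy pr simp: blin_simps inner_simps)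
qed

lemma upper_part_top: "upper_part X (norm X) = 0"
  by (rule blinfun_eqI) (simp add: upper_part_def upper_proj_top[OF X] blin_simps)

text \<open>
  Compare \<open>f t = \<langle>(X - t)\<^sub>+ x, x\<rangle>\<close> with \<open>g t = \<integral> (z - t)\<^sub>+\<close>: both decrease at a rate between \<open>d t\<close> and
  \<open>d s\<close> on \<open>[s, t]\<close>, and both vanish at \<open>\<parallel>X\<parallel>\<close>.  To the left of the spectrum they are the two sides of
  the claim, up to a common affine term.
\<close>

theorem spectral_integral: "(\<integral>z. z \<partial>spec_measure X x) = X x \<bullet> x"
proof -
  let ?P = "upper_proj X" and ?M = "spec_measure X x"
  define f where "f t = upper_part X t x \<bullet> x" for t
  define g where "g t = (\<integral>z. max (z - t) 0 \<partial>?M)" for t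
  define d where "d t = ?P t x \<bullet> x" for t
  define a where "a = - norm X - 1"
  interpret finite_measure ?M by (rule finite_spec_measure[OF X])
  have int: "integrable ?M (\<lambda>z. max (z - t) 0)" for t
    by (rule integrable_spec_measureI[where c = "norm X + 1 + \<bar>t\<bar>"]) auto
  have ind: "(\<integral>z. indicator {t<..} z \<partial>?M) = d t" for t
    by (simp add: d_def measure_spec_measure[OF X])
  have indi: "integrable ?M (indicator {t<..} :: real \<Rightarrow> real)" for t
    by (rule integrable_spec_measureI[where c = 1]) (auto simp: indicator_def)
  have f: "(t - s) * d t \<le> f s - f t" "f s - f t \<le> (t - s) * d s" if st: "s \<le> t" for s t
    using pos_opD[OF upper_part_decrease(1)[OF st], of x] pos_opD[OF upper_part_decrease(2)[OF st], of x]
    by (simp_all add: f_def d_def blin_simps inner_simps)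
  have g: "(t - s) * d t \<le> g s - g t" "g s - g t \<le> (t - s) * d s" if st: "s \<le> t" for s t
  proof -
    have e: "g s - g t = (\<integral>z. max (z - s) 0 - max (z - t) 0 \<partial>?M)"
      unfolding g_def by (rule Bochner_Integration.integral_diff[symmetric]) (rule int)+
    have "(\<integral>z. (t - s) * indicator {t<..} z \<partial>?M) \<le> g s - g t"
      unfolding e by (rule integral_mono[OF integrable_mult_right[OF indi] Bochner_Integration.integrable_diff[OF int int]])
        (use st in \<open>auto simp: indicator_def\<close>)
    moreover have "g s - g t \<le> (\<integral>z. (t - s) * indicator {s<..} z \<partial>?M)"
      unfolding e by (rule integral_mono[OF Bochner_Integration.integrable_diff[OF int int] integrable_mult_right[OF indi]])
        (use st in \<open>auto simp: indicator_def\<close>)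
    ultimately show "(t - s) * d t \<le> g s - g t" "g s - g t \<le> (t - s) * d s"
      by (simp_all only: ind integral_mult_right_zero)
  qed
  have "g (norm X) = (\<integral>z. 0 \<partial>?M)" unfolding g_def
  proof (rule integral_cong_AE)
    show "AE z in ?M. max (z - norm X) 0 = 0"
      using AE_spec_measure_le[OF X] by eventually_elim simp
  qed auto
  then have b: "f (norm X) = g (norm X)" by (simp add: f_def upper_part_top blin_simps)
  have ab: "a \<le> norm X" unfolding a_def using norm_ge_zero[of X] by linarith
  have "f a - g a \<le> f (norm X) - g (norm X)"
    by (rule partition_monotone[OF _ ab, of _ d]) (use f g in \<open>simp add: right_diff_distrib; fastforce\<close>)
  moreover have "g a - f a \<le> g (norm X) - f (norm X)"
    by (rule partition_monotone[OF _ ab, of _ d]) (use f g in \<open>simp add: right_diff_distrib; fastforce\<close>)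
  ultimately have "f a = g a" using b by simp
  moreover have Pa: "?P a = id_blinfun" by (rule upper_proj_bot_norm[OF X]) (simp add: a_def)
  then have "f a = X x \<bullet> x - a * (x \<bullet> x)" by (simp add: f_def upper_part_quad)
  moreover have "g a = (\<integral>z. z - a \<partial>?M)" unfolding g_def
  proof (rule integral_cong_AE)
    show "AE z in ?M. max (z - a) 0 = z - a"
      using AE_spec_measure_gt[OF X Pa] by eventually_elim simp
  qed auto
  moreover have "(\<integral>z. z - a \<partial>?M) = (\<integral>z. z \<partial>?M) - a * (x \<bullet> x)"
  proof (subst Bochner_Integration.integral_diff)
    show "integrable ?M (\<lambda>z. z)" by (rule integrable_spec_measureI[where c = "norm X + 1"]) auto
  qed (auto simp: measure_spec_measure[OF X])
  ultimately show ?thesis by simp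
qed

end

section \<open>Borel functional calculus\<close>

definition bounded_borel :: "(real \<Rightarrow> real) \<Rightarrow> bool" where
  "bounded_borel g \<longleftrightarrow> g \<in> borel_measurable borel \<and> (\<exists>c. \<forall>z. \<bar>g z\<bar> \<le> c)"

lemma bounded_borelI: "g \<in> borel_measurable borel \<Longrightarrow> (\<And>z. \<bar>g z\<bar> \<le> c) \<Longrightarrow> bounded_borel g"
  unfolding bounded_borel_def by blast

lemma bounded_borel_measurable: "bounded_borel g \<Longrightarrow> g \<in> borel_measurable borel"
  unfolding bounded_borel_def by blast

lemma bounded_borel_const: "bounded_borel (\<lambda>z. c)"
  by (rule bounded_borelI[where c = "\<bar>c\<bar>"]) auto

lemma bounded_borel_indicator: "B \<in> sets borel \<Longrightarrow> bounded_borel (indicator B)"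
  by (rule bounded_borelI[where c = 1]) (auto simp: indicator_def)

lemma bounded_borel_mult:
  assumes "bounded_borel g" "bounded_borel h"
  shows "bounded_borel (\<lambda>z. g z * h z)"
proof -
  obtain c d where c: "\<And>z. \<bar>g z\<bar> \<le> c" and d: "\<And>z. \<bar>h z\<bar> \<le> d"
    using assms unfolding bounded_borel_def by blast
  show ?thesis
  proof (rule bounded_borelI)
    show "(\<lambda>z. g z * h z) \<in> borel_measurable borel"
      using assms by (intro borel_measurable_times bounded_borel_measurable)
    show "\<bar>g z * h z\<bar> \<le> c * d" for z
      unfolding abs_mult by (rule mult_mono) (use c[of z] d[of z] in auto)
  qed
qed

lemma integrable_bounded_borel:
  assumes "finite_measure M" "sets M = sets borel" "bounded_borel g"
  shows "integrable M g"
proof -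
  interpret finite_measure M by fact
  obtain c where c: "\<And>z. \<bar>g z\<bar> \<le> c" using assms(3) unfolding bounded_borel_def by blast
  have "g \<in> borel_measurable M"
    using bounded_borel_measurable[OF assms(3)] measurable_cong_sets[OF assms(2) refl] by blast
  then show ?thesis by (intro integrable_const_bound[where B = c]) (auto simp: c)
qed

text \<open>
  Linear functionals on the symmetric part of the double commutant of \<open>X\<close> that respect increasing
  strong limits.  The examples are vector states, vector states composed with a left multiplication,
  and the trace.
\<close>

definition normal_functional :: "('a::{real_inner,complete_space} \<Rightarrow>\<^sub>L 'a) \<Rightarrow> (('a \<Rightarrow>\<^sub>L 'a) \<Rightarrow> real) \<Rightarrow> bool" where
  "normal_functional X \<phi> \<longleftrightarrow>
    (\<forall>A B. sym_op A \<and> bicommutes X A \<longrightarrow> sym_op B \<and> bicommutes X B \<longrightarrow> \<phi> (A + B) = \<phi> A + \<phi> B) \<and>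
    (\<forall>A c. sym_op A \<and> bicommutes X A \<longrightarrow> \<phi> (c *\<^sub>R A) = c * \<phi> A) \<and>
    (\<forall>A L. (\<forall>n::nat. sym_op (A n) \<and> bicommutes X (A n)) \<longrightarrow> sym_op L \<and> bicommutes X L \<longrightarrow>
       (\<forall>n x. A n x \<bullet> x \<le> A (Suc n) x \<bullet> x) \<longrightarrow> (\<forall>x. (\<lambda>n. A n x) \<longlonglongrightarrow> L x) \<longrightarrow>
       (\<lambda>n. \<phi> (A n)) \<longlonglongrightarrow> \<phi> L)"

definition has_distribution :: "('a::{real_inner,complete_space} \<Rightarrow>\<^sub>L 'a) \<Rightarrow> (('a \<Rightarrow>\<^sub>L 'a) \<Rightarrow> real) \<Rightarrow> real measure \<Rightarrow> bool" where
  "has_distribution X \<phi> \<nu> \<longleftrightarrow> finite_measure \<nu> \<and> sets \<nu> = sets borel \<and>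
     (\<forall>t. \<phi> (upper_proj X t) = measure \<nu> {t<..})"

text \<open>
  \<open>A = g(X)\<close>, expressed through all normal functionals at once.  Vector states determine \<open>A\<close>; that the
  same induction over \<open>g\<close> also serves every other normal functional yields multiplicativity and the
  trace formula without further approximation arguments.
\<close>

definition represents :: "('a::{real_inner,complete_space} \<Rightarrow>\<^sub>L 'a) \<Rightarrow> (real \<Rightarrow> real) \<Rightarrow> ('a \<Rightarrow>\<^sub>L 'a) \<Rightarrow> bool" where
  "represents X g A \<longleftrightarrow> sym_op A \<and> bicommutes X A \<and>
     (\<forall>\<phi> \<nu>. normal_functional X \<phi> \<longrightarrow> has_distribution X \<phi> \<nu> \<longrightarrow> \<phi> A = (\<integral>z. g z \<partial>\<nu>))"

lemma normal_functional_left_mult: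
  "normal_functional X (\<lambda>A. C (A x) \<bullet> y)" for C :: "'a::{real_inner,complete_space} \<Rightarrow>\<^sub>L 'a"
  unfolding normal_functional_def
  by (auto simp: blin_simps inner_simps intro!: tendsto_inner[OF bounded_linear.tendsto[OF blinfun.bounded_linear_right] tendsto_const])

lemma normal_functional_vector: "normal_functional X (\<lambda>A. A x \<bullet> x)"
  using normal_functional_left_mult[of X id_blinfun x x] by simp

context
  fixes X :: "'a::{real_inner,complete_space} \<Rightarrow>\<^sub>L 'a"
  assumes X: "sym_op X"
begin

lemma has_distribution_vector: "has_distribution X (\<lambda>A. A x \<bullet> x) (spec_measure X x)"
  unfolding has_distribution_def
  by (simp add: finite_spec_measure[OF X] measure_spec_measure[OF X])

lemma represents_quad: "represents X g A \<Longrightarrow> A x \<bullet> x = (\<integral>z. g z \<partial>spec_measure X x)"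
  unfolding represents_def using normal_functional_vector has_distribution_vector by blast

lemma represents_sym: "represents X g A \<Longrightarrow> sym_op A"
  and represents_bicommutes: "represents X g A \<Longrightarrow> bicommutes X A"
  and represents_functional: "represents X g A \<Longrightarrow> normal_functional X \<phi> \<Longrightarrow> has_distribution X \<phi> \<nu>
    \<Longrightarrow> \<phi> A = (\<integral>z. g z \<partial>\<nu>)"
  unfolding represents_def by blast+

lemma represents_unique: "represents X g A \<Longrightarrow> represents X g B \<Longrightarrow> A = B"
  by (rule sym_op_eqI) (simp_all add: represents_sym represents_quad)

lemma represents_add:
  assumes A: "represents X g A" and B: "represents X h B" and g: "bounded_borel g" and h: "bounded_borel h"
  shows "represents X (\<lambda>z. g z + h z) (A + B)"
  unfolding represents_def
proof (intro conjI allI impI)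
  show "sym_op (A + B)" "bicommutes X (A + B)"
    using A B by (auto simp: represents_def intro: sym_op_intros bicommutes_intros)
  fix \<phi> \<nu> assume p: "normal_functional X \<phi>" "has_distribution X \<phi> \<nu>"
  then have "\<phi> (A + B) = \<phi> A + \<phi> B"
    using A B unfolding normal_functional_def represents_def by blast
  also have "\<dots> = (\<integral>z. g z \<partial>\<nu>) + (\<integral>z. h z \<partial>\<nu>)"
    using represents_functional[OF A p] represents_functional[OF B p] by simp
  also have "\<dots> = (\<integral>z. g z + h z \<partial>\<nu>)"
    using p g h by (intro Bochner_Integration.integral_add[symmetric] integrable_bounded_borel)
      (auto simp: has_distribution_def)
  finally show "\<phi> (A + B) = (\<integral>z. g z + h z \<partial>\<nu>)" .
qed

lemma represents_scale:
  assumes A: "represents X g A"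
  shows "represents X (\<lambda>z. c * g z) (c *\<^sub>R A)"
  unfolding represents_def
proof (intro conjI allI impI)
  show "sym_op (c *\<^sub>R A)" "bicommutes X (c *\<^sub>R A)"
    using A by (auto simp: represents_def intro: sym_op_intros bicommutes_intros)
  fix \<phi> \<nu> assume p: "normal_functional X \<phi>" "has_distribution X \<phi> \<nu>"
  then have "\<phi> (c *\<^sub>R A) = c * \<phi> A"
    using A unfolding normal_functional_def represents_def by blast
  then show "\<phi> (c *\<^sub>R A) = (\<integral>z. c * g z \<partial>\<nu>)"
    using represents_functional[OF A p] by simp
qed

lemma represents_upper_proj: "represents X (indicator {t<..}) (upper_proj X t)"
  unfolding represents_def has_distribution_def
  by (auto simp: proj_opD(1)[OF upper_proj_proj_op[OF X]] upper_proj_bicommutes[OF X])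

text \<open>
  The total mass of \<open>\<nu>\<close> is already visible on half-lines, since \<open>upper_proj X t\<close> is the identity for \<open>t < -\<parallel>X\<parallel>\<close>.
\<close>

lemma represents_one: "represents X (\<lambda>z. 1) id_blinfun"
  unfolding represents_def
proof (intro conjI allI impI)
  fix \<phi> \<nu> assume p: "normal_functional X \<phi>" "has_distribution X \<phi> \<nu>"
  then interpret finite_measure \<nu> by (simp add: has_distribution_def)
  have s: "sets \<nu> = sets borel" using p by (simp add: has_distribution_def)
  have "emeasure \<nu> UNIV = ennreal (\<phi> id_blinfun)"
  proof (rule emeasure_UNIV_greaterThan[OF s])
    fix t assume "t < - norm X"
    then have "\<phi> id_blinfun = measure \<nu> {t<..}"
      using p upper_proj_bot_norm[OF X] unfolding has_distribution_def by metis
    then show "emeasure \<nu> {t<..} = ennreal (\<phi> id_blinfun)" by (simp add: emeasure_eq_measure)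
  qed
  moreover have "0 \<le> \<phi> id_blinfun"
  proof -
    have "\<phi> (upper_proj X (- norm X - 1)) = measure \<nu> {- norm X - 1<..}"
      using p unfolding has_distribution_def by blast
    then show ?thesis by (simp add: upper_proj_bot_norm[OF X])
  qed
  ultimately have "measure \<nu> (space \<nu>) = \<phi> id_blinfun"
    using sets_eq_imp_space_eq[OF s] by (simp add: measure_def)
  then show "\<phi> id_blinfun = (\<integral>z. 1 \<partial>\<nu>)" by simp
qed (auto intro: sym_op_intros bicommutes_intros)

lemma represents_limit:
  assumes A: "\<And>n. represents X (g n) (A n)" and inc: "\<And>n z. g n z \<le> g (Suc n) z"
    and bd: "\<And>n z. \<bar>g n z\<bar> \<le> c" and meas: "\<And>n. g n \<in> borel_measurable borel"
    and lim: "\<And>z. (\<lambda>n. g n z) \<longlonglongrightarrow> h z"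
  shows "\<exists>L. represents X h L \<and> (\<forall>x. (\<lambda>n. A n x) \<longlonglongrightarrow> L x)"
proof -
  note [measurable] = meas
  have h[measurable]: "h \<in> borel_measurable borel"
    by (rule borel_measurable_LIMSEQ_real[OF lim]) measurable
  have bb: "bounded_borel (g n)" for n by (rule bounded_borelI[OF meas bd])
  have sy: "sym_op (A n)" for n by (rule represents_sym[OF A])
  have Ainc: "A n x \<bullet> x \<le> A (Suc n) x \<bullet> x" for n x
    unfolding represents_quad[OF A]
    by (intro integral_mono inc integrable_bounded_borel finite_spec_measure[OF X] bb) auto
  have Abd: "A n x \<bullet> x \<le> c * (x \<bullet> x)" for n x
  proof -
    interpret finite_measure "spec_measure X x" by (rule finite_spec_measure[OF X])
    have "g n z \<le> c" for z using bd[of n z] by simp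
    then have "A n x \<bullet> x \<le> (\<integral>z. c \<partial>spec_measure X x)"
      unfolding represents_quad[OF A]
      by (intro integral_mono integrable_bounded_borel finite_spec_measure[OF X] bb bounded_borel_const) simp_all
    then show ?thesis by (simp add: measure_spec_measure[OF X] mult.commute)
  qed
  obtain L where L: "sym_op L" "\<forall>x. (\<lambda>n. A n x) \<longlonglongrightarrow> L x"
    and Lc: "\<forall>X. (\<forall>n. bicommutes X (A n)) \<longrightarrow> bicommutes X L"
    using monotone_operator_limit[of A, OF sy Ainc Abd] by blast
  have LX: "bicommutes X L" using Lc represents_bicommutes[OF A] by blast
  have "represents X h L"
    unfolding represents_def
  proof (intro conjI allI impI L LX)
    fix \<phi> \<nu> assume p: "normal_functional X \<phi>" "has_distribution X \<phi> \<nu>"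
    then interpret finite_measure \<nu> by (simp add: has_distribution_def)
    have s[measurable_cong]: "sets \<nu> = sets borel" using p by (simp add: has_distribution_def)
    have "(\<lambda>n. \<phi> (A n)) \<longlonglongrightarrow> \<phi> L"
      using p(1) represents_sym[OF A] represents_bicommutes[OF A] L LX Ainc
      unfolding normal_functional_def by blast
    moreover have "(\<lambda>n. \<integral>z. g n z \<partial>\<nu>) \<longlonglongrightarrow> (\<integral>z. h z \<partial>\<nu>)"
      by (rule integral_dominated_convergence[where w = "\<lambda>_. c"]) (auto simp: lim bd)
    ultimately show "\<phi> L = (\<integral>z. h z \<partial>\<nu>)"
      unfolding represents_functional[OF A p] by (rule LIMSEQ_unique)
  qed
  then show ?thesis using L by blast
qed

lemma indicator_partial_unions:
  fixes B :: "nat \<Rightarrow> real set"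
  assumes "disjoint_family B"
  shows "indicator (\<Union>i<Suc n. B i) z = (indicator (\<Union>i<n. B i) z + indicator (B n) z :: real)"
    and "(\<lambda>n. indicator (\<Union>i<n. B i) z :: real) \<longlonglongrightarrow> indicator (\<Union>i. B i) z"
proof -
  show "indicator (\<Union>i<Suc n. B i) z = (indicator (\<Union>i<n. B i) z + indicator (B n) z :: real)"
  proof -
    have "z \<notin> B i" if "z \<in> B n" "i < n" for i
      using assms that unfolding disjoint_family_on_def by (metis UNIV_I disjoint_iff less_irrefl)
    then show ?thesis by (auto simp: indicator_def lessThan_Suc)
  qed
  show "(\<lambda>n. indicator (\<Union>i<n. B i) z :: real) \<longlonglongrightarrow> indicator (\<Union>i. B i) z"
    by (rule LIMSEQ_indicator_UN)
qed

lemma represents_disjoint_union: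
  assumes B: "\<And>n. B n \<in> sets borel" and d: "disjoint_family B"
    and A: "\<And>n. represents X (indicator (B n)) (A n)"
  shows "\<exists>L. represents X (indicator (\<Union>n. B n)) L \<and> (\<forall>x. (\<lambda>n. A n x) sums L x)"
proof -
  define S where "S n = (\<Sum>i<n. A i)" for n
  have SS: "S (Suc n) = S n + A n" "S 0 = 0" for n by (simp_all add: S_def)
  have z: "represents X (indicator {}) 0"
    using represents_scale[OF represents_one, of 0] by (simp add: indicator_def[abs_def])
  have Un: "(\<Union>i<n. B i) \<in> sets borel" for n using B by auto
  have S: "represents X (indicator (\<Union>i<n. B i)) (S n)" for n
  proof (induction n)
    case 0 then show ?case by (simp only: SS lessThan_0 UN_empty z)
  next
    case (Suc n)
    have e: "indicator (\<Union>i<Suc n. B i) = (\<lambda>z. indicator (\<Union>i<n. B i) z + indicator (B n) z :: real)"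
      by (rule ext) (rule indicator_partial_unions[OF d])
    show ?case unfolding e SS
      by (rule represents_add[OF Suc A]) (intro bounded_borel_indicator Un B)+
  qed
  have "\<exists>L. represents X (indicator (\<Union>n. B n)) L \<and> (\<forall>x. (\<lambda>n. S n x) \<longlonglongrightarrow> L x)"
  proof (rule represents_limit[OF S, where c = 1])
    show "indicator (\<Union>i<n. B i) z \<le> (indicator (\<Union>i<Suc n. B i) z :: real)" for n z
      unfolding indicator_partial_unions(1)[OF d] by simp
    show "(\<lambda>n. indicator (\<Union>i<n. B i) z :: real) \<longlonglongrightarrow> indicator (\<Union>i. B i) z" for z
      by (rule indicator_partial_unions[OF d])
    show "(indicator (\<Union>i<n. B i) :: real \<Rightarrow> real) \<in> borel_measurable borel" for n
      using Un by (rule borel_measurable_indicator)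
  qed (simp add: indicator_def)
  moreover have "S n x = (\<Sum>i<n. A i x)" for n x
    by (induction n) (simp_all add: SS blin_simps)
  ultimately show ?thesis unfolding sums_def by auto
qed

lemma represents_indicator_exists:
  assumes "B \<in> sets borel"
  shows "\<exists>A. represents X (indicator B) A"
proof -
  let ?G = "range greaterThan :: real set set"
  have gen: "sets borel = sigma_sets UNIV ?G"
    by (subst borel_Ioi) simp
  have B: "B \<in> sigma_sets UNIV ?G" using assms by (simp add: gen)
  have "Int_stable ?G"
  proof (rule Int_stableI)
    fix A B assume "A \<in> ?G" "B \<in> ?G"
    then obtain a b where "A = {a<..}" "B = {b<..}" by blast
    then have "A \<inter> B = {max a b<..}" by auto
    then show "A \<inter> B \<in> ?G" by blast
  qed
  moreover have "?G \<subseteq> Pow UNIV" by simp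
  ultimately show ?thesis using B
  proof (induction rule: sigma_sets_induct_disjoint)
    case (basic A) then show ?case using represents_upper_proj by blast
  next
    case empty
    have "represents X (indicator {}) 0"
      using represents_scale[OF represents_one, of 0] by (simp add: indicator_def[abs_def])
    then show ?case by blast
  next
    case (compl B)
    then obtain A where A: "represents X (indicator B) A" by blast
    have B: "B \<in> sets borel" using compl by (simp add: gen)
    have "represents X (\<lambda>z. 1 + - 1 * indicator B z) (id_blinfun + - 1 *\<^sub>R A)"
      by (intro represents_add represents_scale represents_one A bounded_borel_mult bounded_borel_indicator B)
        (auto intro!: bounded_borelI[where c = 1])
    moreover have "(\<lambda>z. 1 + - 1 * indicator B z) = (indicator (UNIV - B) :: real \<Rightarrow> real)"
      by (auto simp: indicator_def)
    ultimately show ?case by auto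
  next
    case (union B)
    then obtain A where "\<And>n. represents X (indicator (B n)) (A n)" by metis
    moreover have "B n \<in> sets borel" for n using union by (auto simp: gen)
    ultimately show ?case using represents_disjoint_union union by blast
  qed
qed

lemma represents_exists:
  assumes "bounded_borel g"
  shows "\<exists>A. represents X g A"
proof -
  have nonneg: "\<exists>A. represents X u A"
    if u: "u \<in> borel_measurable borel" "\<And>z. 0 \<le> u z" and b: "\<exists>c. \<forall>z. u z \<le> c" for u :: "real \<Rightarrow> real"
  proof -
    have "(\<exists>c. \<forall>z. u z \<le> c) \<longrightarrow> (\<exists>A. represents X u A)"
      using u
    proof (induction rule: borel_measurable_induct_real)
      case (set B) then show ?case using represents_indicator_exists by auto
    next
      case (mult u c)
      show ?case
      proof
        assume "\<exists>d. \<forall>z. c * u z \<le> d"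
        then obtain d where d: "\<And>z. c * u z \<le> d" by blast
        show "\<exists>A. represents X (\<lambda>z. c * u z) A"
        proof (cases "c = 0")
          case True
          then show ?thesis using represents_scale[OF represents_one, of 0] by auto
        next
          case False
          then have "u z \<le> d / c" for z using d[of z] mult by (simp add: field_simps)
          then show ?thesis using mult represents_scale by blast
        qed
      qed
    next
      case (add u v)
      show ?case
      proof
        assume "\<exists>d. \<forall>z. v z + u z \<le> d"
        then obtain d where d: "\<And>z. v z + u z \<le> d" by blast
        have b: "u z \<le> d" "v z \<le> d" for z
          using d[of z] add.hyps(2)[of z] add.hyps(4)[of z] by linarith+
        have "bounded_borel u" "bounded_borel v"
          by (rule bounded_borelI[where c = d]; use b add.hyps in simp)+
        then show "\<exists>A. represents X (\<lambda>z. v z + u z) A"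
          using add b represents_add by blast
      qed
    next
      case (seq U)
      show ?case
      proof
        assume "\<exists>d. \<forall>z. u z \<le> d"
        then obtain d where d: "\<And>z. u z \<le> d" by blast
        have Ud: "U i z \<le> d" for i z
        proof -
          have "incseq (\<lambda>i. U i z)" using seq by (simp add: incseq_def le_fun_def)
          then have "U i z \<le> u z" by (rule incseq_le) (use seq in simp)
          then show ?thesis using d[of z] by simp
        qed
        then obtain A where A: "\<And>i. represents X (U i) (A i)" using seq by metis
        have "\<exists>L. represents X u L \<and> (\<forall>x. (\<lambda>n. A n x) \<longlonglongrightarrow> L x)"
        proof (rule represents_limit[OF A, where c = d])
          show "U n z \<le> U (Suc n) z" for n z using seq by (simp add: incseq_def le_fun_def)
          show "\<bar>U n z\<bar> \<le> d" for n z using Ud seq by simp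
        qed (use seq in auto)
        then show "\<exists>A. represents X u A" by blast
      qed
    qed
    then show ?thesis using b by blast
  qed
  obtain c where c: "\<And>z. \<bar>g z\<bar> \<le> c" using assms unfolding bounded_borel_def by blast
  note [measurable] = bounded_borel_measurable[OF assms]
  have "\<exists>A. represents X (\<lambda>z. g z + c) A"
  proof (rule nonneg)
    show "0 \<le> g z + c" for z using c[of z] by (simp add: abs_le_iff)
    show "\<exists>d. \<forall>z. g z + c \<le> d"
      by (rule exI[of _ "c + c"]) (use c abs_le_D1 in auto)
  qed simp
  then obtain A where A: "represents X (\<lambda>z. g z + c) A" by blast
  have "represents X (\<lambda>z. (g z + c) + - c * 1) (A + - c *\<^sub>R id_blinfun)"
  proof (intro represents_add represents_scale represents_one A)
    show "bounded_borel (\<lambda>z. g z + c)"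
    proof (rule bounded_borelI[where c = "c + \<bar>c\<bar>"])
      show "\<bar>g z + c\<bar> \<le> c + \<bar>c\<bar>" for z
        using c[of z] abs_triangle_ineq[of "g z" c] by linarith
    qed simp
    show "bounded_borel (\<lambda>z. - c * 1)" by (rule bounded_borelI[where c = "\<bar>c\<bar>"]) auto
  qed
  then show ?thesis by auto
qed

end

definition fun_calc :: "('a::{real_inner,complete_space} \<Rightarrow>\<^sub>L 'a) \<Rightarrow> (real \<Rightarrow> real) \<Rightarrow> ('a \<Rightarrow>\<^sub>L 'a)" where
  "fun_calc X g = (SOME A. represents X g A)"

context
  fixes X :: "'a::{real_inner,complete_space} \<Rightarrow>\<^sub>L 'a"
  assumes X: "sym_op X"
begin

lemma represents_fun_calc: "bounded_borel g \<Longrightarrow> represents X g (fun_calc X g)"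
  unfolding fun_calc_def using represents_exists[OF X] by (rule someI_ex)

lemmas sym_fun_calc = represents_sym[OF X represents_fun_calc]
lemmas bicommutes_fun_calc = represents_bicommutes[OF X represents_fun_calc]
lemmas fun_calc_quad = represents_quad[OF X represents_fun_calc]
lemmas fun_calc_functional = represents_functional[OF X represents_fun_calc]

lemma fun_calc_unique: "represents X g A \<Longrightarrow> bounded_borel g \<Longrightarrow> fun_calc X g = A"
  using represents_unique[OF X represents_fun_calc] by blast

lemma fun_calc_greaterThan: "fun_calc X (indicator {t<..}) = upper_proj X t"
  by (rule fun_calc_unique[OF represents_upper_proj[OF X]]) (simp add: bounded_borel_indicator)

lemma fun_calc_one: "fun_calc X (\<lambda>z. 1) = id_blinfun"
  by (rule fun_calc_unique[OF represents_one[OF X]]) (auto intro!: bounded_borelI[where c = 1])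

lemma fun_calc_sums:
  assumes B: "\<And>n. B n \<in> sets borel" and d: "disjoint_family B"
  shows "(\<lambda>n. fun_calc X (indicator (B n)) x) sums fun_calc X (indicator (\<Union>n. B n)) x"
proof -
  have "\<exists>L. represents X (indicator (\<Union>n. B n)) L \<and> (\<forall>x. (\<lambda>n. fun_calc X (indicator (B n)) x) sums L x)"
    by (rule represents_disjoint_union[OF X B d]) (intro represents_fun_calc bounded_borel_indicator B)
  moreover have "fun_calc X (indicator (\<Union>n. B n)) = L" if "represents X (indicator (\<Union>n. B n)) L" for L
    by (rule fun_calc_unique[OF that]) (use B in \<open>auto intro: bounded_borel_indicator\<close>)
  ultimately show ?thesis by auto
qed

text \<open>
  The functional \<open>A \<mapsto> \<langle>C A x, x\<rangle>\<close> is normal, and by hypothesis its distribution is the spectral measure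
  with density \<open>h\<close>.
\<close>

lemma left_mult_fun_calc_quad:
  fixes C :: "'a \<Rightarrow>\<^sub>L 'a"
  assumes h: "bounded_borel h" and h0: "\<And>z. 0 \<le> h z" and g: "bounded_borel g"
    and C: "\<And>t. C (upper_proj X t x) \<bullet> x = (\<integral>z. h z * indicator {t<..} z \<partial>spec_measure X x)"
  shows "C (fun_calc X g x) \<bullet> x = (\<integral>z. h z * g z \<partial>spec_measure X x)"
proof -
  let ?M = "spec_measure X x"
  define N where "N = density ?M (\<lambda>z. ennreal (h z))"
  note [measurable] = bounded_borel_measurable[OF h] bounded_borel_measurable[OF g]
  have int: "integrable ?M (\<lambda>z. h z * indicator B z)" if "B \<in> sets borel" for B
    by (intro integrable_bounded_borel finite_spec_measure[OF X] bounded_borel_mult h bounded_borel_indicator that) simp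
  have em: "emeasure N B = ennreal (\<integral>z. h z * indicator B z \<partial>?M)" if [measurable]: "B \<in> sets borel" for B
  proof -
    have "emeasure N B = (\<integral>\<^sup>+z. ennreal (h z * indicator B z) \<partial>?M)"
      unfolding N_def by (subst emeasure_density) (auto intro!: nn_integral_cong simp: indicator_def)
    also have "\<dots> = ennreal (\<integral>z. h z * indicator B z \<partial>?M)"
      by (rule nn_integral_eq_integral[OF int[OF that]]) (auto simp: h0)
    finally show ?thesis .
  qed
  have "has_distribution X (\<lambda>A. C (A x) \<bullet> x) N"
    unfolding has_distribution_def
  proof (intro conjI allI)
    show "finite_measure N"
      by (rule finite_measureI) (use em[of UNIV] in \<open>simp add: N_def\<close>)
    show "sets N = sets borel" by (simp add: N_def)
    show "C (upper_proj X t x) \<bullet> x = measure N {t<..}" for t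
      unfolding C by (simp add: measure_def em h0)
  qed
  then have "C (fun_calc X g x) \<bullet> x = (\<integral>z. g z \<partial>N)"
    by (rule fun_calc_functional[OF g normal_functional_left_mult])
  also have "\<dots> = (\<integral>z. h z * g z \<partial>?M)"
    unfolding N_def by (subst integral_density) (auto simp: h0)
  finally show ?thesis .
qed

lemma fun_calc_mult:
  assumes h: "bounded_borel h" and h0: "\<And>z. 0 \<le> h z" and g: "bounded_borel g"
  shows "fun_calc X h (fun_calc X g x) = fun_calc X (\<lambda>z. h z * g z) x"
proof -
  \<comment> \<open>The lemma on left multiplications applies first with \<open>C = upper_proj X s\<close>, then with \<open>C = h(X)\<close>.\<close>
  have one: "upper_proj X s (fun_calc X g x) \<bullet> x = (\<integral>z. indicator {s<..} z * g z \<partial>spec_measure X x)"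
    if g: "bounded_borel g" for g s x
  proof (rule left_mult_fun_calc_quad[OF _ _ g])
    show "bounded_borel (indicator {s<..} :: real \<Rightarrow> real)" by (simp add: bounded_borel_indicator)
    fix t
    have "upper_proj X s (upper_proj X t x) = upper_proj X (max s t) x"
      using upper_proj_le[OF X] by (cases "s \<le> t") (auto simp: max_def)
    moreover have "(\<lambda>z. indicator {s<..} z * indicator {t<..} z) = (indicator {max s t<..} :: real \<Rightarrow> real)"
      by (auto simp: indicator_def)
    ultimately show "upper_proj X s (upper_proj X t x) \<bullet> x
        = (\<integral>z. indicator {s<..} z * indicator {t<..} z \<partial>spec_measure X x)"
      by (simp add: measure_spec_measure[OF X])
  qed simp
  have q: "fun_calc X h (fun_calc X g x) \<bullet> x = (\<integral>z. h z * g z \<partial>spec_measure X x)" for x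
  proof (rule left_mult_fun_calc_quad[OF h h0 g])
    fix t
    have "fun_calc X h (upper_proj X t x) = upper_proj X t (fun_calc X h x)"
      by (rule commutesD[OF bicommutes_commute[OF bicommutes_fun_calc[OF h] upper_proj_bicommutes[OF X]]])
    then show "fun_calc X h (upper_proj X t x) \<bullet> x = (\<integral>z. h z * indicator {t<..} z \<partial>spec_measure X x)"
      using one[OF h, of t x] by (simp add: mult.commute)
  qed
  have hg: "bounded_borel (\<lambda>z. h z * g z)" by (rule bounded_borel_mult[OF h g])
  have "fun_calc X h o\<^sub>L fun_calc X g = fun_calc X (\<lambda>z. h z * g z)"
  proof (rule sym_op_eqI)
    show "sym_op (fun_calc X h o\<^sub>L fun_calc X g)"
      by (intro sym_op_bicommutes_compose[of _ _ X] sym_fun_calc bicommutes_fun_calc h g)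
    show "sym_op (fun_calc X (\<lambda>z. h z * g z))" by (rule sym_fun_calc[OF hg])
  qed (simp add: q fun_calc_quad[OF hg])
  then show ?thesis by (metis blinfun_apply_blinfun_compose)
qed

lemma proj_op_fun_calc_indicator:
  assumes B: "B \<in> sets borel"
  shows "proj_op (fun_calc X (indicator B))"
proof -
  have b: "bounded_borel (indicator B :: real \<Rightarrow> real)" by (rule bounded_borel_indicator[OF B])
  have "(\<lambda>z. indicator B z * indicator B z) = (indicator B :: real \<Rightarrow> real)"
    by (auto simp: indicator_def)
  then show ?thesis using fun_calc_mult[OF b _ b] sym_fun_calc[OF b] by (simp add: proj_op_def)
qed

end

section \<open>Complex Hilbert spaces and their underlying real ones\<close>

lemma Re_cinner: "Re (cinner x y) = x \<bullet> y"
  by (simp add: inner_eq_Re_cinner)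

text \<open>
  Complex inner products are recovered from the real one, so complex identities reduce to real ones.
\<close>

lemma Im_cinner: "Im (cinner x y) = x \<bullet> (\<i> *\<^sub>C y)"
proof -
  have "cinner x (\<i> *\<^sub>C y) = cnj (\<i> * cinner y x)"
    by (metis cinner_commute cinner_scaleC_left)
  also have "\<dots> = - \<i> * cinner x y" by (metis cinner_commute complex_cnj_i complex_cnj_mult)
  finally show ?thesis by (simp add: inner_eq_Re_cinner)
qed

lemma cinner_eqI: "x \<bullet> y = u \<bullet> v \<Longrightarrow> x \<bullet> (\<i> *\<^sub>C y) = u \<bullet> (\<i> *\<^sub>C v) \<Longrightarrow> cinner x y = cinner u v"
  by (simp add: complex_eq_iff Re_cinner Im_cinner)

lemma scaleC_i_i: "\<i> *\<^sub>C \<i> *\<^sub>C (x::'h::complex_hilbert_space) = - x"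
  using scaleC_of_real[of "-1" x] by (simp add: scaleC_scaleC)

lemma inner_i_left: "(\<i> *\<^sub>C x) \<bullet> y = - (x \<bullet> (\<i> *\<^sub>C y))"
  by (metis Im_cinner Re_cinner Re_i_times cinner_scaleC_left)

lemma blinfun_scale_op: "scale_op c A x = c *\<^sub>C A x"
  by transfer simp

lemma scaleC_minus_right: "c *\<^sub>C (- x) = - (c *\<^sub>C (x::'h::complex_hilbert_space))"
  using scaleC_add_right[of c x "- x"] scaleC_add_right[of c 0 0]
  by (metis add.right_inverse add_cancel_left_left minus_unique)

lemma scale_op_of_real: "scale_op (complex_of_real r) A = r *\<^sub>R A"
  by (rule blinfun_eqI) (simp add: blinfun_scale_op scaleC_of_real blin_simps)

lemma bounded_ops_iff_commutes:
  "A \<in> bounded_ops \<longleftrightarrow> (\<forall>c. commutes (scale_op c id_blinfun) A)"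
  unfolding bounded_ops_def commutes_def by (auto simp: blinfun_scale_op)

lemma bounded_opsD: "A \<in> bounded_ops \<Longrightarrow> A (c *\<^sub>C x) = c *\<^sub>C A x"
  unfolding bounded_ops_def by blast

lemma bicommutes_bounded_ops: "X \<in> bounded_ops \<Longrightarrow> bicommutes X A \<Longrightarrow> A \<in> bounded_ops"
  unfolding bounded_ops_iff_commutes bicommutes_def by blast

lemma sym_op_Im_zero:
  assumes A: "sym_op A" and b: "A \<in> bounded_ops"
  shows "A x \<bullet> (\<i> *\<^sub>C x) = 0"
proof -
  have "A x \<bullet> (\<i> *\<^sub>C x) = x \<bullet> (\<i> *\<^sub>C A x)"
    using sym_opD[OF A, of x "\<i> *\<^sub>C x"] bounded_opsD[OF b] by simp
  also have "\<dots> = - (A x \<bullet> (\<i> *\<^sub>C x))" by (metis inner_commute inner_i_left)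
  finally show ?thesis by simp
qed

lemma sym_op_cinner:
  assumes A: "sym_op A" and b: "A \<in> bounded_ops"
  shows "cinner (A x) y = cinner x (A y)"
  using sym_opD[OF A, of x y] sym_opD[OF A, of x "\<i> *\<^sub>C y"] bounded_opsD[OF b]
  by (intro cinner_eqI) simp_all

lemma sym_op_cinner_self:
  assumes A: "sym_op A" and b: "A \<in> bounded_ops"
  shows "cinner (A x) x = complex_of_real (A x \<bullet> x)"
  by (simp add: complex_eq_iff Re_cinner Im_cinner sym_op_Im_zero[OF assms])

text \<open>
  On a complex space a real-valued quadratic form forces symmetry: \<open>\<langle>A x, \<i> x\<rangle> = 0\<close> for all \<open>x\<close> is polarized
  with \<open>w = -\<i> y\<close>.
\<close>

lemma positive_op_iff: "positive_op A \<longleftrightarrow> A \<in> bounded_ops \<and> pos_op A"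
proof
  assume p: "positive_op A"
  then have b: "A \<in> bounded_ops" and n: "0 \<le> A x \<bullet> x" and z: "A x \<bullet> (\<i> *\<^sub>C x) = 0" for x
    by (auto simp: positive_op_def complex_nonneg_Reals_iff Re_cinner Im_cinner)
  have "A x \<bullet> y = x \<bullet> A y" for x y
  proof -
    define w where "w = - (\<i> *\<^sub>C y)"
    have iw: "\<i> *\<^sub>C w = y" by (simp add: w_def scaleC_minus_right scaleC_i_i)
    have "A (x + w) \<bullet> (\<i> *\<^sub>C (x + w)) = A x \<bullet> (\<i> *\<^sub>C w) + A w \<bullet> (\<i> *\<^sub>C x)"
      using z[of x] z[of w] by (simp add: blin_simps scaleC_add_right inner_simps)
    then have "A x \<bullet> y = - (A w \<bullet> (\<i> *\<^sub>C x))" using z[of "x + w"] by (simp add: iw)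
    also have "A w = - (\<i> *\<^sub>C A y)" by (simp add: w_def blin_simps bounded_opsD[OF b])
    also have "- (- (\<i> *\<^sub>C A y) \<bullet> (\<i> *\<^sub>C x)) = A y \<bullet> x"
      by (simp add: inner_i_left scaleC_i_i)
    finally show ?thesis by (simp add: inner_commute)
  qed
  then show "A \<in> bounded_ops \<and> pos_op A" using b n by (simp add: pos_op_def sym_op_def)
next
  assume "A \<in> bounded_ops \<and> pos_op A"
  then show "positive_op A"
    unfolding positive_op_def
    by (auto simp: sym_op_cinner_self pos_op_sym pos_opD complex_nonneg_Reals_iff)
qed

text \<open>
  A minimizing sequence of \<open>J x = \<parallel>x\<parallel>\<^sup>2 - 2 f x\<close> is Cauchy by the parallelogram law, and the minimizer \<open>z\<close>
  represents \<open>f\<close>.  This is needed for adjoints to exist, so that \<open>adj A = A\<close> carries information.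
\<close>

lemma riesz_representation:
  fixes f :: "'a::{real_inner,complete_space} \<Rightarrow> real"
  assumes f: "bounded_linear f"
  shows "\<exists>z. \<forall>x. f x = x \<bullet> z"
proof -
  interpret bounded_linear f by fact
  obtain K where K: "\<And>x. norm (f x) \<le> norm x * K" using bounded by blast
  define J where "J x = x \<bullet> x - 2 * f x" for x
  have Jb: "- K\<^sup>2 \<le> J x" for x
  proof -
    have "f x \<le> norm x * K" using K[of x] by simp
    moreover have "0 \<le> (norm x - K)\<^sup>2" by simp
    ultimately show ?thesis by (simp add: J_def dot_square_norm power2_diff mult.assoc)
  qed
  define m where "m = Inf (range J)"
  have bb: "bdd_below (range J)" unfolding bdd_below_def using Jb by blast
  have mle: "m \<le> J x" for x unfolding m_def by (rule cInf_lower[OF _ bb]) simp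
  have "\<exists>x. J x < m + inverse (real (Suc n))" for n
    using cInf_lessD[of "range J" "m + inverse (real (Suc n))"] by (auto simp: m_def)
  then obtain u where u: "\<And>n. J (u n) < m + inverse (real (Suc n))" by metis
  have par: "(norm (x - y))\<^sup>2 \<le> 2 * (J x - m) + 2 * (J y - m)" for x y
  proof -
    have "(norm (x - y))\<^sup>2 = 2 * J x + 2 * J y - 4 * J ((1/2) *\<^sub>R (x + y))"
      by (simp add: J_def add scale power2_norm_eq_inner inner_simps inner_commute field_simps)
    then show ?thesis using mle[of "(1/2) *\<^sub>R (x + y)"] by simp
  qed
  have "Cauchy u"
  proof (rule CauchyI')
    fix e :: real assume e: "0 < e"
    obtain N where N: "inverse (real (Suc N)) < e\<^sup>2 / 4"
      using reals_Archimedean[of "e\<^sup>2 / 4"] e by auto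
    have "dist (u i) (u j) < e" if "N \<le> i" "i < j" for i j
    proof -
      have "inverse (real (Suc i)) \<le> inverse (real (Suc N))" "inverse (real (Suc j)) \<le> inverse (real (Suc N))"
        using that by (auto intro!: le_imp_inverse_le)
      then have "J (u i) - m < e\<^sup>2 / 4" "J (u j) - m < e\<^sup>2 / 4" using u[of i] u[of j] N by linarith+
      then have "(norm (u i - u j))\<^sup>2 < e\<^sup>2" using par[of "u i" "u j"] by (simp add: field_simps)
      then show ?thesis using e unfolding dist_norm by (auto intro: power2_less_imp_less)
    qed
    then show "\<exists>M. \<forall>m\<ge>M. \<forall>n>m. dist (u m) (u n) < e" by blast
  qed
  then obtain z where z: "u \<longlonglongrightarrow> z" using Cauchy_convergent convergent_def by blast
  have "J z \<le> m"
  proof (rule LIMSEQ_le)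
    show "(\<lambda>n. J (u n)) \<longlonglongrightarrow> J z" unfolding J_def by (intro tendsto_intros z tendsto)
    show "(\<lambda>n. m + inverse (real (Suc n))) \<longlonglongrightarrow> m"
      using tendsto_add[OF tendsto_const LIMSEQ_inverse_real_of_nat] by simp
    show "\<exists>N. \<forall>n\<ge>N. J (u n) \<le> m + inverse (real (Suc n))" using u less_imp_le by blast
  qed
  then have Jz: "J z \<le> J x" for x using mle[of x] by simp
  have "f x = x \<bullet> z" for x
  proof -
    define b where "b = z \<bullet> x - f x"
    have q: "0 \<le> 2 * t * b + t\<^sup>2 * (x \<bullet> x)" for t
    proof -
      have "J (z + t *\<^sub>R x) = J z + 2 * t * b + t\<^sup>2 * (x \<bullet> x)"
        by (simp add: J_def b_def add scale inner_simps inner_commute power2_eq_square algebra_simps)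
      then show ?thesis using Jz[of "z + t *\<^sub>R x"] by simp
    qed
    have "b = 0"
    proof (rule ccontr)
      assume b: "b \<noteq> 0"
      define t where "t = - b / (x \<bullet> x + 1)"
      have p: "0 < x \<bullet> x + 1" by (simp add: add_nonneg_pos)
      have bt: "b = - t * (x \<bullet> x + 1)" using p by (simp add: t_def)
      have "0 \<le> 2 * t * (- t * (x \<bullet> x + 1)) + t\<^sup>2 * (x \<bullet> x)" using q[of t] by (simp only: bt[symmetric])
      also have "\<dots> = - (t\<^sup>2 * (x \<bullet> x + 2))" by (simp add: power2_eq_square algebra_simps)
      finally have "t\<^sup>2 * (x \<bullet> x + 2) \<le> 0" by simp
      moreover have "0 < t\<^sup>2 * (x \<bullet> x + 2)" proof (rule mult_pos_pos)
        show "0 < t\<^sup>2" using b p by (simp add: t_def)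
      qed (simp add: add_nonneg_pos)
      ultimately show False by simp
    qed
    then show ?thesis by (simp add: b_def inner_commute)
  qed
  then show ?thesis by blast
qed

lemma inner_left_cancel:
  fixes u v :: "'a::real_inner"
  assumes "\<And>x. x \<bullet> u = x \<bullet> v" shows "u = v"
proof -
  have "(u - v) \<bullet> (u - v) = 0"
    unfolding inner_diff_right[of "u - v" u v] using assms[of "u - v"] by simp
  then show ?thesis by simp
qed

lemma cinner_left_cancel:
  assumes "\<And>x. cinner x u = cinner x v" shows "u = v"
  by (rule inner_left_cancel) (metis assms Re_cinner)

lemma adj_unique:
  fixes A B :: "'h::complex_hilbert_space \<Rightarrow>\<^sub>L 'h"
  assumes "\<And>x y. cinner (A x) y = cinner x (B y)"
  shows "adj A = B"
  unfolding adj_def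
proof (rule the_equality)
  fix C assume C: "\<forall>x y. cinner (A x) y = cinner x (blinfun_apply C y)"
  show "C = B" by (rule blinfun_eqI, rule cinner_left_cancel) (use C assms in metis)
qed (use assms in blast)

lemma adj_cinner:
  fixes A :: "'h::complex_hilbert_space \<Rightarrow>\<^sub>L 'h"
  assumes b: "A \<in> bounded_ops"
  shows "cinner (A x) y = cinner x (adj A y)"
proof -
  have "\<exists>z. \<forall>x. A x \<bullet> y = x \<bullet> z" for y
    by (rule riesz_representation) (intro bounded_linear_inner_left_comp blinfun.bounded_linear_right)
  then obtain a where a: "\<And>x y. A x \<bullet> y = x \<bullet> a y" by metis
  have "bounded_linear a"
  proof (rule bounded_linear_intro)
    show "a (x + y) = a x + a y" for x y by (rule inner_left_cancel) (simp add: inner_add_right a[symmetric])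
    show "a (r *\<^sub>R x) = r *\<^sub>R a x" for r x by (rule inner_left_cancel) (simp add: a[symmetric])
    show "norm (a y) \<le> norm y * norm A" for y
    proof (cases "a y = 0")
      case False
      have "norm (a y) * norm (a y) = A (a y) \<bullet> y" by (simp add: a dot_square_norm power2_eq_square)
      also have "\<dots> \<le> norm (A (a y)) * norm y" by (rule norm_cauchy_schwarz)
      also have "\<dots> \<le> (norm A * norm (a y)) * norm y" by (intro mult_right_mono norm_blinfun) simp
      finally have "norm (a y) * norm (a y) \<le> (norm y * norm A) * norm (a y)" by (simp add: mult_ac)
      then show ?thesis by (rule mult_right_le_imp_le) (simp add: False)
    qed simp
  qed
  then have ap: "blinfun_apply (Blinfun a) = a" by (rule bounded_linear_Blinfun_apply)
  have ai: "a (\<i> *\<^sub>C y) = \<i> *\<^sub>C a y" for y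
  proof (rule inner_left_cancel)
    fix x
    have "x \<bullet> a (\<i> *\<^sub>C y) = - ((\<i> *\<^sub>C A x) \<bullet> y)" by (simp add: a[symmetric] inner_i_left)
    also have "\<dots> = - ((\<i> *\<^sub>C x) \<bullet> a y)" by (simp add: a[symmetric] bounded_opsD[OF b])
    finally show "x \<bullet> a (\<i> *\<^sub>C y) = x \<bullet> (\<i> *\<^sub>C a y)" by (simp add: inner_i_left)
  qed
  have "cinner (A x) y = cinner x (Blinfun a y)" for x y
    unfolding ap by (rule cinner_eqI) (simp_all add: a ai)
  then show ?thesis using adj_unique by metis
qed

lemma adj_eq_self_iff:
  assumes b: "A \<in> bounded_ops"
  shows "adj A = A \<longleftrightarrow> sym_op A"
proof
  assume "adj A = A"
  then have "cinner (A x) y = cinner x (A y)" for x y using adj_cinner[OF b] by simp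
  then show "sym_op A" unfolding sym_op_def using Re_cinner by metis
qed (use adj_unique sym_op_cinner[OF _ b] in blast)

lemma is_projection_iff: "is_projection P \<longleftrightarrow> P \<in> bounded_ops \<and> proj_op P"
proof -
  have "P o\<^sub>L P = P \<longleftrightarrow> (\<forall>x. P (P x) = P x)"
    by (metis blinfun_apply_blinfun_compose blinfun_eqI)
  then show ?thesis unfolding is_projection_def proj_op_def using adj_eq_self_iff by blast
qed

section \<open>The spectral theorem for self-adjoint operators\<close>

lemma sets_scalar_measure [simp, measurable_cong]: "sets (scalar_measure E x) = sets borel"
  and space_scalar_measure [simp]: "space (scalar_measure E x) = UNIV"
  unfolding scalar_measure_def using sets.sigma_sets_eq[of "borel :: complex measure"]
  by (simp_all add: sets_measure_of space_measure_of)

context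
  fixes E :: "complex set \<Rightarrow> ('h::complex_hilbert_space \<Rightarrow>\<^sub>L 'h)"
  assumes E: "projection_valued_measure E"
begin

lemma pvm_proj: "B \<in> sets borel \<Longrightarrow> proj_op (E B)"
  and pvm_UNIV: "E UNIV = id_blinfun"
  and pvm_Int: "A \<in> sets borel \<Longrightarrow> B \<in> sets borel \<Longrightarrow> E (A \<inter> B) = E A o\<^sub>L E B"
  using E unfolding projection_valued_measure_def is_projection_iff by blast+

lemma pvm_sums: "range B \<subseteq> sets borel \<Longrightarrow> disjoint_family B \<Longrightarrow>
    (\<lambda>n::nat. E (B n) x) sums E (\<Union>n. B n) x"
  using E unfolding projection_valued_measure_def by blast

lemma pvm_quad_nonneg: "B \<in> sets borel \<Longrightarrow> 0 \<le> E B x \<bullet> x"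
  by (rule pos_opD[OF proj_op_pos[OF pvm_proj]])

lemma emeasure_scalar_measure:
  assumes "B \<in> sets borel"
  shows "emeasure (scalar_measure E x) B = ennreal (E B x \<bullet> x)"
proof -
  have "emeasure (scalar_measure E x) B = ennreal (Re (cinner (E B x) x))"
    unfolding scalar_measure_def
  proof (rule emeasure_measure_of_sigma)
    show "sigma_algebra UNIV (sets (borel :: complex measure))"
      using sets.sigma_algebra_axioms[of "borel :: complex measure"] by simp
    have "E {} x = 0"
      using pvm_sums[of "\<lambda>_. {}" x] summable_LIMSEQ_zero[of "\<lambda>_::nat. E {} x"]
        LIMSEQ_unique[OF tendsto_const, of "E {} x" 0] by (auto simp: disjoint_family_on_def sums_iff)
    then show "positive (sets borel) (\<lambda>B. ennreal (Re (cinner (E B x) x)))"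
      by (simp add: positive_def Re_cinner)
    show "countably_additive (sets borel) (\<lambda>B. ennreal (Re (cinner (E B x) x)))"
    proof (rule countably_additiveI)
      fix A :: "nat \<Rightarrow> complex set"
      assume A: "range A \<subseteq> sets borel" "disjoint_family A"
      have "(\<lambda>n. E (A n) x \<bullet> x) sums (E (\<Union>n. A n) x \<bullet> x)"
        by (rule bounded_linear.sums[OF bounded_linear_inner_left pvm_sums[OF A]])
      then show "(\<Sum>i. ennreal (Re (cinner (E (A i) x) x))) = ennreal (Re (cinner (E (\<Union>i. A i) x) x))"
        unfolding Re_cinner using A by (intro suminf_ennreal_eq pvm_quad_nonneg) auto
    qed
  qed (use assms in simp)
  then show ?thesis by (simp add: Re_cinner)
qed

lemma finite_scalar_measure: "finite_measure (scalar_measure E x)"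
  by (rule finite_measureI) (simp add: emeasure_scalar_measure)

lemma measure_scalar_measure: "B \<in> sets borel \<Longrightarrow> measure (scalar_measure E x) B = E B x \<bullet> x"
  by (simp add: measure_def emeasure_scalar_measure pvm_quad_nonneg)

lemma pvm_compl: 
  assumes B: "B \<in> sets borel"
  shows "E (UNIV - B) = id_blinfun - E B"
proof (rule sym_op_eqI)
  fix x
  interpret finite_measure "scalar_measure E x" by (rule finite_scalar_measure)
  show "E (UNIV - B) x \<bullet> x = (id_blinfun - E B) x \<bullet> x"
    using finite_measure_compl[of B] B borel_comp[OF B]
    by (simp add: measure_scalar_measure pvm_UNIV blin_simps inner_simps Compl_eq_Diff_UNIV)
next
  show "sym_op (E (UNIV - B))"
    using borel_comp[OF B] by (simp add: proj_opD(1)[OF pvm_proj] Compl_eq_Diff_UNIV)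
  show "sym_op (id_blinfun - E B)"
    by (intro sym_op_intros proj_opD(1)[OF pvm_proj] B)
qed

lemma scalar_measure_restrict:
  assumes B: "B \<in> sets borel"
  shows "scalar_measure E (E B x) = density (scalar_measure E x) (\<lambda>z. ennreal (indicator B z))"
proof (rule measure_eqI)
  fix A assume "A \<in> sets (scalar_measure E (E B x))"
  then have A: "A \<in> sets borel" by simp
  have "E A (E B x) \<bullet> E B x = E B (E A (E B x)) \<bullet> x"
    using sym_opD[OF proj_opD(1)[OF pvm_proj[OF B]], of "E A (E B x)" x] by simp
  also have "\<dots> = E (B \<inter> (A \<inter> B)) x \<bullet> x"
    using A B pvm_Int[of B "A \<inter> B"] pvm_Int[of A B] by simp
  also have "B \<inter> (A \<inter> B) = A \<inter> B" by blast
  finally have "emeasure (scalar_measure E (E B x)) A = emeasure (scalar_measure E x) (A \<inter> B)"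
    using A B by (simp add: emeasure_scalar_measure)
  also have "\<dots> = emeasure (density (scalar_measure E x) (\<lambda>z. ennreal (indicator B z))) A"
    using A B by (subst emeasure_density) (auto simp: ennreal_indicator indicator_inter_arith[symmetric] nn_integral_indicator Int_commute)
  finally show "emeasure (scalar_measure E (E B x)) A =
      emeasure (density (scalar_measure E x) (\<lambda>z. ennreal (indicator B z))) A" .
qed simp

end

lemma spectral_resolution_exists:
  fixes X :: "'h::complex_hilbert_space \<Rightarrow>\<^sub>L 'h"
  assumes X: "sym_op X" and b: "X \<in> bounded_ops"
  shows "\<exists>E. spectral_resolution X E \<and> E (complex_of_real ` {t<..}) = upper_proj X t"
proof -
  define R where "R B = complex_of_real -` B" for B
  define E where "E B = fun_calc X (indicator (R B))" for B
  have RB: "R B \<in> sets borel" if "B \<in> sets borel" for B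
  proof -
    have "complex_of_real \<in> borel_measurable borel" by measurable
    from measurable_sets[OF this that] show ?thesis by (simp add: R_def)
  qed
  have bi: "bounded_borel (indicator (R B) :: real \<Rightarrow> real)" if "B \<in> sets borel" for B
    by (rule bounded_borel_indicator[OF RB[OF that]])
  have E: "projection_valued_measure E"
    unfolding projection_valued_measure_def is_projection_iff
  proof (intro conjI allI ballI impI)
    fix B :: "complex set" assume B: "B \<in> sets borel"
    show "proj_op (E B)" unfolding E_def by (rule proj_op_fun_calc_indicator[OF X RB[OF B]])
    show "E B \<in> bounded_ops" unfolding E_def
      by (rule bicommutes_bounded_ops[OF b bicommutes_fun_calc[OF X bi[OF B]]])
  next
    have "(indicator (R UNIV) :: real \<Rightarrow> real) = (\<lambda>z. 1)" by (auto simp: R_def)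
    then show "E UNIV = id_blinfun" by (simp add: E_def fun_calc_one[OF X])
  next
    fix A B :: "complex set" assume A: "A \<in> sets borel" and B: "B \<in> sets borel"
    have "(indicator (R (A \<inter> B)) :: real \<Rightarrow> real) = (\<lambda>z. indicator (R A) z * indicator (R B) z)"
      by (auto simp: R_def indicator_def)
    then show "E (A \<inter> B) = E A o\<^sub>L E B"
      unfolding E_def by (intro blinfun_eqI) (simp add: fun_calc_mult[OF X bi[OF A] _ bi[OF B]])
  next
    fix B :: "nat \<Rightarrow> complex set" and x assume B: "range B \<subseteq> sets borel" "disjoint_family B"
    have "(\<lambda>n. fun_calc X (indicator (R (B n))) x) sums fun_calc X (indicator (\<Union>n. R (B n))) x"
      by (rule fun_calc_sums[OF X]) (use B RB in \<open>auto simp: R_def disjoint_family_on_def\<close>)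
    moreover have "(\<Union>n. R (B n)) = R (\<Union>n. B n)" by (auto simp: R_def)
    ultimately show "(\<lambda>n. E (B n) x) sums E (\<Union>n. B n) x" by (simp add: E_def)
  qed
  have dist: "scalar_measure E x = distr (spec_measure X x) borel complex_of_real" for x
  proof (rule measure_eqI)
    fix B assume "B \<in> sets (scalar_measure E x)"
    then have B: "B \<in> sets borel" by simp
    interpret finite_measure "spec_measure X x" by (rule finite_spec_measure[OF X])
    have "E B x \<bullet> x = measure (spec_measure X x) (R B)"
      unfolding E_def fun_calc_quad[OF X bi[OF B]] using RB[OF B] by simp
    then have "emeasure (scalar_measure E x) B = emeasure (spec_measure X x) (R B)"
      by (simp add: emeasure_scalar_measure[OF E B] emeasure_eq_measure)
    also have "\<dots> = emeasure (distr (spec_measure X x) borel complex_of_real) B"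
      by (subst emeasure_distr) (use B in \<open>auto simp: R_def\<close>)
    finally show "emeasure (scalar_measure E x) B = emeasure (distr (spec_measure X x) borel complex_of_real) B" .
  qed simp
  have int: "integrable (spec_measure X x) (\<lambda>z. z)" for x
    by (rule integrable_spec_measureI[OF X, where c = "norm X + 1"]) auto
  have "spectral_resolution X E"
    unfolding spectral_resolution_def
  proof (intro conjI E allI)
    fix x
    show "integrable (scalar_measure E x) (\<lambda>z. z)"
      unfolding dist by (subst integrable_distr_eq) (auto intro: int)
    have "(\<integral>z. z \<partial>scalar_measure E x) = (\<integral>z. complex_of_real z \<partial>spec_measure X x)"
      unfolding dist by (subst integral_distr) auto
    then show "cinner (X x) x = (\<integral>z. z \<partial>scalar_measure E x)"
      by (simp add: sym_op_cinner_self[OF X b] spectral_integral[OF X])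
  qed
  moreover have "R (complex_of_real ` {t<..}) = {t<..}" by (auto simp: R_def)
  then have "E (complex_of_real ` {t<..}) = upper_proj X t"
    by (simp add: E_def fun_calc_greaterThan[OF X])
  ultimately show ?thesis by blast
qed

lemma of_real_greaterThan_borel: "complex_of_real ` {t<..} \<in> sets borel"
proof -
  have "complex_of_real ` {t<..} = {z \<in> space borel. Im z = 0 \<and> t < Re z}"
    by (auto simp: complex_eq_iff image_iff)
  also have "\<dots> \<in> sets borel" by measurable
  finally show ?thesis .
qed

text \<open>
  An arbitrary resolution lives on the complex plane and is not known to commute with \<open>X\<close>.  Splitting the
  quadratic form of \<open>X\<close> over \<open>B\<close> and its complement shows that \<open>X\<close> commutes with \<open>E B\<close>; symmetry of
  \<open>X\<close> then makes the non-real part of the plane null, and the projection for a half-line satisfies the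
  order condition that characterises \<open>upper_proj X t\<close>.
\<close>

lemma spectral_resolution_unique:
  fixes X :: "'h::complex_hilbert_space \<Rightarrow>\<^sub>L 'h"
  assumes X: "sym_op X" and b: "X \<in> bounded_ops" and res: "spectral_resolution X E"
  shows "E (complex_of_real ` {t<..}) = upper_proj X t"
proof -
  let ?m = "scalar_measure E"
  have E: "projection_valued_measure E" using res unfolding spectral_resolution_def by blast
  have int: "integrable (?m x) (\<lambda>z. z)" and ci: "cinner (X x) x = (\<integral>z. z \<partial>?m x)" for x
    using res unfolding spectral_resolution_def by blast+
  have intRe: "integrable (?m x) Re" and intIm: "integrable (?m x) Im" for x
    using integrable_Re[OF int] integrable_Im[OF int] by auto
  have Re: "X x \<bullet> x = (\<integral>z. Re z \<partial>?m x)" for x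
    using integral_Re[OF int, of x] ci[of x] Re_cinner[of "X x" x] by simp
  have Im: "(\<integral>z. Im z \<partial>?m x) = 0" for x
    using integral_Im[OF int, of x] ci[of x] Im_cinner[of "X x" x] sym_op_Im_zero[OF X b, of x] by simp
  have restr: "(\<integral>z. f z \<partial>?m (E B x)) = (\<integral>z. indicator B z * f z \<partial>?m x)"
    if "B \<in> sets borel" "f \<in> borel_measurable borel" for B x and f :: "complex \<Rightarrow> real"
    unfolding scalar_measure_restrict[OF E that(1)] using that by (subst integral_density) auto
  have intB: "integrable (?m x) (\<lambda>z. indicator B z * f z)" if "B \<in> sets borel" "integrable (?m x) f"
    for B x and f :: "complex \<Rightarrow> real"
    using integrable_mult_indicator[of B "?m x" f] that by simp
  have comm: "commutes (E B) X" if B: "B \<in> sets borel" for B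
  proof -
    define P where "P = E B"
    define Q where "Q = id_blinfun - P"
    have P: "proj_op P" unfolding P_def by (rule pvm_proj[OF E B])
    have Q: "proj_op Q" unfolding Q_def by (rule proj_op_complement[OF P])
    have cB: "UNIV - B \<in> sets borel" using borel_comp[OF B] by (simp add: Compl_eq_Diff_UNIV)
    have EQ: "E (UNIV - B) = Q" unfolding Q_def P_def by (rule pvm_compl[OF E B])
    have "X = (P o\<^sub>L X o\<^sub>L P) + (Q o\<^sub>L X o\<^sub>L Q)"
    proof (rule sym_op_eqI[OF X])
      have s: "sym_op (P o\<^sub>L X o\<^sub>L P)" if "proj_op P" for P
        using sym_opD[OF X] sym_opD[OF proj_opD(1)[OF that]] unfolding sym_op_def by simp
      show "sym_op ((P o\<^sub>L X o\<^sub>L P) + (Q o\<^sub>L X o\<^sub>L Q))" by (intro sym_op_intros s P Q)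
      fix x
      have "X x \<bullet> x = (\<integral>z. indicator B z * Re z + indicator (UNIV - B) z * Re z \<partial>?m x)"
        unfolding Re by (rule Bochner_Integration.integral_cong) (auto simp: indicator_def)
      also have "\<dots> = X (P x) \<bullet> P x + X (Q x) \<bullet> Q x"
        unfolding Re EQ[symmetric] P_def
        by (subst Bochner_Integration.integral_add) (auto simp: restr B cB intro!: intB intRe)
      also have "\<dots> = ((P o\<^sub>L X o\<^sub>L P) + (Q o\<^sub>L X o\<^sub>L Q)) x \<bullet> x"
        using sym_opD[OF proj_opD(1)[OF P], of "X (P x)" x] sym_opD[OF proj_opD(1)[OF Q], of "X (Q x)" x]
        by (simp add: blin_simps inner_simps)
      finally show "X x \<bullet> x = ((P o\<^sub>L X o\<^sub>L P) + (Q o\<^sub>L X o\<^sub>L Q)) x \<bullet> x" .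
    qed
    note split = arg_cong[OF this, of "\<lambda>A. blinfun_apply A x" for x]
    have XX: "X x = P (X (P x)) + Q (X (Q x))" for x
      by (rule split[unfolded blinfun.add_left blinfun_apply_blinfun_compose])
    have PQ: "P (Q x) = 0" "Q (P x) = 0" "P (P x) = P x" for x
      by (simp_all add: Q_def blin_simps proj_opD(2)[OF P])
    have "P (X x) = P (X (P x))" for x by (subst XX) (simp add: blin_simps PQ)
    moreover have "X (P x) = P (X (P x))" for x by (subst XX) (simp add: blin_simps PQ)
    ultimately show ?thesis unfolding commutes_def P_def by simp
  qed
  have null: "AE z in ?m x. z \<notin> B" if B: "B \<in> sets borel" and f: "f \<in> borel_measurable borel" "integrable (?m x) f"
      "\<And>z. z \<in> B \<Longrightarrow> 0 < f z" and z: "(\<integral>z. f z \<partial>?m (E B x)) = 0" for B x and f :: "complex \<Rightarrow> real"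
  proof -
    have "AE z in ?m x. indicator B z * f z = 0"
      using z integral_nonneg_eq_0_iff_AE[OF intB[OF B f(2)]] f(3)
      unfolding restr[OF B f(1)] by (auto simp: indicator_def less_imp_le)
    then show ?thesis by eventually_elim (use f(3) in \<open>fastforce simp: indicator_def split: if_splits\<close>)
  qed
  have real: "AE z in ?m x. Im z = 0" for x
  proof -
    have "{z \<in> space borel. 0 < Im z} \<in> sets borel" "{z \<in> space borel. Im z < 0} \<in> sets borel" by measurable
    then have m: "{z. 0 < Im z} \<in> sets borel" "{z. Im z < 0} \<in> sets borel" by simp_all
    have "AE z in ?m x. z \<notin> {z. 0 < Im z}" by (rule null[OF m(1), of Im]) (auto simp: intIm Im)
    moreover have "AE z in ?m x. z \<notin> {z. Im z < 0}"
      by (rule null[OF m(2), of "\<lambda>z. - Im z"]) (auto simp: intIm Im)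
    ultimately show ?thesis by eventually_elim auto
  qed
  let ?S = "complex_of_real ` {t<..}"
  have S: "?S \<in> sets borel" by (rule of_real_greaterThan_borel)
  have "cuts X t (E ?S)"
    unfolding cuts_def
  proof (intro conjI allI impI)
    show "proj_op (E ?S)" by (rule pvm_proj[OF E S])
  next
    fix x assume x: "E ?S x = x" "x \<noteq> 0"
    interpret finite_measure "?m x" by (rule finite_scalar_measure[OF E])
    have "measure (?m x) (UNIV - ?S) = 0"
      using finite_measure_compl[of ?S] S x by (simp add: measure_scalar_measure[OF E] pvm_UNIV[OF E])
    then have "AE z in ?m x. z \<in> ?S"
      using S borel_comp[OF S] by (intro AE_I[of _ _ "UNIV - ?S"]) (auto simp: emeasure_eq_measure Compl_eq_Diff_UNIV)
    then have pos: "AE z in ?m x. 0 < Re z - t" by eventually_elim auto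
    have i: "integrable (?m x) (\<lambda>z. Re z - t)" by (intro Bochner_Integration.integrable_diff intRe) simp
    have e: "(\<integral>z. Re z - t \<partial>?m x) = X x \<bullet> x - t * (x \<bullet> x)"
      by (subst Bochner_Integration.integral_diff)
        (auto simp: intRe Re measure_scalar_measure[OF E] pvm_UNIV[OF E])
    have nn: "AE z in ?m x. 0 \<le> Re z - t" using pos by eventually_elim simp
    have "0 \<le> (\<integral>z. Re z - t \<partial>?m x)" by (rule integral_nonneg_AE[OF nn])
    moreover have "(\<integral>z. Re z - t \<partial>?m x) \<noteq> 0"
    proof
      assume "(\<integral>z. Re z - t \<partial>?m x) = 0"
      then have "AE z in ?m x. Re z - t = 0"
        by (rule integral_nonneg_eq_0_iff_AE[OF i nn, THEN iffD1])
      with pos have "AE z in ?m x. False" by eventually_elim simp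
      then have "emeasure (?m x) UNIV = 0" by (simp add: AE_iff_null null_sets_def)
      then show False using x(2) by (simp add: emeasure_scalar_measure[OF E] pvm_UNIV[OF E])
    qed
    ultimately show "t * (x \<bullet> x) < X x \<bullet> x" unfolding e by simp
  next
    fix x assume x: "E ?S x = 0"
    interpret finite_measure "?m x" by (rule finite_scalar_measure[OF E])
    have "AE z in ?m x. z \<notin> ?S"
      using S x by (intro AE_I[of _ _ ?S]) (auto simp: emeasure_scalar_measure[OF E])
    with real have le: "AE z in ?m x. Re z \<le> t"
      by eventually_elim (auto simp: complex_eq_iff image_iff not_less)
    have "(\<integral>z. Re z \<partial>?m x) \<le> (\<integral>z. t \<partial>?m x)"
      by (rule integral_mono_AE[OF intRe _ le]) simp
    then show "X x \<bullet> x \<le> t * (x \<bullet> x)"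
      by (simp add: Re measure_scalar_measure[OF E] pvm_UNIV[OF E] mult.commute)
  qed
  then show ?thesis by (rule upper_proj_unique[OF X _ comm[OF S]])
qed

text \<open>
  Existence and uniqueness together: the definite description is meaningful, with the expected value.
\<close>

theorem spectral_projection_greaterThan:
  assumes X: "sym_op X" and b: "X \<in> bounded_ops"
  shows "spectral_projection X (complex_of_real ` {t<..}) = upper_proj X t"
  unfolding spectral_projection_def
  using spectral_resolution_exists[OF assms, of t] spectral_resolution_unique[OF assms, of _ t]
  by (intro the_equality) metis+

section \<open>Integration over the half-open unit interval\<close>

definition unit_interval :: "real measure" where
  "unit_interval = restrict_space lborel {0..<1}"

lemma space_unit_interval [simp]: "space unit_interval = {0..<1}"
  by (simp add: unit_interval_def space_restrict_space)

lemma measurable_unit_interval: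
  "f \<in> borel_measurable borel \<Longrightarrow> f \<in> borel_measurable unit_interval" for f :: "real \<Rightarrow> real"
  unfolding unit_interval_def by (rule measurable_restrict_space1) simp

lemma emeasure_unit_interval_lessThan:
  assumes "0 \<le> a" "a \<le> 1"
  shows "emeasure unit_interval {0..<a} = ennreal a"
  unfolding unit_interval_def using assms by (subst emeasure_restrict_space) auto

lemma finite_measure_unit_interval: "finite_measure unit_interval"
  by (rule finite_measureI) (use emeasure_unit_interval_lessThan[of 1] in simp)

lemma integral_unit_interval:
  fixes f :: "real \<Rightarrow> real"
  shows "(\<integral>s. f s \<partial>unit_interval) = (\<integral>s. indicator {0..<1} s * f s \<partial>lborel)"
  unfolding unit_interval_def by (subst integral_restrict_space) auto

text \<open>
  Majorization compares initial integrals; it is proved through excess integrals, which for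
  eigenvalue functions are traces of \<open>(X - r)\<^sub>+\<close>.
\<close>

abbreviation initial_integral :: "(real \<Rightarrow> real) \<Rightarrow> real \<Rightarrow> real" where
  "initial_integral h a \<equiv> \<integral>s. indicator {..<a} s * h s \<partial>unit_interval"

abbreviation excess_integral :: "(real \<Rightarrow> real) \<Rightarrow> real \<Rightarrow> real" where
  "excess_integral h r \<equiv> \<integral>s. max (h s - r) 0 \<partial>unit_interval"

lemma integral_unit_interval_lessThan:
  assumes "0 \<le> a" "a \<le> 1"
  shows "(\<integral>s. indicator {..<a} s \<partial>unit_interval) = a"
proof -
  have "(\<integral>s. indicator {..<a} s \<partial>unit_interval) = (\<integral>s. indicator {0..<a} s \<partial>unit_interval)"
    by (rule Bochner_Integration.integral_cong) (auto simp: indicator_def)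
  also have "\<dots> = a"
    using assms by (simp add: measure_def emeasure_unit_interval_lessThan Int_absorb1 ivl_subset)
  finally show ?thesis .
qed

lemma integrable_unit_interval:
  fixes f :: "real \<Rightarrow> real"
  assumes "f \<in> borel_measurable unit_interval" "\<And>s. 0 \<le> s \<Longrightarrow> s < 1 \<Longrightarrow> \<bar>f s\<bar> \<le> c"
  shows "integrable unit_interval f"
proof -
  interpret finite_measure unit_interval by (rule finite_measure_unit_interval)
  show ?thesis
  proof (rule integrable_const_bound[where B = c])
    show "AE s in unit_interval. norm (f s) \<le> c"
      by (rule AE_I2) (use assms(2) in simp)
  qed (rule assms(1))
qed

text \<open>
  The values of \<open>f\<close> at the end points are unrestricted, because the eigenvalue function at \<open>1\<close> is the
  infimum of a set that is unbounded below.
\<close>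

lemma set_integral_eq_unit_interval:
  fixes f g :: "real \<Rightarrow> real"
  assumes g[measurable]: "g \<in> borel_measurable borel" and a: "0 \<le> a" "a \<le> 1"
    and fg: "\<And>s. 0 < s \<Longrightarrow> s < a \<Longrightarrow> f s = g s"
  shows "(LINT s:{0..a}|lborel. f s) = initial_integral g a"
proof -
  define F where "F s = indicator {0..a} s * f s" for s
  define G where "G s = indicator {0..<1} s * (indicator {..<a} s * g s)" for s
  have [measurable]: "G \<in> borel_measurable borel" unfolding G_def[abs_def] by measurable
  have "F = (\<lambda>s. if s = 0 then F 0 else if s = a then F a else G s)"
    using a fg by (auto simp: fun_eq_iff F_def G_def indicator_def)
  also have "\<dots> \<in> borel_measurable borel" by measurable
  finally have [measurable]: "F \<in> borel_measurable borel" .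
  have "(\<integral>s. F s \<partial>lborel) = (\<integral>s. G s \<partial>lborel)"
  proof (rule integral_cong_AE)
    show "AE s in lborel. F s = G s"
      using AE_lborel_singleton[of 0] AE_lborel_singleton[of a]
      by eventually_elim (use a fg in \<open>auto simp: F_def G_def indicator_def\<close>)
  qed auto
  then show ?thesis
    unfolding integral_unit_interval set_lebesgue_integral_def F_def G_def by simp
qed

lemma integral_unit_interval_reflect:
  fixes f :: "real \<Rightarrow> real"
  assumes f[measurable]: "f \<in> borel_measurable borel"
  shows "(\<integral>s. f (1 - s) \<partial>unit_interval) = (\<integral>s. f s \<partial>unit_interval)"
proof -
  have "(\<integral>s. indicator {0..<1} s * f s \<partial>lborel) = (\<integral>s. indicator {0..<1} (1 - s) * f (1 - s) \<partial>lborel)"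
    using lborel_integral_real_affine[of "-1" "\<lambda>s. indicator {0..<1} s * f s" 1] by simp
  also have "\<dots> = (\<integral>s. indicator {0..<1} s * f (1 - s) \<partial>lborel)"
  proof (rule integral_cong_AE)
    show "AE s in lborel. indicator {0..<1} (1 - s) * f (1 - s) = indicator {0..<1} s * f (1 - s)"
      using AE_lborel_singleton[of 0] AE_lborel_singleton[of "1::real"]
      by eventually_elim (auto simp: indicator_def)
  qed measurable
  finally show ?thesis unfolding integral_unit_interval by simp
qed

section \<open>The trace\<close>

context von_neumann_algebra
begin

lemma M_bounded: "A \<in> M \<Longrightarrow> A \<in> bounded_ops"
  using double_commutant unfolding commutant_def by blast

text \<open>
  Scalars and the commutant of \<open>M\<close> commute with \<open>X\<close>, hence with \<open>A\<close>: the former makes \<open>A\<close> complex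
  linear, the latter puts it into the double commutant of \<open>M\<close>.
\<close>

lemma M_bicommutes:
  assumes X: "X \<in> M" and A: "bicommutes X A"
  shows "A \<in> M"
proof -
  have "A o\<^sub>L B = B o\<^sub>L A" if B: "B \<in> commutant M" for B
  proof -
    have "B o\<^sub>L X = X o\<^sub>L B" using B X unfolding commutant_def by blast
    then have "commutes B X" unfolding commutes_def by (metis blinfun_apply_blinfun_compose)
    then have "commutes B A" by (rule bicommutesD[OF A])
    then show ?thesis by (intro blinfun_eqI) (simp add: commutesD)
  qed
  then have "A \<in> commutant (commutant M)"
    using bicommutes_bounded_ops[OF M_bounded[OF X] A] unfolding commutant_def[of "commutant M"] by blast
  then show ?thesis by (simp add: double_commutant)
qed

lemma M_iff: "A \<in> M \<longleftrightarrow> A \<in> bounded_ops \<and> (\<forall>B\<in>commutant M. commutes A B)"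
proof -
  have "A o\<^sub>L B = B o\<^sub>L A \<longleftrightarrow> commutes A B" for B
    unfolding commutes_def by (metis blinfun_apply_blinfun_compose blinfun_eqI)
  then show ?thesis using double_commutant unfolding commutant_def[of "commutant M"] by blast
qed

lemma M_id: "id_blinfun \<in> M"
  and M_scaleR: "A \<in> M \<Longrightarrow> r *\<^sub>R A \<in> M"
  and M_add: "A \<in> M \<Longrightarrow> B \<in> M \<Longrightarrow> A + B \<in> M"
  and M_diff: "A \<in> M \<Longrightarrow> B \<in> M \<Longrightarrow> A - B \<in> M"
  and M_minus: "A \<in> M \<Longrightarrow> - A \<in> M"
  and M_compose: "A \<in> M \<Longrightarrow> B \<in> M \<Longrightarrow> A o\<^sub>L B \<in> M"
  unfolding M_iff bounded_ops_iff_commutes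
  by (auto intro: commutes_intros commutes_sym[OF commutes_intros(1)[OF commutes_sym commutes_sym]]
      commutes_sym[OF commutes_intros(2)[OF commutes_sym commutes_sym]]
      commutes_sym[OF commutes_intros(3)[OF commutes_sym]] commutes_sym[OF commutes_intros(4)[OF commutes_sym]]
      commutes_sym[OF commutes_intros(5)[OF commutes_sym commutes_sym]] commutes_sym[OF commutes_intros(6)])

lemma selfadjoint_part_iff: "X \<in> selfadjoint_part M \<longleftrightarrow> X \<in> M \<and> sym_op X"
  unfolding selfadjoint_part_def using adj_eq_self_iff[OF M_bounded] by blast

lemma M_upper_proj: "X \<in> M \<Longrightarrow> sym_op X \<Longrightarrow> upper_proj X t \<in> M"
  by (rule M_bicommutes[OF _ upper_proj_bicommutes])

lemma M_fun_calc: "X \<in> M \<Longrightarrow> sym_op X \<Longrightarrow> bounded_borel g \<Longrightarrow> fun_calc X g \<in> M"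
  by (rule M_bicommutes[OF _ bicommutes_fun_calc])

end

context tracial_von_neumann_algebra
begin

definition tr :: "('h \<Rightarrow>\<^sub>L 'h) \<Rightarrow> real" where
  "tr A = Re (\<tau> A)"

lemma tr_add: "A \<in> M \<Longrightarrow> B \<in> M \<Longrightarrow> tr (A + B) = tr A + tr B"
  by (simp add: tr_def tau_add)

lemma tau_scaleR: "A \<in> M \<Longrightarrow> \<tau> (r *\<^sub>R A) = complex_of_real r * \<tau> A"
  using tau_scale[of A "complex_of_real r"] by (simp add: scale_op_of_real)

lemma tr_scaleR: "A \<in> M \<Longrightarrow> tr (r *\<^sub>R A) = r * tr A"
  by (simp add: tr_def tau_scaleR)

lemma tr_minus: "A \<in> M \<Longrightarrow> tr (- A) = - tr A"
  using tr_scaleR[of A "-1"] by simp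

lemma tr_diff: "A \<in> M \<Longrightarrow> B \<in> M \<Longrightarrow> tr (A - B) = tr A - tr B"
  using tr_add[of A "- B"] by (simp add: tr_minus M_minus)

lemma tr_one: "tr id_blinfun = 1"
  by (simp add: tr_def tau_one)

lemma tr_commute: "A \<in> M \<Longrightarrow> B \<in> M \<Longrightarrow> tr (A o\<^sub>L B) = tr (B o\<^sub>L A)"
  by (simp add: tr_def tau_tracial)

text \<open>
  Positivity of \<open>\<tau>\<close> is only assumed on products \<open>A\<^sup>*A\<close>; a positive operator is the square of its root.
\<close>

lemma tau_pos_op:
  assumes A: "A \<in> M" and p: "pos_op A"
  shows "\<tau> A \<in> \<real>\<^sub>\<ge>\<^sub>0"
proof -
  obtain S where S: "pos_op S" "S o\<^sub>L S = A" "bicommutes A S" using pos_op_sqrt_exists[OF p] by blast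
  then have SM: "S \<in> M" using M_bicommutes[OF A] by blast
  then have "adj S = S" using adj_eq_self_iff[OF M_bounded] pos_op_sym[OF S(1)] by blast
  then show ?thesis using tau_positive[OF SM] S(2) by simp
qed

lemma tr_pos: "A \<in> M \<Longrightarrow> pos_op A \<Longrightarrow> 0 \<le> tr A"
  using tau_pos_op by (simp add: tr_def complex_nonneg_Reals_iff)

lemma tr_mono: "A \<in> M \<Longrightarrow> B \<in> M \<Longrightarrow> pos_op (B - A) \<Longrightarrow> tr A \<le> tr B"
  using tr_pos[OF M_diff, of B A] by (simp add: tr_diff)

lemma pos_op_add_norm:
  assumes "sym_op A" shows "pos_op (A + norm A *\<^sub>R id_blinfun)"
  unfolding pos_op_def
proof (intro conjI allI)
  show "sym_op (A + norm A *\<^sub>R id_blinfun)" by (intro sym_op_intros assms)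
  show "0 \<le> (A + norm A *\<^sub>R id_blinfun) x \<bullet> x" for x
    using quad_le_norm[of A x] by (simp add: blin_simps inner_simps abs_le_iff)
qed

lemma tau_sym_real:
  assumes A: "A \<in> M" and s: "sym_op A"
  shows "Im (\<tau> A) = 0"
proof -
  have "\<tau> (A + norm A *\<^sub>R id_blinfun) = \<tau> A + complex_of_real (norm A)"
    by (simp add: tau_add A M_scaleR M_id tau_scaleR tau_one)
  moreover have "\<tau> (A + norm A *\<^sub>R id_blinfun) \<in> \<real>\<^sub>\<ge>\<^sub>0"
    by (intro tau_pos_op pos_op_add_norm s M_add A M_scaleR M_id)
  ultimately show ?thesis by (simp add: complex_nonneg_Reals_iff)
qed

lemma tau_compose_real:
  assumes A: "A \<in> M" "sym_op A" and B: "B \<in> M" "sym_op B"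
  shows "\<tau> (A o\<^sub>L B) = complex_of_real (tr (A o\<^sub>L B))"
proof -
  have "sym_op ((A o\<^sub>L B) + (B o\<^sub>L A))"
    unfolding sym_op_def using sym_opD[OF A(2)] sym_opD[OF B(2)] by (simp add: blin_simps inner_simps)
  then have "Im (\<tau> ((A o\<^sub>L B) + (B o\<^sub>L A))) = 0" by (intro tau_sym_real M_add M_compose A B)
  then have "Im (\<tau> (A o\<^sub>L B)) = 0" using A B by (simp add: tau_add M_compose tau_tracial[of B A])
  then show ?thesis by (simp add: complex_eq_iff tr_def)
qed

text \<open>
  The strong limit of an increasing sequence is its supremum in the self-adjoint part of \<open>M\<close>, so normality
  of the trace applies.
\<close>

lemma tr_monotone_limit:
  assumes A: "\<And>n. A n \<in> M" "\<And>n. sym_op (A n)" and L: "L \<in> M" "sym_op L"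
    and inc: "\<And>n x. A n x \<bullet> x \<le> A (Suc n) x \<bullet> x" and lim: "\<And>x. (\<lambda>n. A n x) \<longlonglongrightarrow> L x"
  shows "(\<lambda>n. tr (A n)) \<longlonglongrightarrow> tr L"
proof -
  have mono: "A m x \<bullet> x \<le> A n x \<bullet> x" if "m \<le> n" for m n x
    using lift_Suc_mono_le[of "\<lambda>n. A n x \<bullet> x", OF inc that] .
  have limq: "(\<lambda>n. A n x \<bullet> x) \<longlonglongrightarrow> L x \<bullet> x" for x by (intro tendsto_inner lim tendsto_const)
  have posI: "pos_op (S - R)" if "sym_op S" "sym_op R" "\<And>x. R x \<bullet> x \<le> S x \<bullet> x" for R S :: "'h \<Rightarrow>\<^sub>L 'h"
    using that by (simp add: pos_op_def sym_op_intros blin_simps inner_simps)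
  have leI: "op_le R S" if "R \<in> M" "S \<in> M" "sym_op S" "sym_op R" "\<And>x. R x \<bullet> x \<le> S x \<bullet> x" for R S
    unfolding op_le_def positive_op_iff using that by (intro conjI posI M_bounded M_diff)
  have AL: "A n x \<bullet> x \<le> L x \<bullet> x" for n x
  proof -
    have "incseq (\<lambda>n. A n x \<bullet> x)" by (rule incseq_SucI) (rule inc)
    from incseq_le[OF this limq] show ?thesis .
  qed
  have lub: "is_lub_sa M (range A) L"
    unfolding is_lub_sa_def selfadjoint_part_iff
  proof (intro conjI ballI impI L)
    show "op_le R L" if "R \<in> range A" for R using that A L AL by (auto intro!: leI)
    fix S assume "S \<in> selfadjoint_part M" and "\<forall>R\<in>range A. op_le R S"
    then have S: "S \<in> M \<and> sym_op S" "\<forall>R\<in>range A. op_le R S" by (simp_all add: selfadjoint_part_iff)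
    have "A n x \<bullet> x \<le> S x \<bullet> x" for n x
    proof -
      have "pos_op (S - A n)" using S(2) unfolding op_le_def positive_op_iff by blast
      from pos_opD[OF this, of x] show ?thesis by (simp add: blin_simps inner_simps)
    qed
    then have "L x \<bullet> x \<le> S x \<bullet> x" for x by (intro LIMSEQ_le_const2[OF limq]) blast
    then show "op_le L S" using S L by (intro leI) auto
  qed
  have "Re (\<tau> L) = (SUP R\<in>range A. Re (\<tau> R))"
  proof (rule tau_normal[OF _ _ _ lub])
    show "range A \<subseteq> selfadjoint_part M" using A by (auto simp: selfadjoint_part_iff)
    fix R S assume "R \<in> range A" "S \<in> range A"
    then obtain m n where mn: "R = A m" "S = A n" by blast
    have "op_le (A k) (A (max m n))" if "k \<le> max m n" for k
      using A mono[OF that] by (intro leI) auto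
    then show "\<exists>Q\<in>range A. op_le R Q \<and> op_le S Q" unfolding mn by (meson max.cobounded1 max.cobounded2 rangeI)
  qed auto
  then have SUP: "tr L = (SUP n. tr (A n))" by (simp add: tr_def image_image)
  have "incseq (\<lambda>n. tr (A n))"
    by (rule incseq_SucI) (intro tr_mono posI A inc)
  moreover have "bdd_above (range (\<lambda>n. tr (A n)))"
    by (rule bdd_aboveI[where M = "tr L"]) (use A L AL in \<open>auto intro!: tr_mono posI\<close>)
  ultimately show ?thesis unfolding SUP by (intro LIMSEQ_incseq_SUP)
qed

lemma normal_functional_tr:
  assumes X: "X \<in> M"
  shows "normal_functional X tr"
proof -
  have "tr (A + B) = tr A + tr B" if "bicommutes X A" "bicommutes X B" for A B
    by (intro tr_add M_bicommutes[OF X] that)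
  moreover have "tr (c *\<^sub>R A) = c * tr A" if "bicommutes X A" for A c
    by (intro tr_scaleR M_bicommutes[OF X] that)
  moreover have "(\<lambda>n. tr (A n)) \<longlonglongrightarrow> tr L" if "\<And>n::nat. sym_op (A n) \<and> bicommutes X (A n)"
    "sym_op L \<and> bicommutes X L" "\<And>n x. A n x \<bullet> x \<le> A (Suc n) x \<bullet> x" "\<And>x. (\<lambda>n. A n x) \<longlonglongrightarrow> L x" for A L
    using that by (intro tr_monotone_limit M_bicommutes[OF X]) blast+
  ultimately show ?thesis unfolding normal_functional_def by blast
qed

text \<open>
  The trace property gives \<open>\<tau>(PY) = \<tau>(PYP)\<close>.
\<close>

lemma tr_proj_pos:
  assumes P: "proj_op P" "P \<in> M" and Y: "pos_op Y" "Y \<in> M"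
  shows "0 \<le> tr (P o\<^sub>L Y)"
proof -
  have PP: "P o\<^sub>L P = P" using proj_opD(2)[OF P(1)] by (intro blinfun_eqI) simp
  have "P o\<^sub>L Y = P o\<^sub>L (P o\<^sub>L Y)" using proj_opD(2)[OF P(1)] by (intro blinfun_eqI) simp
  then have "tr (P o\<^sub>L Y) = tr ((P o\<^sub>L Y) o\<^sub>L P)" using P Y by (simp add: tr_commute M_compose)
  also have "0 \<le> \<dots>" by (intro tr_pos M_compose P Y pos_op_sandwich proj_opD(1))
  finally show ?thesis .
qed

lemma compose_assoc: "(A o\<^sub>L B) o\<^sub>L C = A o\<^sub>L (B o\<^sub>L C)" for A B C :: "'h \<Rightarrow>\<^sub>L 'h"
  by (rule blinfun_eqI) simp

lemma compose_diff:
  "A o\<^sub>L (B - C) = (A o\<^sub>L B) - (A o\<^sub>L C)" "(B - C) o\<^sub>L A = (B o\<^sub>L A) - (C o\<^sub>L A)"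
  "A o\<^sub>L (B + C) = (A o\<^sub>L B) + (A o\<^sub>L C)" "(B + C) o\<^sub>L A = (B o\<^sub>L A) + (C o\<^sub>L A)"
  "A o\<^sub>L (r *\<^sub>R B) = r *\<^sub>R (A o\<^sub>L B)" "(r *\<^sub>R B) o\<^sub>L A = r *\<^sub>R (B o\<^sub>L A)"
  "A o\<^sub>L id_blinfun = A" "id_blinfun o\<^sub>L A = A" "A o\<^sub>L (- B) = - (A o\<^sub>L B)"
  for A B C :: "'h \<Rightarrow>\<^sub>L 'h"
  by (rule blinfun_eqI; simp add: blin_simps)+

lemma tr_proj_bounds:
  assumes "proj_op P" "P \<in> M" shows "0 \<le> tr P" "tr P \<le> 1"
  using tr_pos[OF assms(2) proj_op_pos[OF assms(1)]]
    tr_pos[OF M_diff[OF M_id assms(2)] proj_op_pos[OF proj_op_complement[OF assms(1)]]] assms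
  by (simp_all add: tr_diff M_id tr_one)

lemma tr_proj_mono:
  assumes P: "proj_op P" "P \<in> M" and "A \<in> M" "B \<in> M" "pos_op (B - A)"
  shows "tr (P o\<^sub>L A) \<le> tr (P o\<^sub>L B)"
  using tr_proj_pos[OF P assms(5) M_diff[OF assms(4,3)]] assms P
  by (simp add: compose_diff tr_diff M_compose)

lemma tr_proj_le:
  assumes P: "proj_op P" "P \<in> M" and Y: "pos_op Y" "Y \<in> M"
  shows "tr (P o\<^sub>L Y) \<le> tr Y"
  using tr_proj_pos[OF proj_op_complement[OF P(1)] M_diff[OF M_id P(2)] Y] P Y
  by (simp add: compose_diff tr_diff M_compose)

lemma tr_proj_compose_le_dominating:
  assumes P: "proj_op P" "P \<in> M" and X: "X \<in> M" and Y: "pos_op Y" "Y \<in> M"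
    and dom: "pos_op (Y - (X - r *\<^sub>R id_blinfun))"
  shows "tr (P o\<^sub>L X) \<le> r * tr P + tr Y"
proof -
  have "tr (P o\<^sub>L (X - r *\<^sub>R id_blinfun)) \<le> tr (P o\<^sub>L Y)"
    by (intro tr_proj_mono P M_diff X M_scaleR M_id Y dom)
  also have "\<dots> \<le> tr Y" by (intro tr_proj_le P Y)
  finally show ?thesis
    by (simp add: compose_diff tr_diff tr_scaleR M_compose M_scaleR P X)
qed

text \<open>
  With \<open>W = Z\<^sup>2\<close>, the trace property gives \<open>\<tau>(AW) = \<tau>(ZAZ)\<close>.
\<close>

lemma tr_pos_compose:
  assumes A: "A \<in> M" "pos_op A" and W: "W \<in> M" "pos_op W"
  shows "0 \<le> tr (A o\<^sub>L W)"
proof -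
  obtain Z where Z: "pos_op Z" "Z o\<^sub>L Z = W" "bicommutes W Z" using pos_op_sqrt_exists[OF W(2)] by blast
  have ZM: "Z \<in> M" by (rule M_bicommutes[OF W(1) Z(3)])
  have "tr (A o\<^sub>L W) = tr ((A o\<^sub>L Z) o\<^sub>L Z)" by (simp flip: Z(2) add: compose_assoc)
  also have "\<dots> = tr (Z o\<^sub>L (A o\<^sub>L Z))" by (intro tr_commute M_compose A ZM)
  also have "Z o\<^sub>L (A o\<^sub>L Z) = Z o\<^sub>L A o\<^sub>L Z" by (simp add: compose_assoc)
  also have "0 \<le> tr \<dots>" by (intro tr_pos M_compose A ZM pos_op_sandwich pos_op_sym Z)
  finally show ?thesis .
qed

lemma tr_compose_le:
  assumes A: "A \<in> M" "pos_op A" and X: "X \<in> M" "sym_op X"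
  shows "tr (A o\<^sub>L X) \<le> norm X * tr A"
proof -
  have "pos_op (norm X *\<^sub>R id_blinfun - X)"
    using pos_op_add_norm[OF sym_op_intros(4)[OF X(2)]] by simp
  then have "0 \<le> tr (A o\<^sub>L (norm X *\<^sub>R id_blinfun - X))"
    by (intro tr_pos_compose A M_diff M_scaleR M_id X)
  then show ?thesis
    using A X by (simp add: compose_diff tr_diff tr_scaleR M_compose M_scaleR)
qed

end

section \<open>The eigenvalue function\<close>

lemma abs_max_diff_le: "\<bar>z\<bar> \<le> K \<Longrightarrow> \<bar>max (z - r) 0\<bar> \<le> K + \<bar>r\<bar>" for z K r :: real
  by (auto simp: max_def)

context tracial_von_neumann_algebra
begin

lemma tr_zero: "tr 0 = 0"
  using tr_scaleR[OF M_id, of 0] by simp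

text \<open>
  The eigenvalue function with the value \<open>0\<close> outside \<open>[0,1)\<close>, which makes it Borel on the whole line.
\<close>

definition lam :: "('h \<Rightarrow>\<^sub>L 'h) \<Rightarrow> real \<Rightarrow> real" where
  "lam X s = (if 0 \<le> s \<and> s < 1 then eigenvalue_function \<tau> X s else 0)"

context
  fixes X
  assumes XM: "X \<in> M" and X: "sym_op X"
begin

lemma tr_upper_proj_bounds: "0 \<le> tr (upper_proj X t)" "tr (upper_proj X t) \<le> 1"
  using tr_proj_bounds[OF upper_proj_proj_op[OF X] M_upper_proj[OF XM X]] by auto

lemma tr_upper_proj_antimono: "s \<le> t \<Longrightarrow> tr (upper_proj X t) \<le> tr (upper_proj X s)"
  by (intro tr_mono M_upper_proj XM X proj_op_pos upper_proj_diff)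

lemma tr_upper_proj_right_limit:
  "(\<lambda>n. tr (upper_proj X (t + inverse (real (Suc n))))) \<longlonglongrightarrow> tr (upper_proj X t)"
proof (rule tr_monotone_limit)
  show "upper_proj X (t + inverse (real (Suc n))) x \<bullet> x \<le> upper_proj X (t + inverse (real (Suc (Suc n)))) x \<bullet> x" for n x
    by (rule upper_proj_quad_mono[OF X]) (simp add: le_imp_inverse_le)
qed (intro M_upper_proj XM X proj_opD(1)[OF upper_proj_proj_op] upper_proj_right_limit)+

lemma eigenvalue_function_eq: "eigenvalue_function \<tau> X s = Inf {t. tr (upper_proj X t) \<le> s}"
  unfolding eigenvalue_function_def spectral_projection_greaterThan[OF X M_bounded[OF XM]] tr_def ..

text \<open>
  The eigenvalue function is a generalized inverse of \<open>t \<mapsto> \<tau>(P\<^sub>t)\<close>.  Right-continuity of the latter, that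
  is normality of the trace, makes the equivalence hold with both inequalities strict.
\<close>

lemma less_eigenvalue_function_iff:
  assumes s: "0 \<le> s" "s < 1"
  shows "t < eigenvalue_function \<tau> X s \<longleftrightarrow> s < tr (upper_proj X t)"
proof -
  define S where "S = {t. tr (upper_proj X t) \<le> s}"
  have ne: "norm X \<in> S" using s by (simp add: S_def upper_proj_top[OF X] tr_zero)
  have lb: "- norm X \<le> t" if "t \<in> S" for t
    using upper_proj_bot_norm[OF X, of t] that s by (force simp: S_def tr_one)
  then have bb: "bdd_below S" unfolding bdd_below_def by blast
  have E: "eigenvalue_function \<tau> X s = Inf S" by (simp add: eigenvalue_function_eq S_def)
  show ?thesis
  proof
    assume "t < eigenvalue_function \<tau> X s"
    then have "t \<notin> S" unfolding E using cInf_lower[OF _ bb, of t] by linarith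
    then show "s < tr (upper_proj X t)" by (simp add: S_def)
  next
    assume st: "s < tr (upper_proj X t)"
    show "t < eigenvalue_function \<tau> X s"
    proof (rule ccontr)
      assume "\<not> t < eigenvalue_function \<tau> X s"
      then have le: "Inf S \<le> t" by (simp add: E)
      have "tr (upper_proj X (t + inverse (real (Suc n)))) \<le> s" for n
      proof -
        have "0 < inverse (real (Suc n))" by simp
        then have "Inf S < t + inverse (real (Suc n))" using le by linarith
        then obtain u where "u \<in> S" "u < t + inverse (real (Suc n))"
          using cInf_lessD[of S] ne by blast
        then show ?thesis using tr_upper_proj_antimono[of u "t + inverse (real (Suc n))"] by (simp add: S_def)
      qed
      then have "tr (upper_proj X t) \<le> s" by (intro LIMSEQ_le_const2[OF tr_upper_proj_right_limit]) blast
      then show False using st by simp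
    qed
  qed
qed

lemma less_lam_iff: "0 \<le> s \<Longrightarrow> s < 1 \<Longrightarrow> t < lam X s \<longleftrightarrow> s < tr (upper_proj X t)"
  using less_eigenvalue_function_iff by (simp add: lam_def)

lemma lam_le_norm: "0 \<le> s \<Longrightarrow> s < 1 \<Longrightarrow> lam X s \<le> norm X"
proof (rule ccontr)
  assume s: "0 \<le> s" "s < 1" "\<not> lam X s \<le> norm X"
  then have "s < tr (upper_proj X (norm X))" using less_lam_iff[OF s(1,2), of "norm X"] by simp
  moreover have "tr (upper_proj X (norm X)) = 0" by (simp add: upper_proj_top[OF X] tr_zero)
  ultimately show False using s by simp
qed

lemma lam_gt: "0 \<le> s \<Longrightarrow> s < 1 \<Longrightarrow> upper_proj X t = id_blinfun \<Longrightarrow> t < lam X s"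
  using less_lam_iff by (simp add: tr_one)

lemma lam_ge_minus_norm: "0 \<le> s \<Longrightarrow> s < 1 \<Longrightarrow> - norm X \<le> lam X s"
proof (rule ccontr)
  assume s: "0 \<le> s" "s < 1" "\<not> - norm X \<le> lam X s"
  then obtain t where "lam X s < t" "t < - norm X" using dense[of "lam X s" "- norm X"] by auto
  then show False using lam_gt[OF s(1,2) upper_proj_bot_norm[OF X]] by fastforce
qed

lemma abs_lam_le: "\<bar>lam X s\<bar> \<le> norm X"
  using lam_le_norm[of s] lam_ge_minus_norm[of s] by (cases "0 \<le> s \<and> s < 1") (auto simp: lam_def abs_le_iff)

lemma lam_antimono: "0 \<le> s \<Longrightarrow> s \<le> s' \<Longrightarrow> s' < 1 \<Longrightarrow> lam X s' \<le> lam X s"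
proof (rule ccontr)
  assume s: "0 \<le> s" "s \<le> s'" "s' < 1" "\<not> lam X s' \<le> lam X s"
  then have "s' < tr (upper_proj X (lam X s))" using less_lam_iff[of s' "lam X s"] by simp
  then show False using less_lam_iff[of s "lam X s"] s by simp
qed

lemma lam_borel [measurable]: "lam X \<in> borel_measurable borel"
proof (rule borel_measurableI_greater)
  fix t
  have "{s \<in> space borel. t < lam X s} = {0..<1} \<inter> {..<tr (upper_proj X t)} \<union> (if t < 0 then - {0..<1} else {})"
    using less_lam_iff by (auto simp: lam_def)
  also have "\<dots> \<in> sets borel" by auto
  finally show "{s \<in> space borel. t < lam X s} \<in> sets borel" .
qed

lemma integrable_lam_comp:
  fixes g :: "real \<Rightarrow> real"
  shows "g \<in> borel_measurable borel \<Longrightarrow> (\<And>z. \<bar>z\<bar> \<le> norm X \<Longrightarrow> \<bar>g z\<bar> \<le> c) \<Longrightarrow> integrable unit_interval (\<lambda>s. g (lam X s))"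
  by (rule integrable_unit_interval[where c = c])
    (auto intro!: measurable_unit_interval measurable_compose[OF lam_borel] abs_lam_le)

text \<open>
  The distribution of \<open>X\<close> under the trace is the image of Lebesgue measure under \<open>\<lambda>\<^sub>X\<close>.
\<close>

lemma has_distribution_tr: "has_distribution X tr (distr unit_interval borel (lam X))"
proof -
  interpret finite_measure unit_interval by (rule finite_measure_unit_interval)
  have m[measurable]: "lam X \<in> borel_measurable unit_interval" by (rule measurable_unit_interval[OF lam_borel])
  have "tr (upper_proj X t) = measure (distr unit_interval borel (lam X)) {t<..}" for t
  proof -
    have "measure (distr unit_interval borel (lam X)) {t<..} = measure unit_interval (lam X -` {t<..} \<inter> {0..<1})"
      by (subst measure_distr) auto
    also have "lam X -` {t<..} \<inter> {0..<1} = {0..<tr (upper_proj X t)}"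
      using less_lam_iff tr_upper_proj_bounds(2)[of t] by auto
    also have "measure unit_interval \<dots> = tr (upper_proj X t)"
      using tr_upper_proj_bounds[of t] by (simp add: measure_def emeasure_unit_interval_lessThan)
    finally show ?thesis by simp
  qed
  then show ?thesis unfolding has_distribution_def by (simp add: finite_measure_distr)
qed

lemma tr_fun_calc:
  assumes g: "bounded_borel g"
  shows "tr (fun_calc X g) = (\<integral>s. g (lam X s) \<partial>unit_interval)"
proof -
  have "tr (fun_calc X g) = (\<integral>z. g z \<partial>distr unit_interval borel (lam X))"
    by (rule fun_calc_functional[OF X g normal_functional_tr[OF XM] has_distribution_tr])
  also have "\<dots> = (\<integral>s. g (lam X s) \<partial>unit_interval)"
    by (rule integral_distr) (auto intro: measurable_unit_interval[OF lam_borel] bounded_borel_measurable[OF g])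
  finally show ?thesis .
qed

text \<open>
  The identity on the spectrum of \<open>X\<close>, made bounded.
\<close>

definition clip :: "real \<Rightarrow> real" where "clip z = max (- norm X - 1) (min (norm X + 1) z)"

lemma bounded_borel_clip: "bounded_borel clip"
proof (rule bounded_borelI)
  show "clip \<in> borel_measurable borel" unfolding clip_def[abs_def] by measurable
  show "\<bar>clip z\<bar> \<le> norm X + 1" for z by (auto simp: clip_def abs_le_iff)
qed

lemma clip_id: "\<bar>z\<bar> \<le> norm X + 1 \<Longrightarrow> clip z = z"
  by (auto simp: clip_def abs_le_iff)

lemma clip_lam: "clip (lam X s) = lam X s"
  using abs_lam_le[of s] by (intro clip_id) linarith

lemma fun_calc_clip: "fun_calc X clip = X"
proof (rule sym_op_eqI[OF sym_fun_calc[OF X bounded_borel_clip] X])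
  fix x
  have "(\<integral>z. clip z \<partial>spec_measure X x) = (\<integral>z. z \<partial>spec_measure X x)"
  proof (rule integral_cong_AE)
    show "AE z in spec_measure X x. clip z = z"
      using AE_spec_measure_abs_le[OF X] by eventually_elim (rule clip_id)
  qed (use bounded_borel_measurable[OF bounded_borel_clip] in simp_all)
  then show "fun_calc X clip x \<bullet> x = X x \<bullet> x"
    by (simp add: fun_calc_quad[OF X bounded_borel_clip] spectral_integral[OF X])
qed

lemma tr_eq_integral_lam: "tr X = (\<integral>s. lam X s \<partial>unit_interval)"
  using tr_fun_calc[OF bounded_borel_clip] by (simp add: fun_calc_clip clip_lam)

text \<open>
  \<open>(g - r)\<^sub>+(X)\<close> is positive and dominates \<open>g(X) - r\<close>.
\<close>

lemma tr_proj_compose_fun_calc_le: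
  assumes P: "proj_op P" "P \<in> M" and g: "bounded_borel g"
  shows "tr (P o\<^sub>L fun_calc X g) \<le> r * tr P + excess_integral (\<lambda>s. g (lam X s)) r"
proof -
  define q where "q z = max (g z - r) 0" for z
  note [measurable] = bounded_borel_measurable[OF g]
  obtain c where c: "\<And>z. \<bar>g z\<bar> \<le> c" using g unfolding bounded_borel_def by blast
  have qb: "bounded_borel q"
  proof (rule bounded_borelI)
    show "q \<in> borel_measurable borel" unfolding q_def[abs_def] by measurable
    show "\<bar>q z\<bar> \<le> c + \<bar>r\<bar>" for z unfolding q_def by (rule abs_max_diff_le[OF c])
  qed
  note Fs = sym_fun_calc[OF X] and Fq = fun_calc_quad[OF X]
  have dom: "pos_op (fun_calc X q - (fun_calc X g - r *\<^sub>R id_blinfun))"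
    unfolding pos_op_def
  proof (intro conjI allI)
    show "sym_op (fun_calc X q - (fun_calc X g - r *\<^sub>R id_blinfun))" by (intro sym_op_intros Fs g qb)
    fix x
    interpret finite_measure "spec_measure X x" by (rule finite_spec_measure[OF X])
    have i: "integrable (spec_measure X x) g" "integrable (spec_measure X x) q"
      by (intro integrable_bounded_borel finite_spec_measure[OF X] g qb; simp)+
    have "fun_calc X g x \<bullet> x - r * (x \<bullet> x) = (\<integral>z. g z - r \<partial>spec_measure X x)"
      by (subst Bochner_Integration.integral_diff) (auto simp: i Fq[OF g] measure_spec_measure[OF X])
    also have "\<dots> \<le> (\<integral>z. q z \<partial>spec_measure X x)"
      by (rule integral_mono) (auto simp: i q_def)
    finally show "0 \<le> (fun_calc X q - (fun_calc X g - r *\<^sub>R id_blinfun)) x \<bullet> x"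
      by (simp add: blin_simps inner_simps Fq[OF qb])
  qed
  have "pos_op (fun_calc X q)" unfolding pos_op_def Fq[OF qb] using Fs[OF qb]
    by (auto intro!: Bochner_Integration.integral_nonneg simp: q_def)
  from tr_proj_compose_le_dominating[OF P M_fun_calc[OF XM X g] this M_fun_calc[OF XM X qb] dom]
  show ?thesis by (simp add: tr_fun_calc[OF qb] q_def)
qed

lemma integral_positive_part_lam:
  "excess_integral (lam X) r = tr (upper_proj X r o\<^sub>L X) - r * tr (upper_proj X r)"
proof -
  note b = bounded_borel_clip
  have bi: "bounded_borel (indicator {r<..} :: real \<Rightarrow> real)" by (simp add: bounded_borel_indicator)
  have "upper_proj X r o\<^sub>L X = fun_calc X (\<lambda>z. indicator {r<..} z * clip z)"
    by (rule blinfun_eqI) (use fun_calc_mult[OF X bi _ b] in \<open>simp add: fun_calc_greaterThan[OF X] fun_calc_clip\<close>)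
  then have "tr (upper_proj X r o\<^sub>L X) = (\<integral>s. indicator {r<..} (lam X s) * lam X s \<partial>unit_interval)"
    using tr_fun_calc[OF bounded_borel_mult[OF bi b]] by (simp add: clip_lam)
  moreover have "tr (upper_proj X r) = (\<integral>s. indicator {r<..} (lam X s) \<partial>unit_interval)"
    using tr_fun_calc[OF bi] by (simp add: fun_calc_greaterThan[OF X])
  moreover have "excess_integral (lam X) r
    = (\<integral>s. indicator {r<..} (lam X s) * lam X s - r * indicator {r<..} (lam X s) \<partial>unit_interval)"
    by (rule Bochner_Integration.integral_cong) (auto simp: indicator_def)
  moreover have "integrable unit_interval (\<lambda>s. indicator {r<..} (lam X s) * lam X s)"
    by (rule integrable_lam_comp[where c = "norm X"]) (auto simp: indicator_def)
  moreover have "integrable unit_interval (\<lambda>s. r * indicator {r<..} (lam X s) :: real)"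
    by (rule integrable_lam_comp[where c = "\<bar>r\<bar>"]) (auto simp: indicator_def)
  ultimately show ?thesis by simp
qed

lemma integrable_indicator_lam: "integrable unit_interval (\<lambda>s. indicator {..<a} s * lam X s)"
  by (rule integrable_unit_interval[where c = "norm X"])
    (use abs_lam_le lam_borel in \<open>auto intro!: measurable_unit_interval simp: indicator_def\<close>)

lemma integrable_positive_part_lam: "integrable unit_interval (\<lambda>s. max (lam X s - r) 0)"
  by (rule integrable_lam_comp[where c = "norm X + \<bar>r\<bar>"]) (auto intro: abs_max_diff_le)

lemma integral_threshold:
  assumes a: "0 \<le> a" "a \<le> 1"
  shows "(\<integral>s. r * indicator {..<a} s + max (lam X s - r) 0 \<partial>unit_interval)
    = r * a + excess_integral (lam X) r"
    and "integrable unit_interval (\<lambda>s. r * indicator {..<a} s + max (lam X s - r) 0)"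
proof -
  have i: "integrable unit_interval (\<lambda>s. r * indicator {..<a} s :: real)"
    by (rule integrable_unit_interval[where c = "\<bar>r\<bar>"])
      (auto intro!: measurable_unit_interval simp: indicator_def)
  show "(\<integral>s. r * indicator {..<a} s + max (lam X s - r) 0 \<partial>unit_interval)
    = r * a + excess_integral (lam X) r"
    by (simp only: Bochner_Integration.integral_add[OF i integrable_positive_part_lam]
        integral_mult_right_zero integral_unit_interval_lessThan[OF a])
  show "integrable unit_interval (\<lambda>s. r * indicator {..<a} s + max (lam X s - r) 0)"
    by (intro Bochner_Integration.integrable_add i integrable_positive_part_lam)
qed

lemma integral_lam_le:
  assumes a: "0 \<le> a" "a \<le> 1"
  shows "initial_integral (lam X) a \<le> r * a + excess_integral (lam X) r"
proof -
  have "initial_integral (lam X) a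
    \<le> (\<integral>s. r * indicator {..<a} s + max (lam X s - r) 0 \<partial>unit_interval)"
    by (rule integral_mono[OF integrable_indicator_lam integral_threshold(2)[OF a]])
      (auto simp: indicator_def)
  then show ?thesis by (simp only: integral_threshold(1)[OF a])
qed

text \<open>
  The optimal \<open>r\<close> is \<open>\<lambda>\<^sub>X(a)\<close>, as \<open>\<lambda>\<^sub>X\<close> is decreasing; for \<open>a = 1\<close> any lower bound of \<open>\<lambda>\<^sub>X\<close> will do.
\<close>

lemma integral_lam_attained:
  assumes a: "0 \<le> a" "a \<le> 1"
  obtains r where "initial_integral (lam X) a = r * a + excess_integral (lam X) r"
proof -
  define r where "r = (if a < 1 then lam X a else - norm X)"
  have "indicator {..<a} s * lam X s = r * indicator {..<a} s + max (lam X s - r) 0" if "0 \<le> s" "s < 1" for s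
  proof (cases "s < a")
    case True
    then have "r \<le> lam X s" unfolding r_def using that lam_antimono[of s a] lam_ge_minus_norm[of s] by auto
    then show ?thesis using True by simp
  next
    case False
    then have "lam X s \<le> r" unfolding r_def using that a lam_antimono[of a s] by auto
    then show ?thesis using False by simp
  qed
  then have "initial_integral (lam X) a
    = (\<integral>s. r * indicator {..<a} s + max (lam X s - r) 0 \<partial>unit_interval)"
    by (intro Bochner_Integration.integral_cong) auto
  also note integral_threshold(1)[OF a]
  finally show thesis using that by blast
qed

lemma tr_proj_compose_le_integral:
  assumes P: "proj_op P" "P \<in> M"
  shows "tr (P o\<^sub>L X) \<le> initial_integral (lam X) (tr P)"
proof -
  obtain r where "initial_integral (lam X) (tr P)
    = r * tr P + excess_integral (lam X) r"
    using integral_lam_attained[OF tr_proj_bounds[OF P]] by blast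
  then show ?thesis using tr_proj_compose_fun_calc_le[OF P bounded_borel_clip, of r]
    by (simp add: fun_calc_clip clip_lam)
qed

end

section \<open>The layer-cake inequality for the trace of a product\<close>

lemma lam_nonneg:
  assumes TM: "T \<in> M" and T: "pos_op T"
  shows "0 \<le> lam T s"
proof (cases "0 \<le> s \<and> s < 1")
  case True
  have "t < lam T s" if "t < 0" for t
  proof (rule lam_gt[OF TM pos_op_sym[OF T]])
    show "upper_proj T t = id_blinfun"
    proof (rule upper_proj_bot[OF pos_op_sym[OF T]])
      fix x :: 'h assume "x \<noteq> 0"
      then have "t * (x \<bullet> x) < 0" using that by (simp add: mult_neg_pos)
      also have "0 \<le> T x \<bullet> x" by (rule pos_opD[OF T])
      finally show "t * (x \<bullet> x) < T x \<bullet> x" .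
    qed
  qed (use True in auto)
  then show ?thesis using dense[of "lam T s" 0] less_asym not_le by blast
qed (auto simp: lam_def)

lemma integrable_lam_mult:
  assumes T: "T \<in> M" "sym_op T" and h: "h \<in> borel_measurable borel" "\<And>s. \<bar>h s\<bar> \<le> c"
  shows "integrable unit_interval (\<lambda>s. lam T s * h s)"
proof (rule integrable_unit_interval[where c = "norm T * c"])
  show "\<bar>lam T s * h s\<bar> \<le> norm T * c" for s
    unfolding abs_mult by (intro mult_mono abs_lam_le T h) auto
qed (intro measurable_unit_interval borel_measurable_times lam_borel T h)

lemma upper_part_zero:
  fixes T :: "'h \<Rightarrow>\<^sub>L 'h"
  assumes T: "pos_op T"
  shows "upper_part T 0 = T"
proof (rule blinfun_eqI)
  fix x :: 'h
  note Ts = pos_op_sym[OF T]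
  define y where "y = x - upper_proj T 0 x"
  have "upper_proj T 0 y = 0"
    by (simp add: y_def blin_simps proj_opD(2)[OF upper_proj_proj_op[OF Ts]])
  then have "T y \<bullet> y \<le> 0" using upper_proj_cuts[OF Ts, of 0] unfolding cuts_def by simp
  then have "T y = 0" using pos_opD[OF T, of y] by (intro pos_op_kernel[OF T]) simp
  then show "upper_part T 0 x = T x" by (simp add: upper_part_def y_def blin_simps)
qed

text \<open>
  With \<open>F t = \<integral> (\<lambda>\<^sub>T - t)\<^sub>+ h\<close>, the function \<open>\<tau>((T - t)\<^sub>+ X) - F t\<close> has in \<open>t\<close> the formal derivative
  \<open>\<integral> h - \<tau>(P\<^sub>t X) \<ge> 0\<close>, the integral being over \<open>[0, \<tau>(P\<^sub>t)]\<close>.  On \<open>[s, t]\<close> the error of this first-order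
  statement is at most a multiple of \<open>(t - s) (\<tau>(P\<^sub>s) - \<tau>(P\<^sub>t))\<close>, so the function increases from \<open>0\<close> to \<open>\<parallel>T\<parallel>\<close>,
  where it vanishes.
\<close>

lemma tr_compose_le_integral:
  assumes TM: "T \<in> M" and T: "pos_op T" and XM: "X \<in> M" and X: "sym_op X"
    and h: "h \<in> borel_measurable borel" "\<And>s. \<bar>h s\<bar> \<le> c"
    and le: "\<And>t. tr (upper_proj T t o\<^sub>L X) \<le> initial_integral h (tr (upper_proj T t))"
  shows "tr (T o\<^sub>L X) \<le> (\<integral>s. lam T s * h s \<partial>unit_interval)"
proof -
  note Ts = pos_op_sym[OF T]
  note [measurable] = h(1) lam_borel[OF TM Ts]
  let ?P = "upper_proj T" and ?U = "upper_part T"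
  let ?d = "\<lambda>t. tr (?P t)"
  define F where "F t = (\<integral>s. max (lam T s - t) 0 * h s \<partial>unit_interval)" for t
  have PM: "?P t \<in> M" and UM: "?U t \<in> M" for t
    unfolding upper_part_def by (intro M_diff M_compose M_scaleR M_upper_proj TM Ts)+
  have Fi: "integrable unit_interval (\<lambda>s. max (lam T s - t) 0 * h s)" for t
  proof (rule integrable_unit_interval[where c = "(norm T + \<bar>t\<bar>) * c"])
    show "\<bar>max (lam T s - t) 0 * h s\<bar> \<le> (norm T + \<bar>t\<bar>) * c" for s
      unfolding abs_mult by (intro mult_mono abs_max_diff_le abs_lam_le TM Ts h) auto
  qed (intro measurable_unit_interval, measurable)
  have di: "integrable unit_interval (indicator {..<a} :: real \<Rightarrow> real)" for a
    by (rule integrable_unit_interval[where c = 1]) (auto intro: measurable_unit_interval simp: indicator_def)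
  have hi: "integrable unit_interval (\<lambda>s. indicator {..<a} s * h s)" for a
  proof (rule integrable_unit_interval[where c = c])
    show "\<bar>indicator {..<a} s * h s\<bar> \<le> c" for s using h(2)[of s] by (auto simp: indicator_def)
  qed (intro measurable_unit_interval, measurable)
  have F: "(t - s) * initial_integral h (?d t) - (t - s) * (c * (?d s - ?d t)) \<le> F s - F t" if st: "s \<le> t" for s t
  proof -
    have "(t - s) * initial_integral h (?d t) - (t - s) * (c * (?d s - ?d t))
      = (\<integral>u. (t - s) * (indicator {..<?d t} u * h u)
          - (t - s) * (c * (indicator {..<?d s} u - indicator {..<?d t} u)) \<partial>unit_interval)"
      by (simp only: Bochner_Integration.integral_diff integrable_mult_right Bochner_Integration.integrable_diff
          integral_mult_right_zero di hi integral_unit_interval_lessThan[OF tr_upper_proj_bounds[OF TM Ts]])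
    also have "\<dots> \<le> (\<integral>u. max (lam T u - s) 0 * h u - max (lam T u - t) 0 * h u \<partial>unit_interval)"
    proof (rule integral_mono)
      fix u assume "u \<in> space unit_interval"
      then have i: "indicator {..<?d r} u = (of_bool (r < lam T u) :: real)" for r
        by (simp add: indicator_def less_lam_iff[OF TM Ts])
      define v where "v = max (lam T u - s) 0 - max (lam T u - t) 0 - (t - s) * of_bool (t < lam T u)"
      have v: "0 \<le> v" "v \<le> (t - s) * (of_bool (s < lam T u) - of_bool (t < lam T u))"
        using st by (auto simp: v_def)
      have "\<bar>v * h u\<bar> \<le> (t - s) * (of_bool (s < lam T u) - of_bool (t < lam T u)) * c"
        unfolding abs_mult using v by (intro mult_mono h(2)) auto
      then have "- ((t - s) * (of_bool (s < lam T u) - of_bool (t < lam T u)) * c) \<le> v * h u" by linarith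
      then show "(t - s) * (indicator {..<?d t} u * h u) - (t - s) * (c * (indicator {..<?d s} u - indicator {..<?d t} u))
          \<le> max (lam T u - s) 0 * h u - max (lam T u - t) 0 * h u"
        unfolding i by (simp add: v_def algebra_simps)
    qed (intro Bochner_Integration.integrable_diff integrable_mult_right di hi Fi)+
    also have "\<dots> = F s - F t" unfolding F_def by (rule Bochner_Integration.integral_diff[OF Fi Fi])
    finally show ?thesis .
  qed
  have U: "tr (?U s o\<^sub>L X) - tr (?U t o\<^sub>L X) \<le> (t - s) * initial_integral h (?d t) + (t - s) * (norm X * (?d s - ?d t))"
    if st: "s \<le> t" for s t
  proof -
    define V where "V = ?U s - ?U t - (t - s) *\<^sub>R ?P t"
    have V: "V \<in> M" "pos_op V"
      unfolding V_def by (intro M_diff UM M_scaleR PM upper_part_decrease(1)[OF Ts st])+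
    have "tr (?U s) - tr (?U t) \<le> (t - s) * ?d s"
      using tr_pos[OF _ upper_part_decrease(2)[OF Ts st]] by (simp add: M_diff M_scaleR UM PM tr_diff tr_scaleR)
    then have "tr V \<le> (t - s) * (?d s - ?d t)"
      by (simp add: V_def tr_diff tr_scaleR M_diff M_scaleR UM PM right_diff_distrib)
    then have "norm X * tr V \<le> norm X * ((t - s) * (?d s - ?d t))" by (rule mult_left_mono) simp
    then have "tr (V o\<^sub>L X) \<le> (t - s) * (norm X * (?d s - ?d t))"
      using tr_compose_le[OF V XM X] by (simp add: mult.left_commute)
    moreover have "(t - s) * tr (?P t o\<^sub>L X) \<le> (t - s) * initial_integral h (?d t)"
      using st by (intro mult_left_mono le) simp
    moreover have "tr (?U s o\<^sub>L X) - tr (?U t o\<^sub>L X) = tr (V o\<^sub>L X) + (t - s) * tr (?P t o\<^sub>L X)"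
      by (simp add: V_def compose_diff tr_diff tr_scaleR M_compose M_diff M_scaleR UM PM XM)
    ultimately show ?thesis by linarith
  qed
  have "tr (?U 0 o\<^sub>L X) - F 0 \<le> tr (?U (norm T) o\<^sub>L X) - F (norm T)"
  proof (rule partition_monotone[where h = "\<lambda>t. tr (?U t o\<^sub>L X) - F t" and d = "\<lambda>t. (norm X + c) * ?d t"])
    show "(tr (?U s o\<^sub>L X) - F s) - (tr (?U t o\<^sub>L X) - F t) \<le> (t - s) * ((norm X + c) * ?d s - (norm X + c) * ?d t)"
      if "s \<le> t" for s t
      using U[OF that] F[OF that] by (simp add: algebra_simps)
  qed simp
  also have "F (norm T) = (\<integral>s. 0 \<partial>unit_interval)"
    unfolding F_def by (rule Bochner_Integration.integral_cong) (use lam_le_norm[OF TM Ts] in auto)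
  also have "F 0 = (\<integral>s. lam T s * h s \<partial>unit_interval)"
    unfolding F_def by (simp add: lam_nonneg[OF TM T])
  also have "tr (?U (norm T) o\<^sub>L X) = 0"
    using tr_compose_le[OF M_scaleR[OF M_id, of 0] _ XM X] by (simp add: upper_part_top[OF Ts] tr_zero)
  finally show ?thesis by (simp add: upper_part_zero[OF T])
qed

end

section \<open>Conditional expectation\<close>

text \<open>
  \<open>g \<circ> l\<close> is the conditional expectation of \<open>h\<close> given \<open>l\<close>: a Radon-Nikodym density of the image under \<open>l\<close> of
  the measure with density \<open>h\<close>, with respect to the image of \<open>M\<close>.
\<close>

lemma bounded_conditional_expectation:
  fixes l h :: "'a \<Rightarrow> real"
  assumes M: "finite_measure M" and l[measurable]: "l \<in> borel_measurable M"
    and h[measurable]: "h \<in> borel_measurable M" and h0: "\<And>s. 0 \<le> h s" and hc: "\<And>s. h s \<le> c"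
  obtains g where "g \<in> borel_measurable borel" "\<And>z. 0 \<le> g z" "\<And>z. g z \<le> c"
    "\<And>B. B \<in> sets borel \<Longrightarrow> (\<integral>s. indicator B (l s) * g (l s) \<partial>M) = (\<integral>s. indicator B (l s) * h s \<partial>M)"
proof -
  interpret finite_measure M by fact
  have c0: "0 \<le> c" using h0 hc order_trans by blast
  define \<nu> where "\<nu> = distr M borel l"
  define \<eta> where "\<eta> = distr (density M (\<lambda>s. ennreal (h s))) borel l"
  interpret \<nu>: finite_measure \<nu> unfolding \<nu>_def by (rule finite_measure_distr) measurable
  have [measurable_cong, simp]: "sets \<nu> = sets borel" "sets \<eta> = sets borel" by (simp_all add: \<nu>_def \<eta>_def)
  have \<nu>: "emeasure \<nu> B = (\<integral>\<^sup>+s. indicator B (l s) \<partial>M)" if [measurable]: "B \<in> sets borel" for B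
  proof -
    have "emeasure \<nu> B = (\<integral>\<^sup>+z. indicator B z \<partial>\<nu>)" by simp
    also have "\<dots> = (\<integral>\<^sup>+s. indicator B (l s) \<partial>M)" unfolding \<nu>_def by (rule nn_integral_distr) measurable
    finally show ?thesis .
  qed
  have \<eta>: "emeasure \<eta> B = (\<integral>\<^sup>+s. ennreal (indicator B (l s) * h s) \<partial>M)" if [measurable]: "B \<in> sets borel" for B
  proof -
    have "emeasure \<eta> B = (\<integral>\<^sup>+z. indicator B z \<partial>\<eta>)" by simp
    also have "\<dots> = (\<integral>\<^sup>+s. indicator B (l s) \<partial>density M (\<lambda>s. ennreal (h s)))"
      unfolding \<eta>_def by (rule nn_integral_distr) measurable
    also have "\<dots> = (\<integral>\<^sup>+s. ennreal (h s) * indicator B (l s) \<partial>M)"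
      by (rule nn_integral_density) measurable
    also have "\<dots> = (\<integral>\<^sup>+s. ennreal (indicator B (l s) * h s) \<partial>M)"
      by (rule nn_integral_cong) (auto simp: indicator_def)
    finally show ?thesis .
  qed
  have \<eta>le: "emeasure \<eta> B \<le> ennreal c * emeasure \<nu> B" if [measurable]: "B \<in> sets borel" for B
  proof -
    have "emeasure \<eta> B \<le> (\<integral>\<^sup>+s. ennreal c * indicator B (l s) \<partial>M)"
      unfolding \<eta>[OF that] by (rule nn_integral_mono) (auto simp: indicator_def hc ennreal_leI)
    also have "\<dots> = ennreal c * emeasure \<nu> B" unfolding \<nu>[OF that] by (rule nn_integral_cmult) measurable
    finally show ?thesis .
  qed
  have "absolutely_continuous \<nu> \<eta>"
    unfolding absolutely_continuous_def
  proof
    fix B assume "B \<in> null_sets \<nu>"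
    then show "B \<in> null_sets \<eta>" using \<eta>le[of B] by (auto simp: null_sets_def)
  qed
  then obtain f where f[measurable]: "f \<in> borel_measurable \<nu>" and df: "density \<nu> f = \<eta>"
    using \<nu>.Radon_Nikodym[of \<eta>] by auto
  have [measurable]: "f \<in> borel_measurable borel" using f measurable_cong_sets[OF \<open>sets \<nu> = sets borel\<close> refl] by blast
  define B0 where "B0 = {z \<in> space borel. ennreal c < f z}"
  have B0[measurable]: "B0 \<in> sets borel" unfolding B0_def by measurable
  \<comment> \<open>As \<open>\<eta> \<le> c \<nu>\<close>, the integral of \<open>f - c\<close> over the set \<open>B0\<close> where \<open>f > c\<close> is zero.\<close>
  have "AE z in \<nu>. f z \<le> ennreal c"
  proof -
    have "(\<integral>\<^sup>+z. (f z - ennreal c) * indicator B0 z \<partial>\<nu>) + ennreal c * emeasure \<nu> B0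
        = (\<integral>\<^sup>+z. (f z - ennreal c) * indicator B0 z + ennreal c * indicator B0 z \<partial>\<nu>)"
      by (subst nn_integral_add) (auto simp: nn_integral_cmult)
    also have "\<dots> = (\<integral>\<^sup>+z. f z * indicator B0 z \<partial>\<nu>)"
      by (rule nn_integral_cong) (auto simp: indicator_def B0_def diff_add_cancel_ennreal less_imp_le)
    also have "\<dots> = emeasure \<eta> B0" unfolding df[symmetric] by (rule emeasure_density[symmetric]) auto
    also have "\<dots> \<le> ennreal c * emeasure \<nu> B0" by (rule \<eta>le[OF B0])
    finally have "ennreal c * emeasure \<nu> B0 + (\<integral>\<^sup>+z. (f z - ennreal c) * indicator B0 z \<partial>\<nu>)
        = ennreal c * emeasure \<nu> B0 + 0"
      by (intro antisym) (simp_all add: add.commute)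
    moreover have "ennreal c * emeasure \<nu> B0 \<noteq> top"
      by (simp add: \<nu>.emeasure_eq_measure ennreal_mult_eq_top_iff)
    ultimately have "(\<integral>\<^sup>+z. (f z - ennreal c) * indicator B0 z \<partial>\<nu>) = 0"
      unfolding ennreal_add_left_cancel infinity_ennreal_def by blast
    then have "AE z in \<nu>. (f z - ennreal c) * indicator B0 z = 0"
      by (subst (asm) nn_integral_0_iff_AE) auto
    then show ?thesis
      by eventually_elim (auto simp: B0_def indicator_def diff_eq_0_iff_ennreal not_less split: if_splits)
  qed
  define g where "g z = min c (enn2real (f z))" for z
  have gm[measurable]: "g \<in> borel_measurable borel" unfolding g_def[abs_def] by measurable
  have g0: "0 \<le> g z" and gc: "g z \<le> c" for z using c0 by (auto simp: g_def)
  have fg: "AE z in \<nu>. f z = ennreal (g z)"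
    using \<open>AE z in \<nu>. f z \<le> ennreal c\<close>
  proof eventually_elim
    case (elim z)
    then have "f z < top" using le_less_trans by fastforce
    moreover have "enn2real (f z) \<le> c" using enn2real_mono[OF elim] c0 by simp
    ultimately show ?case by (simp add: g_def min_absorb2)
  qed
  have "(\<integral>s. indicator B (l s) * g (l s) \<partial>M) = (\<integral>s. indicator B (l s) * h s \<partial>M)"
    if B[measurable]: "B \<in> sets borel" for B
  proof -
    have ig: "integrable M (\<lambda>s. indicator B (l s) * g (l s))"
      by (rule integrable_const_bound[where B = c]) (auto simp: indicator_def g0 gc c0 intro!: AE_I2)
    have ih: "integrable M (\<lambda>s. indicator B (l s) * h s)"
      by (rule integrable_const_bound[where B = c]) (auto simp: indicator_def h0 hc c0 intro!: AE_I2)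
    have "ennreal (\<integral>s. indicator B (l s) * h s \<partial>M) = emeasure \<eta> B"
      unfolding \<eta>[OF B] by (rule nn_integral_eq_integral[OF ih, symmetric]) (auto simp: h0)
    also have "\<dots> = (\<integral>\<^sup>+z. f z * indicator B z \<partial>\<nu>)" unfolding df[symmetric] by (rule emeasure_density) auto
    also have "\<dots> = (\<integral>\<^sup>+z. ennreal (indicator B z * g z) \<partial>\<nu>)"
    proof (rule nn_integral_cong_AE)
      show "AE z in \<nu>. f z * indicator B z = ennreal (indicator B z * g z)"
        using fg by eventually_elim (auto simp: indicator_def)
    qed
    also have "\<dots> = (\<integral>\<^sup>+s. ennreal (indicator B (l s) * g (l s)) \<partial>M)"
      unfolding \<nu>_def by (rule nn_integral_distr) measurable
    also have "\<dots> = ennreal (\<integral>s. indicator B (l s) * g (l s) \<partial>M)"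
      by (rule nn_integral_eq_integral[OF ig]) (auto simp: g0)
    finally show ?thesis
      by (subst (asm) ennreal_inj) (auto intro!: Bochner_Integration.integral_nonneg simp: h0 g0)
  qed
  then show thesis using that gm g0 gc by blast
qed

section \<open>The C-numerical range\<close>

context tracial_von_neumann_algebra
begin

lemma integral_eigenvalue_function:
  assumes X: "X \<in> M" "sym_op X" and a: "0 \<le> a" "a \<le> 1"
  shows "(LINT s:{0..a}|lborel. eigenvalue_function \<tau> X s) = initial_integral (lam X) a"
  by (rule set_integral_eq_unit_interval[OF lam_borel[OF X] a]) (use a in \<open>auto simp: lam_def\<close>)

lemma majorizes_iff:
  assumes C: "C \<in> M" "sym_op C" and X: "X \<in> M" "sym_op X"
  shows "majorizes (eigenvalue_function \<tau> C) (eigenvalue_function \<tau> X) \<longleftrightarrow>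
    (\<forall>a\<in>{0..1}. initial_integral (lam X) a \<le> initial_integral (lam C) a) \<and>
    tr X = tr C"
proof -
  have "(LINT s:{0..1}|lborel. eigenvalue_function \<tau> X s) = tr X" if "X \<in> M" "sym_op X" for X
  proof -
    have "initial_integral (lam X) 1 = (\<integral>s. lam X s \<partial>unit_interval)"
      by (rule Bochner_Integration.integral_cong) (auto simp: indicator_def)
    then show ?thesis using integral_eigenvalue_function[OF that, of 1] tr_eq_integral_lam[OF that] by simp
  qed
  then show ?thesis unfolding majorizes_def using integral_eigenvalue_function C X by auto
qed

lemma integrable_indicator_mult:
  assumes h: "h \<in> borel_measurable borel" "\<And>s. \<bar>h s\<bar> \<le> c" and B: "B \<in> sets borel"
  shows "integrable unit_interval (\<lambda>s. indicator B s * h s :: real)"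
proof (rule integrable_unit_interval[where c = c])
  show "\<bar>indicator B s * h s\<bar> \<le> c" for s
    using h(2)[of s] by (auto simp: indicator_def)
qed (intro measurable_unit_interval borel_measurable_times borel_measurable_indicator B h)

text \<open>
  The layer-cake inequality for \<open>X\<close> and \<open>h\<close>, and for \<open>-X\<close> and \<open>-h\<close>.
\<close>

lemma tr_compose_eq_integral:
  assumes T: "T \<in> M" "pos_op T" and X: "X \<in> M" "sym_op X"
    and h: "h \<in> borel_measurable borel" "\<And>s. \<bar>h s\<bar> \<le> c"
    and eq: "\<And>t. tr (upper_proj T t o\<^sub>L X) = initial_integral h (tr (upper_proj T t))"
  shows "tr (T o\<^sub>L X) = (\<integral>s. lam T s * h s \<partial>unit_interval)"
proof (rule antisym)
  show "tr (T o\<^sub>L X) \<le> (\<integral>s. lam T s * h s \<partial>unit_interval)"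
    by (rule tr_compose_le_integral[OF T X h]) (simp add: eq)
  have "tr (T o\<^sub>L (- X)) \<le> (\<integral>s. lam T s * - h s \<partial>unit_interval)"
  proof (rule tr_compose_le_integral[OF T M_minus[OF X(1)] sym_op_intros(4)[OF X(2)], where c = c])
    show "(\<lambda>s. - h s) \<in> borel_measurable borel" using h(1) by measurable
    show "\<bar>- h s\<bar> \<le> c" for s using h(2) by simp
    show "tr (upper_proj T t o\<^sub>L - X) \<le> (\<integral>s. indicator {..<tr (upper_proj T t)} s * - h s \<partial>unit_interval)" for t
      using eq[of t] M_upper_proj[OF T(1) pos_op_sym[OF T(2)], of t] X
      by (simp add: compose_diff tr_minus M_compose)
  qed
  then show "(\<integral>s. lam T s * h s \<partial>unit_interval) \<le> tr (T o\<^sub>L X)"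
    using T X by (simp add: compose_diff tr_minus M_compose)
qed

lemma integral_reflect_lessThan:
  fixes h :: "real \<Rightarrow> real"
  assumes h: "h \<in> borel_measurable borel" "\<And>s. \<bar>h s\<bar> \<le> c" and a: "0 \<le> a" "a \<le> 1"
  shows "(\<integral>s. indicator {..<a} s * h (1 - s) \<partial>unit_interval)
    = (\<integral>s. h s \<partial>unit_interval) - initial_integral h (1 - a)"
proof -
  note [measurable] = h(1)
  have "(\<integral>s. indicator {..<a} s * h (1 - s) \<partial>unit_interval) = (\<integral>s. indicator {1 - a<..} s * h s \<partial>unit_interval)"
    using integral_unit_interval_reflect[of "\<lambda>s. indicator {1 - a<..} s * h s"]
    by (simp add: indicator_def)
  also have "\<dots> = (\<integral>s. indicator {1 - a..} s * h s \<partial>unit_interval)"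
  proof (rule integral_cong_AE)
    have "AE s in lborel. s \<noteq> 1 - a" by (rule AE_lborel_singleton)
    then have "AE s in unit_interval. s \<noteq> 1 - a"
      unfolding unit_interval_def by (subst AE_restrict_space_iff) auto
    then show "AE s in unit_interval. indicator {1 - a<..} s * h s = indicator {1 - a..} s * h s"
      by eventually_elim (auto simp: indicator_def)
  qed (intro measurable_unit_interval, measurable)+
  also have "\<dots> = (\<integral>s. indicator UNIV s * h s - indicator {..<1 - a} s * h s \<partial>unit_interval)"
    by (rule Bochner_Integration.integral_cong) (auto simp: indicator_def)
  also have "\<dots> = (\<integral>s. indicator UNIV s * h s \<partial>unit_interval) - initial_integral h (1 - a)"
    by (rule Bochner_Integration.integral_diff) (intro integrable_indicator_mult[OF h]; simp)+
  finally show ?thesis by simp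
qed

text \<open>
  The lower bound uses complementary projections:
  \<open>-\<tau>(P\<^sub>tX) = \<tau>((1 - P\<^sub>t)X) - \<tau>(C)\<close> is at most minus the integral of \<open>\<lambda>\<^sub>C\<close> over \<open>[1 - \<tau>(P\<^sub>t), 1]\<close>.
\<close>

lemma tr_compose_bounds:
  assumes T: "T \<in> M" "pos_op T" and C: "C \<in> M" "sym_op C" and X: "X \<in> M" "sym_op X"
    and maj_CX: "majorizes (eigenvalue_function \<tau> C) (eigenvalue_function \<tau> X)"
  shows "tr (T o\<^sub>L X) \<le> (\<integral>s. lam T s * lam C s \<partial>unit_interval)"
    and "(\<integral>s. lam T s * lam C (1 - s) \<partial>unit_interval) \<le> tr (T o\<^sub>L X)"
proof -
  note Ts = pos_op_sym[OF T(2)]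
  note [measurable] = lam_borel[OF C]
  have maj: "initial_integral (lam X) a \<le> initial_integral (lam C) a"
    if "0 \<le> a" "a \<le> 1" for a
    using maj_CX that unfolding majorizes_iff[OF C X] by auto
  have trXC: "tr X = tr C" using maj_CX unfolding majorizes_iff[OF C X] by blast
  have up: "tr (P o\<^sub>L X) \<le> initial_integral (lam C) (tr P)" if P: "proj_op P" "P \<in> M" for P
    using tr_proj_compose_le_integral[OF X P] maj[OF tr_proj_bounds[OF P]] by simp
  have P: "proj_op (upper_proj T t)" "upper_proj T t \<in> M" for t
    using upper_proj_proj_op[OF Ts] M_upper_proj[OF T(1) Ts] by auto
  show "tr (T o\<^sub>L X) \<le> (\<integral>s. lam T s * lam C s \<partial>unit_interval)"
    by (rule tr_compose_le_integral[OF T X lam_borel[OF C] abs_lam_le[OF C]]) (rule up[OF P])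
  have "tr (T o\<^sub>L (- X)) \<le> (\<integral>s. lam T s * - lam C (1 - s) \<partial>unit_interval)"
  proof (rule tr_compose_le_integral[OF T M_minus[OF X(1)] sym_op_intros(4)[OF X(2)], where c = "norm C"])
    show "(\<lambda>s. - lam C (1 - s)) \<in> borel_measurable borel" by measurable
    show "\<bar>- lam C (1 - s)\<bar> \<le> norm C" for s using abs_lam_le[OF C] by simp
    fix t
    let ?P = "upper_proj T t"
    have "tr ((id_blinfun - ?P) o\<^sub>L X) \<le> initial_integral (lam C) (1 - tr ?P)"
      using up[OF proj_op_complement[OF P(1)] M_diff[OF M_id P(2)]] by (simp add: tr_diff M_id P tr_one)
    then have "- tr (?P o\<^sub>L X) \<le> - ((\<integral>s. lam C s \<partial>unit_interval) - initial_integral (lam C) (1 - tr ?P))"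
      using trXC by (simp add: compose_diff tr_diff M_compose P X tr_eq_integral_lam[OF C])
    also have "\<dots> = - (\<integral>s. indicator {..<tr ?P} s * lam C (1 - s) \<partial>unit_interval)"
      using integral_reflect_lessThan[OF lam_borel[OF C] abs_lam_le[OF C] tr_proj_bounds[OF P]] by simp
    finally show "tr (?P o\<^sub>L - X) \<le> (\<integral>s. indicator {..<tr ?P} s * - lam C (1 - s) \<partial>unit_interval)"
      by (simp add: compose_diff tr_minus M_compose P X)
  qed
  then show "(\<integral>s. lam T s * lam C (1 - s) \<partial>unit_interval) \<le> tr (T o\<^sub>L X)"
    using T X by (simp add: compose_diff tr_minus M_compose)
qed

text \<open>
  \<open>X = g(T)\<close>, where \<open>g \<circ> \<lambda>\<^sub>T\<close> is the conditional expectation of \<open>h\<close> given \<open>\<lambda>\<^sub>T\<close>.  Two estimates give the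
  majorization: the excess integral of \<open>\<lambda>\<^sub>X\<close> is at most that of \<open>g \<circ> \<lambda>\<^sub>T\<close>, which by Jensen's
  inequality is at most that of \<open>h\<close>.
\<close>

lemma majorized_operator_exists:
  assumes T: "T \<in> M" "pos_op T" and C: "C \<in> M" "pos_op C"
    and h: "h \<in> borel_measurable borel" "\<And>s. 0 \<le> h s" "\<And>s. h s \<le> c"
    and h_int: "(\<integral>s. h s \<partial>unit_interval) = tr C"
    and h_maj: "\<And>r. excess_integral h r \<le> excess_integral (lam C) r"
  obtains X where "X \<in> M" "sym_op X" "majorizes (eigenvalue_function \<tau> C) (eigenvalue_function \<tau> X)"
    "tr (T o\<^sub>L X) = (\<integral>s. lam T s * h s \<partial>unit_interval)"
proof -
  note Ts = pos_op_sym[OF T(2)] and Cs = pos_op_sym[OF C(2)]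
  note lT = lam_borel[OF T(1) Ts]
  note [measurable] = h(1) lT
  have habs: "\<bar>h s\<bar> \<le> c" for s using h(2,3) by simp
  obtain g where g[measurable]: "g \<in> borel_measurable borel" and g0: "\<And>z. 0 \<le> g z" and gc: "\<And>z. g z \<le> c"
    and ge: "\<And>B. B \<in> sets borel \<Longrightarrow>
      (\<integral>s. indicator B (lam T s) * g (lam T s) \<partial>unit_interval) = (\<integral>s. indicator B (lam T s) * h s \<partial>unit_interval)"
    using bounded_conditional_expectation[OF finite_measure_unit_interval measurable_unit_interval[OF lT]
        measurable_unit_interval[OF h(1)] h(2,3)] by blast
  have gb: "bounded_borel g" by (rule bounded_borelI[OF g, where c = c]) (use g0 gc in simp)
  define X where "X = fun_calc T g"
  have XM: "X \<in> M" unfolding X_def by (rule M_fun_calc[OF T(1) Ts gb])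
  have Xs: "sym_op X" unfolding X_def by (rule sym_fun_calc[OF Ts gb])
  have trX: "tr X = tr C"
  proof -
    have "tr X = (\<integral>s. g (lam T s) \<partial>unit_interval)" unfolding X_def by (rule tr_fun_calc[OF T(1) Ts gb])
    also have "\<dots> = (\<integral>s. h s \<partial>unit_interval)" using ge[of UNIV] by simp
    finally show ?thesis using h_int by simp
  qed
  have pp: "excess_integral (lam X) r \<le> excess_integral (lam C) r" for r
  proof -
    have "excess_integral (lam X) r \<le> excess_integral (\<lambda>s. g (lam T s)) r"
      using tr_proj_compose_fun_calc_le[OF T(1) Ts upper_proj_proj_op[OF Xs] M_upper_proj[OF XM Xs] gb, of r r]
        integral_positive_part_lam[OF XM Xs, of r] by (simp add: X_def)
    also have "\<dots> \<le> excess_integral h r"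
    proof -
      \<comment> \<open>Jensen's inequality for \<open>z \<mapsto> (z - r)\<^sub>+\<close>: conditioning is exact on the event \<open>g > r\<close>.\<close>
      define B where "B = {z \<in> space borel. r < g z}"
      have B[measurable]: "B \<in> sets borel" unfolding B_def by measurable
      have i: "integrable unit_interval (\<lambda>s. indicator B (lam T s) * k s)"
        if [measurable]: "k \<in> borel_measurable borel" and k: "\<And>s. \<bar>k s\<bar> \<le> d" for k :: "real \<Rightarrow> real" and d
      proof (rule integrable_unit_interval[where c = d])
        show "\<bar>indicator B (lam T s) * k s\<bar> \<le> d" for s using k[of s] by (auto simp: indicator_def)
      qed (intro measurable_unit_interval, measurable)
      have gi: "integrable unit_interval (\<lambda>s. indicator B (lam T s) * g (lam T s))"
        by (rule i[of "\<lambda>s. g (lam T s)" c]) (use g0 gc in auto)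
      have hi: "integrable unit_interval (\<lambda>s. indicator B (lam T s) * h s)" by (rule i[OF h(1) habs])
      have ri: "integrable unit_interval (\<lambda>s. indicator B (lam T s) * r)" by (rule i[of "\<lambda>s. r" "\<bar>r\<bar>"]) auto
      have "excess_integral (\<lambda>s. g (lam T s)) r = (\<integral>s. indicator B (lam T s) * g (lam T s) - indicator B (lam T s) * r \<partial>unit_interval)"
        by (rule Bochner_Integration.integral_cong) (auto simp: B_def indicator_def)
      also have "\<dots> = (\<integral>s. indicator B (lam T s) * h s \<partial>unit_interval) - (\<integral>s. indicator B (lam T s) * r \<partial>unit_interval)"
        by (simp only: Bochner_Integration.integral_diff[OF gi ri] ge[OF B])
      also have "\<dots> = (\<integral>s. indicator B (lam T s) * h s - indicator B (lam T s) * r \<partial>unit_interval)"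
        by (rule Bochner_Integration.integral_diff[OF hi ri, symmetric])
      also have "\<dots> \<le> excess_integral h r"
      proof (rule integral_mono[OF Bochner_Integration.integrable_diff[OF hi ri]])
        show "integrable unit_interval (\<lambda>s. max (h s - r) 0)"
        proof (rule integrable_unit_interval[where c = "c + \<bar>r\<bar>"])
          show "\<bar>max (h s - r) 0\<bar> \<le> c + \<bar>r\<bar>" for s by (rule abs_max_diff_le[OF habs])
        qed (intro measurable_unit_interval, measurable)
      qed (auto simp: indicator_def)
      finally show ?thesis .
    qed
    also note h_maj
    finally show ?thesis .
  qed
  have "majorizes (eigenvalue_function \<tau> C) (eigenvalue_function \<tau> X)"
    unfolding majorizes_iff[OF C(1) Cs XM Xs]
  proof (intro conjI ballI trX)
    fix a :: real assume "a \<in> {0..1}"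
    then have a: "0 \<le> a" "a \<le> 1" by auto
    obtain r where r: "initial_integral (lam C) a = r * a + excess_integral (lam C) r"
      using integral_lam_attained[OF C(1) Cs a] by blast
    show "initial_integral (lam X) a \<le> initial_integral (lam C) a"
      unfolding r using integral_lam_le[OF XM Xs a, of r] pp[of r] by simp
  qed
  moreover have "tr (T o\<^sub>L X) = (\<integral>s. lam T s * h s \<partial>unit_interval)"
  proof (rule tr_compose_eq_integral[OF T XM Xs h(1) habs])
    fix t
    have bi: "bounded_borel (indicator {t<..} :: real \<Rightarrow> real)" by (simp add: bounded_borel_indicator)
    have "upper_proj T t o\<^sub>L X = fun_calc T (\<lambda>z. indicator {t<..} z * g z)"
      unfolding X_def
      by (rule blinfun_eqI) (use fun_calc_mult[OF Ts bi _ gb] in \<open>simp add: fun_calc_greaterThan[OF Ts]\<close>)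
    then have "tr (upper_proj T t o\<^sub>L X) = (\<integral>s. indicator {t<..} (lam T s) * g (lam T s) \<partial>unit_interval)"
      using tr_fun_calc[OF T(1) Ts bounded_borel_mult[OF bi gb]] by simp
    also have "\<dots> = (\<integral>s. indicator {t<..} (lam T s) * h s \<partial>unit_interval)" by (rule ge) simp
    also have "\<dots> = initial_integral h (tr (upper_proj T t))"
      by (rule Bochner_Integration.integral_cong) (auto simp: indicator_def less_lam_iff[OF T(1) Ts])
    finally show "tr (upper_proj T t o\<^sub>L X) = initial_integral h (tr (upper_proj T t))" .
  qed
  ultimately show thesis using that XM Xs by blast
qed

text \<open>
  A point of the interval is a convex combination of the end points with some weight \<open>u\<close>; the same
  combination \<open>h\<close> of \<open>\<lambda>\<^sub>C\<close> and its reflection is realised by an operator.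
\<close>

lemma C_numerical_range_eq:
  assumes T: "T \<in> M" "pos_op T" and C: "C \<in> M" "pos_op C"
  shows "C_numerical_range M \<tau> C T = complex_of_real `
    {(\<integral>s. lam T s * lam C (1 - s) \<partial>unit_interval) .. (\<integral>s. lam T s * lam C s \<partial>unit_interval)}"
    (is "_ = complex_of_real ` {?L .. ?U}")
proof (intro equalityI subsetI)
  note Ts = pos_op_sym[OF T(2)] and Cs = pos_op_sym[OF C(2)]
  fix v assume "v \<in> C_numerical_range M \<tau> C T"
  then obtain X where v: "v = \<tau> (T o\<^sub>L X)" and X: "X \<in> M" "sym_op X"
    and maj: "majorizes (eigenvalue_function \<tau> C) (eigenvalue_function \<tau> X)"
    unfolding C_numerical_range_def selfadjoint_part_iff by blast
  have "v = complex_of_real (tr (T o\<^sub>L X))" unfolding v by (rule tau_compose_real[OF T(1) Ts X])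
  then show "v \<in> complex_of_real ` {?L .. ?U}" using tr_compose_bounds[OF T C(1) Cs X maj] by auto
next
  note Ts = pos_op_sym[OF T(2)] and Cs = pos_op_sym[OF C(2)]
  note lC = lam_borel[OF C(1) Cs]
  note [measurable] = lC
  fix v assume "v \<in> complex_of_real ` {?L .. ?U}"
  then obtain w where w: "v = complex_of_real w" "?L \<le> w" "w \<le> ?U" by auto
  have "w \<in> closed_segment ?L ?U" using w by (simp add: closed_segment_eq_real_ivl)
  then obtain u where u: "0 \<le> u" "u \<le> 1" "w = (1 - u) * ?L + u * ?U"
    by (auto simp: closed_segment_def)
  define h where "h s = (1 - u) * lam C (1 - s) + u * lam C s" for s
  have hm: "h \<in> borel_measurable borel" unfolding h_def[abs_def] by measurable
  have h0: "0 \<le> h s" for s unfolding h_def using u by (intro add_nonneg_nonneg mult_nonneg_nonneg lam_nonneg C) auto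
  have hc: "h s \<le> norm C" for s
    unfolding h_def using abs_lam_le[OF C(1) Cs] u by (intro convex_bound_le) (auto simp: abs_le_iff)
  have i: "integrable unit_interval (\<lambda>s. k (lam C s))" "integrable unit_interval (\<lambda>s. k (lam C (1 - s)))"
    and r: "(\<integral>s. k (lam C (1 - s)) \<partial>unit_interval) = (\<integral>s. k (lam C s) \<partial>unit_interval)"
    if [measurable]: "k \<in> borel_measurable borel" and b: "\<And>z. \<bar>z\<bar> \<le> norm C \<Longrightarrow> \<bar>k z\<bar> \<le> d" for k :: "real \<Rightarrow> real" and d
  proof -
    show "integrable unit_interval (\<lambda>s. k (lam C s))" "integrable unit_interval (\<lambda>s. k (lam C (1 - s)))"
      by (rule integrable_unit_interval[where c = d];
          (intro measurable_unit_interval, measurable | intro b abs_lam_le C Cs))+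
    show "(\<integral>s. k (lam C (1 - s)) \<partial>unit_interval) = (\<integral>s. k (lam C s) \<partial>unit_interval)"
      by (rule integral_unit_interval_reflect[of "\<lambda>s. k (lam C s)"]) measurable
  qed
  note i1 = i[of "\<lambda>z. z" "norm C", simplified] and r1 = r[of "\<lambda>z. z" "norm C", simplified]
  have h_int: "(\<integral>s. h s \<partial>unit_interval) = tr C"
    unfolding h_def using i1 r1 by (simp add: tr_eq_integral_lam[OF C(1) Cs] algebra_simps)
  have h_maj: "excess_integral h r \<le> excess_integral (lam C) r" for r
  proof -
    have km: "(\<lambda>z::real. max (z - r) 0) \<in> borel_measurable borel" by measurable
    note i2 = i[OF km abs_max_diff_le]
    have r2: "(\<integral>s. max (lam C (1 - s) - r) 0 \<partial>unit_interval) = excess_integral (lam C) r"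
      by (rule r[OF km abs_max_diff_le])
    have "excess_integral h r
      \<le> (\<integral>s. (1 - u) * max (lam C (1 - s) - r) 0 + u * max (lam C s - r) 0 \<partial>unit_interval)"
    proof (rule integral_mono)
      show "integrable unit_interval (\<lambda>s. max (h s - r) 0)"
      proof (rule integrable_unit_interval[where c = "norm C + \<bar>r\<bar>"])
        show "\<bar>max (h s - r) 0\<bar> \<le> norm C + \<bar>r\<bar>" for s
          by (rule abs_max_diff_le) (use h0[of s] hc[of s] in simp)
      qed (intro measurable_unit_interval, use hm in measurable)
      show "integrable unit_interval (\<lambda>s. (1 - u) * max (lam C (1 - s) - r) 0 + u * max (lam C s - r) 0)"
        by (intro Bochner_Integration.integrable_add integrable_mult_right i2)
      fix s
      have "h s - r = (1 - u) * (lam C (1 - s) - r) + u * (lam C s - r)" by (simp add: h_def algebra_simps)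
      also have "\<dots> \<le> (1 - u) * max (lam C (1 - s) - r) 0 + u * max (lam C s - r) 0"
        using u by (intro add_mono mult_left_mono) auto
      finally show "max (h s - r) 0 \<le> (1 - u) * max (lam C (1 - s) - r) 0 + u * max (lam C s - r) 0"
        using u by simp
    qed
    also have "\<dots> = (1 - u) * (\<integral>s. max (lam C (1 - s) - r) 0 \<partial>unit_interval) + u * excess_integral (lam C) r"
      by (simp only: Bochner_Integration.integral_add[OF integrable_mult_right[OF i2(2)] integrable_mult_right[OF i2(1)]]
          integral_mult_right_zero)
    also have "\<dots> = excess_integral (lam C) r"
      unfolding r2 by (simp add: algebra_simps)
    finally show ?thesis .
  qed
  obtain X where X: "X \<in> M" "sym_op X" "majorizes (eigenvalue_function \<tau> C) (eigenvalue_function \<tau> X)"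
    and TX: "tr (T o\<^sub>L X) = (\<integral>s. lam T s * h s \<partial>unit_interval)"
    using majorized_operator_exists[OF T C hm h0 hc h_int h_maj] by blast
  have j: "integrable unit_interval (\<lambda>s. lam T s * lam C (1 - s))" "integrable unit_interval (\<lambda>s. lam T s * lam C s)"
    by (rule integrable_lam_mult[OF T(1) Ts, where c = "norm C"]; use abs_lam_le[OF C(1) Cs] in measurable)+
  have "(\<integral>s. lam T s * h s \<partial>unit_interval)
    = (\<integral>s. (1 - u) * (lam T s * lam C (1 - s)) + u * (lam T s * lam C s) \<partial>unit_interval)"
    by (rule Bochner_Integration.integral_cong) (auto simp: h_def algebra_simps)
  also have "\<dots> = w"
    by (simp only: Bochner_Integration.integral_add[OF integrable_mult_right[OF j(1)] integrable_mult_right[OF j(2)]]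
        integral_mult_right_zero u(3))
  finally have "v = \<tau> (T o\<^sub>L X)" using w(1) TX tau_compose_real[OF T(1) Ts X(1,2)] by simp
  then show "v \<in> C_numerical_range M \<tau> C T"
    unfolding C_numerical_range_def selfadjoint_part_iff using X by blast
qed

lemma integral_eigenvalue_functions:
  assumes T: "T \<in> M" "sym_op T" and C: "C \<in> M" "sym_op C"
  shows "(LINT s:{0..1}|lborel. eigenvalue_function \<tau> T s * eigenvalue_function \<tau> C s)
      = (\<integral>s. lam T s * lam C s \<partial>unit_interval)"
    and "(LINT s:{0..1}|lborel. eigenvalue_function \<tau> T s * eigenvalue_function \<tau> C (1 - s))
      = (\<integral>s. lam T s * lam C (1 - s) \<partial>unit_interval)"
proof -
  note [measurable] = lam_borel[OF T] lam_borel[OF C]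
  have one: "(\<integral>s. indicator {..<1} s * f s \<partial>unit_interval) = (\<integral>s. f s \<partial>unit_interval)" for f :: "real \<Rightarrow> real"
    by (rule Bochner_Integration.integral_cong) (auto simp: indicator_def)
  have m: "(\<lambda>s. lam T s * lam C s) \<in> borel_measurable borel"
    "(\<lambda>s. lam T s * lam C (1 - s)) \<in> borel_measurable borel" by measurable
  show "(LINT s:{0..1}|lborel. eigenvalue_function \<tau> T s * eigenvalue_function \<tau> C s)
      = (\<integral>s. lam T s * lam C s \<partial>unit_interval)"
    by (subst set_integral_eq_unit_interval[OF m(1)]) (simp_all add: one, simp add: lam_def)
  show "(LINT s:{0..1}|lborel. eigenvalue_function \<tau> T s * eigenvalue_function \<tau> C (1 - s))
      = (\<integral>s. lam T s * lam C (1 - s) \<partial>unit_interval)"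
    by (subst set_integral_eq_unit_interval[OF m(2)]) (simp_all add: one, simp add: lam_def)
qed

end

theorem proposition3p1:
  fixes M :: "('h::complex_hilbert_space \<Rightarrow>\<^sub>L 'h) set"
    and \<tau> :: "('h \<Rightarrow>\<^sub>L 'h) \<Rightarrow> complex"
    and T C :: "'h \<Rightarrow>\<^sub>L 'h"
  assumes "tracial_von_neumann_algebra M \<tau>"
    and "T \<in> M" and "positive_op T"
    and "C \<in> M" and "positive_op C"
  shows "C_numerical_range M \<tau> C T =
    complex_of_real `
      {(LINT s:{0..1}|lborel. eigenvalue_function \<tau> T s * eigenvalue_function \<tau> C (1 - s)) ..
       (LINT s:{0..1}|lborel. eigenvalue_function \<tau> T s * eigenvalue_function \<tau> C s)}"
proof -
  interpret tracial_von_neumann_algebra M \<tau> by fact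
  have T: "pos_op T" and C: "pos_op C" using assms by (simp_all add: positive_op_iff)
  show ?thesis
    unfolding integral_eigenvalue_functions[OF \<open>T \<in> M\<close> pos_op_sym[OF T] \<open>C \<in> M\<close> pos_op_sym[OF C]]
    by (rule C_numerical_range_eq[OF \<open>T \<in> M\<close> T \<open>C \<in> M\<close> C])
qed

end
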